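(* The nonsymmetric operad $\mathrm{ncHyperCom}$ is Koszul. All its components are concentrated in even non-negative degrees, and, for $n\ge 2$, the dimension of the graded component of degree $2k$ of $\mathrm{ncHyperCom}(n)$ is equal to the Narayana number $\frac{1}{n-1}\binom{n-1}{k}\binom{n-1}{k+1}$. In particular, the dimension of $\mathrm{ncHyperCom}(n)$ is equal to the Catalan number $\frac1n\binom{2n-2}{n-1}$.
   Context: All operads are nonsymmetric (ns), in graded vector spaces over a field. $\mathrm{ncHyperCom}$ is the ns operad with generators $\nu_k$ of arity $k$ and degree $2k-4$, $k\ge2$, and quadratic relations $$\sum_{j=2}^{i}\nu_{n-j+1}\circ_{i-j+1}\nu_j=\sum_{k=2}^{n-i+1}\nu_{n-k+1}\circ_i\nu_k,\qquad n\ge 3,\ 2\le i\le n-1 .$$ (In the paper it is introduced as the Koszul dual of the operadic suspension of the operad $\mathrm{ncGrav}$ of noncommutative gravity algebras; this is its presentation.) Koszulness refers to this quadratic presentation. *)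

theory Defs
  imports Complex_Main "HOL-Library.Poly_Mapping"
begin

section \<open>Formal linear combinations\<close>

definition pm_scale :: "'k::field \<Rightarrow> ('t \<Rightarrow>\<^sub>0 'k) \<Rightarrow> ('t \<Rightarrow>\<^sub>0 'k)" (infixr \<open>*\<^sub>p\<close> 75)
  where "c *\<^sub>p f = Poly_Mapping.map ((*) c) f"

definition lin_ext :: "('s \<Rightarrow> ('t \<Rightarrow>\<^sub>0 'k::field)) \<Rightarrow> ('s \<Rightarrow>\<^sub>0 'k) \<Rightarrow> ('t \<Rightarrow>\<^sub>0 'k)"
  where "lin_ext F f = (\<Sum>s\<in>Poly_Mapping.keys f. Poly_Mapping.lookup f s *\<^sub>p F s)"

abbreviation push :: "('s \<Rightarrow> 't) \<Rightarrow> ('s \<Rightarrow>\<^sub>0 'k::field) \<Rightarrow> ('t \<Rightarrow>\<^sub>0 'k)"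
  where "push F \<equiv> lin_ext (\<lambda>s. Poly_Mapping.single (F s) 1)"

text \<open>\<open>quot_dim V W d\<close>: the quotient space \<open>V / (V \<inter> W)\<close> has finite dimension \<open>d\<close>,
  i.e. there are \<open>d\<close> elements of \<open>V\<close> whose classes form a basis of it.\<close>

definition quot_dim :: "('t \<Rightarrow>\<^sub>0 'k::field) set \<Rightarrow> ('t \<Rightarrow>\<^sub>0 'k) set \<Rightarrow> nat \<Rightarrow> bool"
  where "quot_dim V W d \<longleftrightarrow>
    (\<exists>B. finite B \<and> card B = d \<and> B \<subseteq> V \<and>
         (\<forall>v\<in>V. \<exists>c. v - (\<Sum>b\<in>B. c b *\<^sub>p b) \<in> W) \<and>
         (\<forall>c. (\<Sum>b\<in>B. c b *\<^sub>p b) \<in> W \<longrightarrow> (\<forall>b\<in>B. c b = 0)))"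

definition ksign :: "int \<Rightarrow> 'k::field"
  where "ksign m = (if even m then 1 else - 1)"


section \<open>Planar trees\<close>

datatype 'x ptree = Leaf | Node 'x "'x ptree list"

text \<open>The tree \<open>Leaf\<close> (one leaf, no vertex) stands for the operadic unit.\<close>

primrec leaves :: "'x ptree \<Rightarrow> nat"
  where
    "leaves Leaf = 1"
  | "leaves (Node x ts) = sum_list (map leaves ts)"

primrec vertices :: "'x ptree \<Rightarrow> nat"
  where
    "vertices Leaf = 0"
  | "vertices (Node x ts) = Suc (sum_list (map vertices ts))"

primrec tdeg :: "('x \<Rightarrow> int) \<Rightarrow> 'x ptree \<Rightarrow> int"
  where
    "tdeg dg Leaf = 0"
  | "tdeg dg (Node x ts) = dg x + sum_list (map (tdeg dg) ts)"

inductive_set trees :: "'x set \<Rightarrow> ('x \<Rightarrow> nat) \<Rightarrow> 'x ptree set"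
  for G :: "'x set" and ar :: "'x \<Rightarrow> nat"
  where
    Leaf: "Leaf \<in> trees G ar"
  | Node: "\<lbrakk>x \<in> G; length ts = ar x; \<And>t. t \<in> set ts \<Longrightarrow> t \<in> trees G ar\<rbrakk> \<Longrightarrow> Node x ts \<in> trees G ar"

text \<open>\<open>graft s i t\<close> identifies the root of \<open>t\<close> with the \<open>i\<close>-th leaf of \<open>s\<close>, counted from the
  left starting with 1; it is meaningful for \<open>1 \<le> i \<le> leaves s\<close>.\<close>

fun graft :: "'x ptree \<Rightarrow> nat \<Rightarrow> 'x ptree \<Rightarrow> 'x ptree"
  and graft_list :: "'x ptree list \<Rightarrow> nat \<Rightarrow> 'x ptree \<Rightarrow> 'x ptree list"
  where
    "graft Leaf i t = t"
  | "graft (Node x ss) i t = Node x (graft_list ss i t)"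
  | "graft_list [] i t = []"
  | "graft_list (s # ss) i t =
      (if i \<le> leaves s then graft s i t # ss else s # graft_list ss (i - leaves s) t)"

text \<open>\<open>tail_deg dg s i\<close> is the total degree of the vertices of \<open>s\<close> that come after the \<open>i\<close>-th leaf
  when the tree is read in prefix order (a vertex, then its subtrees from left to right).\<close>

fun tail_deg :: "('x \<Rightarrow> int) \<Rightarrow> 'x ptree \<Rightarrow> nat \<Rightarrow> int"
  and tail_deg_list :: "('x \<Rightarrow> int) \<Rightarrow> 'x ptree list \<Rightarrow> nat \<Rightarrow> int"
  where
    "tail_deg dg Leaf i = 0"
  | "tail_deg dg (Node x ss) i = tail_deg_list dg ss i"
  | "tail_deg_list dg [] i = 0"
  | "tail_deg_list dg (s # ss) i =
      (if i \<le> leaves s then tail_deg dg s i + sum_list (map (tdeg dg) ss)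
       else tail_deg_list dg ss (i - leaves s))"


section \<open>Operads presented by quadratic data\<close>

record (overloaded) ('x, 'k::zero) quadratic_data =
  gens :: "'x set"
  arity :: "'x \<Rightarrow> nat"
  degree :: "'x \<Rightarrow> int"
  rels :: "('x ptree \<Rightarrow>\<^sub>0 'k) set"

text \<open>The free nonsymmetric operad on the graded collection with basis \<open>gens D\<close> has the tree
  monomials as a basis; the monomial of a tree is the tensor product of its labels in prefix order.
  \<open>free_arity D n\<close> is its component of arity \<open>n\<close> and \<open>free_comp D n d\<close> the part of degree \<open>d\<close>.\<close>

definition monomials :: "('x, 'k::zero) quadratic_data \<Rightarrow> 'x ptree set"
  where "monomials D = trees (gens D) (arity D)"

definition free_arity :: "('x, 'k::field) quadratic_data \<Rightarrow> nat \<Rightarrow> ('x ptree \<Rightarrow>\<^sub>0 'k) set"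
  where "free_arity D n = {f. \<forall>t\<in>Poly_Mapping.keys f. t \<in> monomials D \<and> leaves t = n}"

definition free_comp :: "('x, 'k::field) quadratic_data \<Rightarrow> nat \<Rightarrow> int \<Rightarrow> ('x ptree \<Rightarrow>\<^sub>0 'k) set"
  where "free_comp D n d = {f \<in> free_arity D n. \<forall>t\<in>Poly_Mapping.keys f. tdeg (degree D) t = d}"

text \<open>Partial composition \<open>f \<circ>\<^sub>i g\<close>. Bringing \<open>g\<close> to the \<open>i\<close>-th leaf of \<open>f\<close> moves it past the
  labels of \<open>f\<close> that come after this leaf, which gives the Koszul sign.\<close>

definition tree_comp :: "('x \<Rightarrow> int) \<Rightarrow> 'x ptree \<Rightarrow> nat \<Rightarrow> 'x ptree \<Rightarrow> ('x ptree \<Rightarrow>\<^sub>0 'k::field)"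
  where "tree_comp dg s i t =
    Poly_Mapping.single (graft s i t) (ksign (tdeg dg t * tail_deg dg s i))"

definition pcomp :: "('x, 'k::field) quadratic_data \<Rightarrow>
    ('x ptree \<Rightarrow>\<^sub>0 'k) \<Rightarrow> nat \<Rightarrow> ('x ptree \<Rightarrow>\<^sub>0 'k) \<Rightarrow> ('x ptree \<Rightarrow>\<^sub>0 'k)"
  where "pcomp D f i g = lin_ext (\<lambda>s. lin_ext (\<lambda>t. tree_comp (degree D) s i t) g) f"

definition generator :: "('x, 'k::field) quadratic_data \<Rightarrow> 'x \<Rightarrow> ('x ptree \<Rightarrow>\<^sub>0 'k)"
  where "generator D x = Poly_Mapping.single (Node x (replicate (arity D x) Leaf)) 1"

definition is_quadratic :: "('x, 'k::field) quadratic_data \<Rightarrow> bool"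
  where "is_quadratic D \<longleftrightarrow>
    (\<forall>r\<in>rels D. (\<exists>n d. r \<in> free_comp D n d) \<and> (\<forall>t\<in>Poly_Mapping.keys r. vertices t = 2))"

text \<open>The operadic ideal generated by the relations. The presented operad is the quotient of the free
  operad by it.\<close>

inductive_set op_ideal :: "('x, 'k::field) quadratic_data \<Rightarrow> ('x ptree \<Rightarrow>\<^sub>0 'k) set"
  for D :: "('x, 'k::field) quadratic_data"
  where
    rel: "r \<in> rels D \<Longrightarrow> r \<in> op_ideal D"
  | zero: "0 \<in> op_ideal D"
  | add: "\<lbrakk>f \<in> op_ideal D; g \<in> op_ideal D\<rbrakk> \<Longrightarrow> f + g \<in> op_ideal D"
  | scale: "f \<in> op_ideal D \<Longrightarrow> c *\<^sub>p f \<in> op_ideal D"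
  | comp_left: "\<lbrakk>f \<in> op_ideal D; f \<in> free_arity D m; g \<in> free_arity D n; 1 \<le> i; i \<le> m\<rbrakk>
      \<Longrightarrow> pcomp D f i g \<in> op_ideal D"
  | comp_right: "\<lbrakk>g \<in> op_ideal D; g \<in> free_arity D n; f \<in> free_arity D m; 1 \<le> i; i \<le> m\<rbrakk>
      \<Longrightarrow> pcomp D f i g \<in> op_ideal D"

definition arity_dim :: "('x, 'k::field) quadratic_data \<Rightarrow> nat \<Rightarrow> nat \<Rightarrow> bool"
  where "arity_dim D n m \<longleftrightarrow> quot_dim (free_arity D n) (op_ideal D) m"

definition comp_dim :: "('x, 'k::field) quadratic_data \<Rightarrow> nat \<Rightarrow> int \<Rightarrow> nat \<Rightarrow> bool"
  where "comp_dim D n d m \<longleftrightarrow> quot_dim (free_comp D n d) (op_ideal D) m"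


section \<open>Bar construction and Koszulness\<close>

text \<open>Let \<open>F\<close> be the free operad on the generators, \<open>I\<close> the ideal of relations and \<open>P = F / I\<close>; write
  \<open>F\<^sub>+\<close> and \<open>P\<^sub>+\<close> for the parts of positive weight and \<open>s\<close> for the suspension. The bar construction of
  \<open>P\<close> is the cofree conilpotent cooperad on \<open>s P\<^sub>+\<close>, that is, the space of trees with vertices
  decorated by \<open>s P\<^sub>+\<close>, with the differential contracting internal edges. By right exactness of the
  tensor product this is the space of trees decorated by \<open>s F\<^sub>+\<close>, which has as basis the trees
  labelled by nontrivial tree monomials, modulo the subspace \<open>bar_ideal\<close> spanned by the decorated
  trees with a decoration in \<open>I\<close>. Decorations are again tensored in prefix order.\<close>

definition bar_trees :: "('x, 'k::zero) quadratic_data \<Rightarrow> 'x ptree ptree set"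
  where "bar_trees D = trees (monomials D - {Leaf}) leaves"

definition sdeg :: "('x \<Rightarrow> int) \<Rightarrow> 'x ptree \<Rightarrow> int"
  where "sdeg dg a = tdeg dg a + 1"

text \<open>The weight of a decorated tree is the total number of generators occurring in it.\<close>

definition bar_weight :: "'x ptree ptree \<Rightarrow> int"
  where "bar_weight = tdeg (\<lambda>a. int (vertices a))"

definition bar_comp :: "('x, 'k::field) quadratic_data \<Rightarrow> nat \<Rightarrow> nat \<Rightarrow> nat \<Rightarrow>
    ('x ptree ptree \<Rightarrow>\<^sub>0 'k) set"
  where "bar_comp D n w b =
    {f. \<forall>T\<in>Poly_Mapping.keys f. T \<in> bar_trees D \<and> leaves T = n \<and> bar_weight T = int w \<and> vertices T = b}"

inductive_set bar_ideal :: "('x, 'k::field) quadratic_data \<Rightarrow> ('x ptree ptree \<Rightarrow>\<^sub>0 'k) set"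
  for D :: "('x, 'k::field) quadratic_data"
  where
    root: "\<lbrakk>f \<in> op_ideal D; f \<in> free_arity D (length Ts); Leaf \<notin> Poly_Mapping.keys f; set Ts \<subseteq> bar_trees D\<rbrakk>
      \<Longrightarrow> push (\<lambda>a. Node a Ts) f \<in> bar_ideal D"
  | inner: "\<lbrakk>h \<in> bar_ideal D; a \<in> monomials D - {Leaf}; leaves a = length Ts + length Us + 1;
       set Ts \<subseteq> bar_trees D; set Us \<subseteq> bar_trees D\<rbrakk>
      \<Longrightarrow> push (\<lambda>T. Node a (Ts @ T # Us)) h \<in> bar_ideal D"
  | zero: "0 \<in> bar_ideal D"
  | add: "\<lbrakk>f \<in> bar_ideal D; g \<in> bar_ideal D\<rbrakk> \<Longrightarrow> f + g \<in> bar_ideal D"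
  | scale: "f \<in> bar_ideal D \<Longrightarrow> c *\<^sub>p f \<in> bar_ideal D"

text \<open>Contraction of the edge joining the root of \<open>Node a Ts\<close> to its child in position \<open>i\<close> (counted
  from 0). The label \<open>sb\<close> of the child is first moved past the subtrees to its left, and
  then \<open>sa \<otimes> sb\<close> is sent to \<open>(-1)\<^bsup>|a|\<^esup> s(a \<circ>\<^bsub>i+1\<^esub> b)\<close>.\<close>

definition left_deg :: "('x \<Rightarrow> int) \<Rightarrow> 'x ptree ptree list \<Rightarrow> nat \<Rightarrow> int"
  where "left_deg dg Ts i = sum_list (map (tdeg (sdeg dg)) (take i Ts))"

definition contract_root ::
    "('x \<Rightarrow> int) \<Rightarrow> 'x ptree \<Rightarrow> 'x ptree ptree list \<Rightarrow> nat \<Rightarrow> ('x ptree ptree \<Rightarrow>\<^sub>0 'k::field)"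
  where "contract_root dg a Ts i =
    (case Ts ! i of
       Leaf \<Rightarrow> 0
     | Node b Us \<Rightarrow>
         ksign (sdeg dg b * left_deg dg Ts i + tdeg dg a) *\<^sub>p
         push (\<lambda>c. Node c (take i Ts @ Us @ drop (Suc i) Ts)) (tree_comp dg a (Suc i) b))"

function bar_d_tree :: "('x \<Rightarrow> int) \<Rightarrow> 'x ptree ptree \<Rightarrow> ('x ptree ptree \<Rightarrow>\<^sub>0 'k::field)"
  where
    "bar_d_tree dg Leaf = 0"
  | "bar_d_tree dg (Node a Ts) =
      (\<Sum>i<length Ts. contract_root dg a Ts i) +
      (\<Sum>i<length Ts. ksign (sdeg dg a + left_deg dg Ts i) *\<^sub>p
          push (\<lambda>S. Node a (Ts[i := S])) (bar_d_tree dg (Ts ! i)))"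
  by pat_completeness auto
termination
  by (relation "measure (\<lambda>(dg, T). size T)") (auto simp: less_Suc_eq_le intro: size_list_estimation'[OF nth_mem])

definition bar_d :: "('x, 'k::field) quadratic_data \<Rightarrow>
    ('x ptree ptree \<Rightarrow>\<^sub>0 'k) \<Rightarrow> ('x ptree ptree \<Rightarrow>\<^sub>0 'k)"
  where "bar_d D = lin_ext (bar_d_tree (degree D))"

text \<open>A quadratic operad is Koszul if the homology of its bar construction is concentrated on the
  diagonal, where the number \<open>b\<close> of vertices equals the weight \<open>w\<close> (the diagonal homology being the
  Koszul dual cooperad).\<close>

definition koszul :: "('x, 'k::field) quadratic_data \<Rightarrow> bool"
  where "koszul D \<longleftrightarrow> is_quadratic D \<and>
    (\<forall>n w b. b \<noteq> w \<longrightarrow>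
      (\<forall>x\<in>bar_comp D n w b. bar_d D x \<in> bar_ideal D \<longrightarrow>
        (\<exists>y\<in>bar_comp D n w (Suc b). x - bar_d D y \<in> bar_ideal D)))"


section \<open>The operad ncHyperCom\<close>

text \<open>The generator \<open>\<nu>\<^sub>k\<close> is labelled by \<open>k\<close>. The relations are written with the composition of the free
  operad, which depends on the generators and their degrees only, so they are added in a second step.\<close>

definition nc_free :: "(nat, 'k::field) quadratic_data"
  where "nc_free = \<lparr>gens = {2..}, arity = (\<lambda>k. k), degree = (\<lambda>k. 2 * int k - 4), rels = {}\<rparr>"

definition nu :: "nat \<Rightarrow> (nat ptree \<Rightarrow>\<^sub>0 'k::field)"
  where "nu k = generator nc_free k"

definition nc_rel :: "nat \<Rightarrow> nat \<Rightarrow> (nat ptree \<Rightarrow>\<^sub>0 'k::field)"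
  where "nc_rel n i =
    (\<Sum>j=2..i. pcomp nc_free (nu (n - j + 1)) (i - j + 1) (nu j)) -
    (\<Sum>k=2..n - i + 1. pcomp nc_free (nu (n - k + 1)) i (nu k))"

definition ncHyperCom :: "(nat, 'k::field) quadratic_data"
  where "ncHyperCom = nc_free \<lparr>rels := {nc_rel n i | n i. 3 \<le> n \<and> 2 \<le> i \<and> i \<le> n - 1}\<rparr>"

end

theory Submission
  imports Defs
begin

text \<open>Order tree monomials by the positions of their vertices. The leading term of each relation is then
  its only term with a composition at the first leaf, so the normal monomials are the trees in which every
  first child is a leaf. These are linearly independent modulo the relations because they carry an algebra
  structure: the free algebra on one generator is the space of rose trees, where
  \<open>\<nu> (x u, y\<^sub>1, \<dots>, y\<^sub>m)\<close>, for a generator \<open>x\<close> and a word \<open>u\<close> of rose trees, is computed from the relation with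
  \<open>\<nu> (x, u\<^sub>1, \<dots>, u\<^sub>p) = x u\<close>. Counting rose trees by leaves gives the Narayana numbers.

  For Koszulness, the bar complex has a basis of trees decorated by normal monomials, that is, trees of generators in
  which some edges are cut, including all edges to first children. Up to terms that are larger in
  the order, the differential uncuts edges that do not lead to first children, and toggling the first such edge is an
  acyclic matching. The unmatched trees have all edges cut and lie on the diagonal.\<close>

subsection \<open>Linear combinations\<close>

text \<open>The obstacle is that \<open>op_ideal\<close> and \<open>bar_ideal\<close> are generated
  subspaces. Rewriting shows that normal forms span the quotients, but independence needs linear
  maps that vanish on the ideals. Evaluating a tree on copies of the generator of the free algebra
  gives such a map (\<open>nform\<close>), and using it label by label gives coordinates on the bar
  complex (\<open>coord\<close>). Proving that rose trees satisfy the relations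
  (\<open>nuop_law_holds\<close>) thus takes the place of the confluence check for a Groebner basis.
  All generators have even degree, so compositions carry no sign and the signs of the bar
  differential only count vertices. A tree of arity n with w vertices has degree 2(n - 1 - w), so
  the graded dimensions count rose trees by inner nodes. The order serves twice: rewriting raises it
  and therefore stops, and it makes the differential triangular. It is constant on matched pairs,
  since these have the same underlying tree; a further term of the differential is either again a
  tree with a cut edge to toggle or strictly higher. Elimination along the matching moves every
  cycle onto such trees, on which the differential is injective.\<close>

abbreviation (input) keys :: "('t \<Rightarrow>\<^sub>0 'k::zero) \<Rightarrow> 't set"
  where "keys \<equiv> Poly_Mapping.keys"

abbreviation (input) lookup :: "('t \<Rightarrow>\<^sub>0 'k::zero) \<Rightarrow> 't \<Rightarrow> 'k"
  where "lookup \<equiv> Poly_Mapping.lookup"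

type_synonym 'k tree_vec = "nat ptree \<Rightarrow>\<^sub>0 'k"
type_synonym 'k bar_vec = "nat ptree ptree \<Rightarrow>\<^sub>0 'k"

text \<open>The linear functional with values \<open>\<kappa>\<close> on the basis;
  \<open>lin_ext\<close> is reduced to it coefficient by coefficient and inherits its rules.\<close>

definition ev :: "('s \<Rightarrow> 'k::field) \<Rightarrow> ('s \<Rightarrow>\<^sub>0 'k) \<Rightarrow> 'k"
  where "ev \<kappa> f = (\<Sum>s\<in>keys f. lookup f s * \<kappa> s)"

lemma ev_superset:
  assumes "finite S" "keys f \<subseteq> S"
  shows "ev \<kappa> f = (\<Sum>s\<in>S. lookup f s * \<kappa> s)"
  unfolding ev_def using assms by (intro sum.mono_neutral_left) (auto simp: in_keys_iff)

lemma lookup_pm_scale [simp]: "lookup (c *\<^sub>p f) s = c * lookup f s"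
  unfolding pm_scale_def by (simp add: Poly_Mapping.map.rep_eq when_def)

lemma keys_pm_scale: "keys (c *\<^sub>p f) \<subseteq> keys f"
  by (auto simp: in_keys_iff)

interpretation pm: vector_space "pm_scale :: 'k::field \<Rightarrow> ('t \<Rightarrow>\<^sub>0 'k) \<Rightarrow> ('t \<Rightarrow>\<^sub>0 'k)"
  by standard (auto intro!: poly_mapping_eqI simp: lookup_add algebra_simps)

lemma ev_add: "ev \<kappa> (f + g) = ev \<kappa> f + ev \<kappa> g"
proof -
  let ?S = "keys f \<union> keys g"
  have "finite ?S" "keys (f + g) \<subseteq> ?S" by (auto simp: keys_add)
  then show ?thesis
    by (simp add: ev_superset[of ?S] lookup_add distrib_right sum.distrib)
qed

lemma ev_scale: "ev \<kappa> (c *\<^sub>p f) = c * ev \<kappa> f"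
  unfolding ev_superset[OF finite_keys keys_pm_scale[of c f]]
  unfolding ev_def
  by (simp add: sum_distrib_left mult.assoc)

lemma ev_zero [simp]: "ev \<kappa> 0 = 0"
  by (simp add: ev_def)

lemma ev_single [simp]: "ev \<kappa> (Poly_Mapping.single s c) = c * \<kappa> s"
  by (simp add: ev_superset[of "{s}"])

lemma ev_uminus: "ev \<kappa> (- f) = - ev \<kappa> f"
  by (metis add_eq_0_iff ev_add ev_zero)

lemma ev_diff: "ev \<kappa> (f - g) = ev \<kappa> f - ev \<kappa> g"
  by (metis diff_conv_add_uminus ev_add ev_uminus)

lemma ev_sum: "ev \<kappa> (\<Sum>i\<in>I. f i) = (\<Sum>i\<in>I. ev \<kappa> (f i))"
  by (induction I rule: infinite_finite_induct) (auto simp: ev_add)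

lemma lookup_lin_ext: "lookup (lin_ext F f) t = ev (\<lambda>s. lookup (F s) t) f"
  by (simp add: lin_ext_def ev_def lookup_sum)

lemma lin_ext_add: "lin_ext F (f + g) = lin_ext F f + lin_ext F g"
  by (rule poly_mapping_eqI) (simp add: lookup_lin_ext lookup_add ev_add)

lemma lin_ext_scale: "lin_ext F (c *\<^sub>p f) = c *\<^sub>p lin_ext F f"
  by (rule poly_mapping_eqI) (simp add: lookup_lin_ext ev_scale)

lemma lin_ext_zero [simp]: "lin_ext F 0 = 0"
  by (simp add: lin_ext_def)

lemma lin_ext_single [simp]: "lin_ext F (Poly_Mapping.single s c) = c *\<^sub>p F s"
  by (rule poly_mapping_eqI) (simp add: lookup_lin_ext)

lemma lin_ext_diff: "lin_ext F (f - g) = lin_ext F f - lin_ext F g"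
  by (rule poly_mapping_eqI) (simp add: lookup_lin_ext lookup_minus ev_diff)

lemma lin_ext_sum: "lin_ext F (\<Sum>i\<in>I. f i) = (\<Sum>i\<in>I. lin_ext F (f i))"
  by (induction I rule: infinite_finite_induct) (auto simp: lin_ext_add)

lemma lin_ext_cong: "(\<And>s. s \<in> keys f \<Longrightarrow> F s = G s) \<Longrightarrow> lin_ext F f = lin_ext G f"
  by (simp add: lin_ext_def)

lemma lin_ext_fun_add: "lin_ext (\<lambda>s. F s + G s) f = lin_ext F f + lin_ext G f"
  by (simp add: lin_ext_def pm.scale_right_distrib sum.distrib)

lemma lin_ext_fun_diff: "lin_ext (\<lambda>s. F s - G s) f = lin_ext F f - lin_ext G f"
  by (simp add: lin_ext_def pm.scale_right_diff_distrib sum_subtractf)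

lemma lin_ext_fun_sum: "lin_ext (\<lambda>s. \<Sum>i\<in>I. F i s) f = (\<Sum>i\<in>I. lin_ext (F i) f)"
  by (simp add: lin_ext_def pm.scale_sum_right) (rule sum.swap)

lemma lin_ext_fun_scale: "lin_ext (\<lambda>s. c *\<^sub>p F s) f = c *\<^sub>p lin_ext F f"
  by (simp add: lin_ext_def pm.scale_sum_right mult.commute)

lemma lin_ext_fun_zero [simp]: "lin_ext (\<lambda>s. 0) f = 0"
  by (simp add: lin_ext_def)

lemma lin_ext_lin_ext: "lin_ext F (lin_ext G f) = lin_ext (\<lambda>s. lin_ext F (G s)) f"
  by (simp add: lin_ext_def[of G] lin_ext_def[of "\<lambda>s. lin_ext F (G s)"] lin_ext_sum lin_ext_scale)

lemma lin_ext_swap: "lin_ext (\<lambda>s. lin_ext (F s) g) f = lin_ext (\<lambda>t. lin_ext (\<lambda>s. F s t) f) g"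
  by (simp add: lin_ext_def pm.scale_sum_right mult.commute) (rule sum.swap)

lemma push_push: "push F (push G f) = push (\<lambda>s. F (G s)) f"
  by (simp add: lin_ext_lin_ext)

lemma single_scale: "c *\<^sub>p Poly_Mapping.single s d = Poly_Mapping.single s (c * d)"
  by (rule poly_mapping_eqI) (simp add: lookup_single when_def)

lemma push_id [simp]: "push (\<lambda>s. s) f = f"
  by (rule poly_mapping_eqI)
     (simp add: lookup_lin_ext ev_def lookup_single when_def sum.delta' in_keys_iff if_distrib cong: if_cong)

lemma keys_lin_ext: "keys (lin_ext F f) \<subseteq> (\<Union>s\<in>keys f. keys (F s))"
proof
  fix t assume "t \<in> keys (lin_ext F f)"
  then have "(\<Sum>s\<in>keys f. lookup f s * lookup (F s) t) \<noteq> 0"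
    by (simp add: in_keys_iff lookup_lin_ext ev_def)
  then obtain s where "s \<in> keys f" "lookup (F s) t \<noteq> 0"
    by (metis (no_types, lifting) mult_zero_right sum.neutral)
  then show "t \<in> (\<Union>s\<in>keys f. keys (F s))" by (auto simp: in_keys_iff)
qed

lemma keys_push: "keys (push F f) \<subseteq> F ` keys f"
  using keys_lin_ext[of "\<lambda>s. Poly_Mapping.single (F s) 1" f] by (auto split: if_splits)

lemma keys_diff_subset: "keys (f - g) \<subseteq> keys f \<union> keys g"
  by (auto simp: in_keys_iff lookup_minus)

lemma keys_sum_subset: "keys (\<Sum>i\<in>I. f i) \<subseteq> (\<Union>i\<in>I. keys (f i))"
  by (induction I rule: infinite_finite_induct) (auto dest!: subsetD[OF keys_add])

lemma ev_lin_ext: "ev \<kappa> (lin_ext F f) = ev (\<lambda>s. ev \<kappa> (F s)) f"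
  by (simp add: lin_ext_def ev_def[of "\<lambda>s. ev \<kappa> (F s)"] ev_sum ev_scale)

lemma ev_cong: "(\<And>s. s \<in> keys f \<Longrightarrow> \<kappa> s = \<kappa>' s) \<Longrightarrow> ev \<kappa> f = ev \<kappa>' f"
  by (simp add: ev_def)

lemma ev_mult_right: "ev (\<lambda>s. \<kappa> s * c) f = ev \<kappa> f * c"
  by (simp add: ev_def sum_distrib_right mult.assoc)

abbreviation (input) mon :: "'t \<Rightarrow> ('t \<Rightarrow>\<^sub>0 'k::field)"
  where "mon t \<equiv> Poly_Mapping.single t 1"

definition supp :: "'t set \<Rightarrow> ('t \<Rightarrow>\<^sub>0 'k::field) set"
  where "supp S = {f. keys f \<subseteq> S}"

lemma lin_ext_in_subspace:
  assumes "pm.subspace V" "\<And>s. s \<in> keys f \<Longrightarrow> F s \<in> V"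
  shows "lin_ext F f \<in> V"
  unfolding lin_ext_def using assms by (intro pm.subspace_sum pm.subspace_scale) auto

lemma subspace_supp: "pm.subspace (supp S)"
  unfolding pm.subspace_def supp_def using keys_add keys_pm_scale by fastforce

lemma subspace_vimage_lin_ext:
  assumes "pm.subspace V" shows "pm.subspace {f. lin_ext F f \<in> V}"
  using assms by (auto simp: pm.subspace_def lin_ext_add lin_ext_scale)

subsection \<open>The free algebra on one generator\<close>

datatype rose = R "rose list"

type_synonym 'k word_vec = "rose list \<Rightarrow>\<^sub>0 'k"

text \<open>Every node contributes one copy of the generator, so this is the arity of the
  corresponding tree monomial, and it drives the induction on words.\<close>

primrec nodes :: "rose \<Rightarrow> nat"
  where "nodes (R us) = Suc (sum_list (map nodes us))"

definition slice :: "nat \<Rightarrow> nat \<Rightarrow> 'a list \<Rightarrow> 'a list"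
  where "slice a b w = drop a (take (Suc b) w)"

lemma sum_list_slice_le: "sum_list (map f (slice a b w)) \<le> (sum_list (map f w) :: nat)"
proof -
  have "sum_list (map f w) = sum_list (map f (take (Suc b) w)) + sum_list (map f (drop (Suc b) w))"
    by (metis append_take_drop_id map_append sum_list_append)
  moreover have "sum_list (map f (take (Suc b) w)) =
      sum_list (map f (take a (take (Suc b) w))) + sum_list (map f (slice a b w))"
    unfolding slice_def by (metis append_take_drop_id map_append sum_list_append)
  ultimately show ?thesis by linarith
qed

lemma length_slice [simp]: "length (slice a b w) = min (Suc b) (length w) - a"
  by (simp add: slice_def min.commute)

text \<open>Write \<open>R u\<close> as nu(x, u). The word x, u, y has a relation at the last letter
  of u, and nu(R u, y) is its term whose inner interval starts at x. Solving for this term leaves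
  terms nu(x, v), that is \<open>R v\<close>, where v arises from \<open>u @ y\<close> by
  contracting an interval that starts (first sum) or ends (second sum) at the last letter of u. The
  recursion ends because x has been removed.\<close>

function nuop :: "rose list \<Rightarrow> (rose \<Rightarrow>\<^sub>0 'k::field)"
  where
    "nuop [] = 0"
  | "nuop (R u # y) = push R (if u = [] then mon y else
      (\<Sum>b\<in>{length u..<length (u @ y)}.
         push (\<lambda>z. take (length u - 1) (u @ y) @ z # drop (Suc b) (u @ y)) (nuop (slice (length u - 1) b (u @ y)))) -
      (\<Sum>a\<in>{0..<length u - 1}.
         push (\<lambda>z. take a (u @ y) @ z # drop (length u) (u @ y)) (nuop (slice a (length u - 1) (u @ y)))))"
  by pat_completeness auto
termination
proof (relation "measure (\<lambda>w. sum_list (map nodes w))")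
  show "wf (measure (\<lambda>w. sum_list (map nodes w)))" by simp
next
  fix u y :: "rose list" and b
  show "(slice (length u - 1) b (u @ y), R u # y) \<in> measure (\<lambda>w. sum_list (map nodes w))"
    using sum_list_slice_le[of nodes "length u - 1" b "u @ y"] by simp
next
  fix u y :: "rose list" and a
  show "(slice a (length u - 1) (u @ y), R u # y) \<in> measure (\<lambda>w. sum_list (map nodes w))"
    using sum_list_slice_le[of nodes a "length u - 1" "u @ y"] by simp
qed

text \<open>Letters of words are counted from 0; \<open>nuop\<close> is applied to the letters \<open>a, \<dots>, b\<close>, both included.\<close>

definition ctr :: "nat \<Rightarrow> nat \<Rightarrow> rose list \<Rightarrow> (rose list \<Rightarrow>\<^sub>0 'k::field)"
  where "ctr a b w = (if b < length w
    then push (\<lambda>z. take a w @ z # drop (Suc b) w) (nuop (slice a b w)) else 0)"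

text \<open>The body of \<open>nuop\<close> below the root: the first p letters of w are the old
  children of the leading letter. For p = 0 that letter is the generator and nothing has to be
  rewritten.\<close>

definition split_op :: "nat \<Rightarrow> rose list \<Rightarrow> (rose list \<Rightarrow>\<^sub>0 'k::field)"
  where "split_op p w = (if p = 0 then mon w else
    (\<Sum>b\<in>{p..<length w}. ctr (p - 1) b w) - (\<Sum>a\<in>{0..<p - 1}. ctr a (p - 1) w))"

lemma nuop_Cons: "nuop (R u # y) = push R (split_op (length u) (u @ y) :: 'k::field word_vec)"
proof -
  have "(\<Sum>a\<in>{0..<length u - 1}. ctr a (length u - 1) (u @ y)) =
      (\<Sum>a\<in>{0..<length u - 1}.
         push (\<lambda>z. take a (u @ y) @ z # drop (length u) (u @ y)) (nuop (slice a (length u - 1) (u @ y)) :: rose \<Rightarrow>\<^sub>0 'k))"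
    if "u \<noteq> []"
    using that by (intro sum.cong) (auto simp: ctr_def)
  then show ?thesis
    unfolding nuop.simps split_op_def by (auto simp: ctr_def intro!: arg_cong[where f = "push R"] arg_cong2[where f = minus])
qed

declare nuop.simps(2) [simp del]

section \<open>Two successive contractions of a word\<close>

lemma keys_ctr:
  assumes "v \<in> keys (ctr a b w)"
  obtains z where "b < length w" "v = take a w @ z # drop (Suc b) w"
  using assms subsetD[OF keys_push] by (fastforce simp: ctr_def split: if_splits)

lemma length_keys_ctr:
  assumes "v \<in> keys (ctr a b w)" "a \<le> b"
  shows "b < length w" "length v = length w - (b - a)"
  using assms by (auto elim!: keys_ctr)

lemma ctr_context:
  assumes "b < length w" "a \<le> b"
  shows "ctr (length x + a) (length x + b) (x @ w @ r) = push (\<lambda>v. x @ v @ r) (ctr a b w :: 'k::field word_vec)"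
  using assms by (simp add: ctr_def slice_def lin_ext_lin_ext Suc_diff_le)

lemma ctr_block:
  assumes "length y = Suc (b - a)" "a \<le> b" "length x = a"
  shows "ctr a b (x @ y @ r) = (push (\<lambda>z. x @ z # r) (nuop y) :: 'k::field word_vec)"
  using assms by (auto simp: ctr_def slice_def)

declare Nat.diff_diff_right [simp del]

text \<open>Contracting [a,b] shortens the word by b - a, which is the shift of c and d on the left
  side.\<close>

lemma ctr_disjoint:
  assumes "a \<le> b" "b < c" "c \<le> d"
  shows "lin_ext (ctr (c - (b - a)) (d - (b - a))) (ctr a b w) = lin_ext (ctr a b) (ctr c d w :: 'k::field word_vec)"
proof (cases "d < length w")
  case False
  have "ctr (c - (b - a)) (d - (b - a)) v = (0 :: 'k word_vec)" if "v \<in> keys (ctr a b w :: 'k word_vec)" for v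
    using length_keys_ctr[OF that] assms False by (auto simp: ctr_def)
  then have "lin_ext (ctr (c - (b - a)) (d - (b - a))) (ctr a b w) = lin_ext (\<lambda>v. 0 :: 'k word_vec) (ctr a b w :: 'k word_vec)"
    by (intro lin_ext_cong)
  with False show ?thesis by (simp add: ctr_def)
next
  case True
  define x y u y' r where "x = take a w" and "y = slice a b w" and "u = drop (Suc b) (take c w)"
    and "y' = slice c d w" and "r = drop (Suc d) w"
  have len: "length x = a" "length y = Suc (b - a)" "length u = c - Suc b" "length y' = Suc (d - c)"
    using assms True by (auto simp: x_def y_def u_def y'_def Suc_diff_le min_def)
  have "take c w = take (Suc b) (take c w) @ u" unfolding u_def by (rule append_take_drop_id[symmetric])
  then have 1: "take c w = take (Suc b) w @ u" using assms by (simp add: min_def)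
  have "take (Suc b) w = take a (take (Suc b) w) @ y" unfolding y_def slice_def by (rule append_take_drop_id[symmetric])
  then have 2: "take (Suc b) w = x @ y" using assms by (simp add: min_def x_def)
  have "take (Suc d) w = take c (take (Suc d) w) @ y'" unfolding y'_def slice_def by (rule append_take_drop_id[symmetric])
  then have 3: "take (Suc d) w = take c w @ y'" using assms by (simp add: min_def)
  have w: "w = x @ y @ u @ y' @ r"
    using 1 2 3 append_take_drop_id[of "Suc d" w] unfolding r_def by simp
  have s1: "ctr a b w = (push (\<lambda>z. x @ z # (u @ y' @ r)) (nuop y) :: 'k word_vec)"
    unfolding w by (rule ctr_block) (use len assms in auto)
  have s2: "ctr c d w = (push (\<lambda>z. (x @ y @ u) @ z # r) (nuop y') :: 'k word_vec)"
  proof -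
    have "w = (x @ y @ u) @ y' @ r" by (simp add: w)
    then show ?thesis using ctr_block[where 'k = 'k, of y' d c "x @ y @ u" r] len assms by simp
  qed
  have t1: "ctr (c - (b - a)) (d - (b - a)) (x @ z # u @ y' @ r) = (push (\<lambda>z'. x @ z # u @ z' # r) (nuop y') :: 'k word_vec)" for z
  proof -
    have l: "length y' = Suc ((d - (b - a)) - (c - (b - a)))" "c - (b - a) \<le> d - (b - a)"
        "length (x @ z # u) = c - (b - a)"
      using len assms by auto
    have eq: "x @ z # u @ y' @ r = (x @ z # u) @ y' @ r" by simp
    show ?thesis unfolding eq ctr_block[OF l] by simp
  qed
  have t2: "ctr a b (x @ y @ u @ z' # r) = (push (\<lambda>z. x @ z # u @ z' # r) (nuop y) :: 'k word_vec)" for z'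
    by (rule ctr_block) (use len assms in auto)
  show ?thesis
    unfolding s1 s2 by (simp add: lin_ext_lin_ext t1 t2) (rule lin_ext_swap)
qed

text \<open>The outer contraction absorbs the inner one, so everything happens inside the slice
  [c,d]. This is what allows an induction hypothesis about that slice to be used.\<close>

lemma ctr_nested:
  assumes "c \<le> a" "a \<le> b" "b \<le> d" "d < length w"
  shows "lin_ext (ctr c (d - (b - a))) (ctr a b w) =
    (push (\<lambda>z. take c w @ z # drop (Suc d) w) (lin_ext nuop (ctr (a - c) (b - c) (slice c d w))) :: 'k::field word_vec)"
proof -
  define x y r where "x = take c w" and "y = slice c d w" and "r = drop (Suc d) w"
  have len: "length x = c" "length y = Suc (d - c)"
    using assms by (auto simp: x_def y_def Suc_diff_le min_def)
  have "take (Suc d) w = take c (take (Suc d) w) @ y" unfolding y_def slice_def by (rule append_take_drop_id[symmetric])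
  then have "take (Suc d) w = x @ y" using assms by (simp add: min_def x_def)
  then have w: "w = x @ y @ r"
    using append_take_drop_id[of "Suc d" w] unfolding r_def by simp
  have "ctr a b w = push (\<lambda>v. x @ v @ r) (ctr (a - c) (b - c) y :: 'k word_vec)"
    using ctr_context[where 'k = 'k, of "b - c" y "a - c" x r] len assms w by simp
  moreover have "ctr c (d - (b - a)) (x @ v @ r) = (push (\<lambda>z. x @ z # r) (nuop v) :: 'k word_vec)"
    if v: "v \<in> keys (ctr (a - c) (b - c) y :: 'k word_vec)" for v
  proof (rule ctr_block)
    show "length v = Suc (d - (b - a) - c)"
      using length_keys_ctr[OF v] len assms by auto
  qed (use len assms in auto)
  ultimately have "lin_ext (ctr c (d - (b - a))) (ctr a b w) =
      lin_ext (\<lambda>v. push (\<lambda>z. x @ z # r) (nuop v)) (ctr (a - c) (b - c) y :: 'k word_vec)"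
    by (simp add: lin_ext_lin_ext) (rule lin_ext_cong)
  then show ?thesis by (simp add: lin_ext_lin_ext x_def y_def r_def)
qed

section \<open>Sums over pairs of intervals\<close>

lemma sum_split_at:
  fixes f :: "nat \<Rightarrow> 'b::comm_monoid_add"
  assumes "l \<le> a" "a < u"
  shows "(\<Sum>i\<in>{l..<u}. f i) = (\<Sum>i\<in>{l..<a}. f i) + (f a + (\<Sum>i\<in>{Suc a..<u}. f i))"
  using assms sum.atLeastLessThan_concat[of l a u f] by (simp add: sum.atLeast_Suc_lessThan)

lemma sum_triangle:
  fixes f :: "nat \<Rightarrow> nat \<Rightarrow> 'b::comm_monoid_add"
  shows "(\<Sum>i\<in>{l..<u}. \<Sum>j\<in>{Suc i..<u}. f i j) = (\<Sum>j\<in>{l..<u}. \<Sum>i\<in>{l..<j}. f i j)"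
proof -
  have "(\<Sum>i\<in>{l..<u}. \<Sum>j\<in>{Suc i..<u}. f i j) = (\<Sum>i\<in>{l..<u}. \<Sum>j\<in>{j \<in> {l..<u}. i < j}. f i j)"
    by (intro sum.cong) auto
  also have "\<dots> = (\<Sum>j\<in>{l..<u}. \<Sum>i\<in>{i \<in> {l..<u}. i < j}. f i j)"
    by (rule sum.swap_restrict) auto
  also have "\<dots> = (\<Sum>j\<in>{l..<u}. \<Sum>i\<in>{l..<j}. f i j)"
    by (intro sum.cong) auto
  finally show ?thesis .
qed

text \<open>In the next two lemmas \<open>Y c d a b\<close> stands for the contraction of the interval \<open>[a,b]\<close> followed by
  that of \<open>[c,d]\<close>, and \<open>X a b c d\<close> for the contraction of two disjoint intervals.\<close>

lemma ends_sum_eq_starts_sum: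
  fixes Y :: "nat \<Rightarrow> nat \<Rightarrow> 'b::ab_group_add"
  assumes "\<And>s. Q < s \<Longrightarrow> s < S \<Longrightarrow> (\<Sum>a\<in>{Q..<s}. Y a s) = (\<Sum>b\<in>{Suc s..S}. Y s b)"
  shows "(\<Sum>b\<in>{Suc Q..<S}. Y Q b) = (\<Sum>a\<in>{Suc Q..<S}. Y a S)"
proof -
  \<comment> \<open>Sum the hypothesis over all s strictly between Q and S. Intervals with both ends
    strictly inside occur on both sides and cancel; those starting at Q and those ending at S
    remain.\<close>
  have "(\<Sum>s\<in>{Suc Q..<S}. Y Q s + (\<Sum>a\<in>{Suc Q..<s}. Y a s)) = (\<Sum>s\<in>{Suc Q..<S}. \<Sum>a\<in>{Q..<s}. Y a s)"
    by (intro sum.cong refl) (simp add: sum.atLeast_Suc_lessThan)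
  also have "\<dots> = (\<Sum>s\<in>{Suc Q..<S}. \<Sum>b\<in>{Suc s..S}. Y s b)"
    using assms by (intro sum.cong[OF refl]) auto
  also have "\<dots> = (\<Sum>s\<in>{Suc Q..<S}. Y s S + (\<Sum>b\<in>{Suc s..<S}. Y s b))"
    by (intro sum.cong refl) (simp add: sum.last_plus atLeastLessThanSuc_atLeastAtMost[symmetric] add.commute)
  finally show ?thesis
    by (simp add: sum.distrib sum_triangle)
qed

lemma contraction_sums:
  fixes X Y :: "nat \<Rightarrow> nat \<Rightarrow> nat \<Rightarrow> nat \<Rightarrow> 'b::ab_group_add"
  assumes QS: "Q < S" "S < m"
    and Y: "\<And>c s d. c < s \<Longrightarrow> s < d \<Longrightarrow> d < m \<Longrightarrow>
      (\<Sum>a\<in>{c..<s}. Y c d a s) = (\<Sum>b\<in>{Suc s..d}. Y c d s b)"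
  shows "(\<Sum>b\<in>{Suc Q..<S}. (\<Sum>d\<in>{Suc S..<m}. X Q b S d) -
        ((\<Sum>c\<in>{Suc b..<S}. X Q b c S) + Y Q S Q b + (\<Sum>c\<in>{0..<Q}. Y c S Q b)))
    + ((\<Sum>d\<in>{Suc S..<m}. Y Q d Q S) - (\<Sum>c\<in>{0..<Q}. Y c S Q S))
    - (\<Sum>a\<in>{0..<Q}. (\<Sum>d\<in>{Suc S..<m}. X a Q S d) -
        ((\<Sum>c\<in>{Suc Q..<S}. X a Q c S) + Y a S a Q + (\<Sum>c\<in>{0..<a}. Y c S a Q)))
    + (\<Sum>a\<in>{Suc Q..<S}. (\<Sum>d\<in>{Suc Q..<a}. X Q d a S) + Y Q S a S + (\<Sum>d\<in>{Suc S..<m}. Y Q d a S)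
        - (\<Sum>c\<in>{0..<Q}. X c Q a S))
    = (\<Sum>b\<in>{Suc S..<m}. (\<Sum>d\<in>{Suc Q..<S}. X Q d S b) + Y Q b S b + (\<Sum>d\<in>{Suc b..<m}. Y Q d S b)
        - (\<Sum>c\<in>{0..<Q}. X c Q S b))"
proof -
  \<comment> \<open>Disjoint pairs cancel by exchanging sums (1 to 4). Nested pairs are grouped by
    the outer interval: [Q,d] with d beyond S uses the law at S (5), [c,S] with c before Q uses it
    at Q (6), and [Q,S] uses it at every point in between (7).\<close>
  have 1: "(\<Sum>b\<in>{Suc Q..<S}. \<Sum>d\<in>{Suc S..<m}. X Q b S d) = (\<Sum>b\<in>{Suc S..<m}. \<Sum>d\<in>{Suc Q..<S}. X Q d S b)"
    by (rule sum.swap)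
  have 2: "(\<Sum>b\<in>{Suc Q..<S}. \<Sum>c\<in>{Suc b..<S}. X Q b c S) = (\<Sum>a\<in>{Suc Q..<S}. \<Sum>d\<in>{Suc Q..<a}. X Q d a S)"
    by (rule sum_triangle)
  have 3: "(\<Sum>a\<in>{0..<Q}. \<Sum>d\<in>{Suc S..<m}. X a Q S d) = (\<Sum>b\<in>{Suc S..<m}. \<Sum>c\<in>{0..<Q}. X c Q S b)"
    by (rule sum.swap)
  have 4: "(\<Sum>a\<in>{0..<Q}. \<Sum>c\<in>{Suc Q..<S}. X a Q c S) = (\<Sum>a\<in>{Suc Q..<S}. \<Sum>c\<in>{0..<Q}. X c Q a S)"
    by (rule sum.swap)
  have 5: "(\<Sum>d\<in>{Suc S..<m}. Y Q d Q S) + (\<Sum>a\<in>{Suc Q..<S}. \<Sum>d\<in>{Suc S..<m}. Y Q d a S) =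
      (\<Sum>b\<in>{Suc S..<m}. Y Q b S b) + (\<Sum>b\<in>{Suc S..<m}. \<Sum>d\<in>{Suc b..<m}. Y Q d S b)"
  proof -
    have "(\<Sum>d\<in>{Suc S..<m}. Y Q d Q S) + (\<Sum>a\<in>{Suc Q..<S}. \<Sum>d\<in>{Suc S..<m}. Y Q d a S) =
        (\<Sum>d\<in>{Suc S..<m}. Y Q d Q S + (\<Sum>a\<in>{Suc Q..<S}. Y Q d a S))"
      by (simp add: sum.distrib) (rule sum.swap)
    also have "\<dots> = (\<Sum>d\<in>{Suc S..<m}. \<Sum>a\<in>{Q..<S}. Y Q d a S)"
      using QS by (intro sum.cong refl) (simp add: sum.atLeast_Suc_lessThan)
    also have "\<dots> = (\<Sum>d\<in>{Suc S..<m}. \<Sum>b\<in>{Suc S..d}. Y Q d S b)"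
      using QS by (intro sum.cong Y) auto
    also have "\<dots> = (\<Sum>d\<in>{Suc S..<m}. Y Q d S d + (\<Sum>b\<in>{Suc S..<d}. Y Q d S b))"
      by (intro sum.cong refl) (simp add: sum.last_plus atLeastLessThanSuc_atLeastAtMost[symmetric] add.commute)
    finally show ?thesis by (simp add: sum.distrib sum_triangle)
  qed
  have 6: "(\<Sum>b\<in>{Suc Q..<S}. \<Sum>c\<in>{0..<Q}. Y c S Q b) + (\<Sum>c\<in>{0..<Q}. Y c S Q S) =
      (\<Sum>a\<in>{0..<Q}. Y a S a Q) + (\<Sum>a\<in>{0..<Q}. \<Sum>c\<in>{0..<a}. Y c S a Q)"
  proof -
    have "(\<Sum>b\<in>{Suc Q..<S}. \<Sum>c\<in>{0..<Q}. Y c S Q b) + (\<Sum>c\<in>{0..<Q}. Y c S Q S) =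
       (\<Sum>c\<in>{0..<Q}. (\<Sum>b\<in>{Suc Q..<S}. Y c S Q b) + Y c S Q S)"
      by (simp add: sum.distrib) (rule sum.swap)
    also have "\<dots> = (\<Sum>c\<in>{0..<Q}. \<Sum>b\<in>{Suc Q..S}. Y c S Q b)"
      using QS by (intro sum.cong refl) (simp add: sum.last_plus atLeastLessThanSuc_atLeastAtMost[symmetric] add.commute)
    also have "\<dots> = (\<Sum>c\<in>{0..<Q}. \<Sum>a\<in>{c..<Q}. Y c S a Q)"
      using QS by (intro sum.cong Y[symmetric]) auto
    also have "\<dots> = (\<Sum>c\<in>{0..<Q}. Y c S c Q + (\<Sum>a\<in>{Suc c..<Q}. Y c S a Q))"
      by (intro sum.cong refl) (simp add: sum.atLeast_Suc_lessThan)
    finally show ?thesis by (simp add: sum.distrib sum_triangle)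
  qed
  have 7: "(\<Sum>b\<in>{Suc Q..<S}. Y Q S Q b) = (\<Sum>a\<in>{Suc Q..<S}. Y Q S a S)"
    using Y[of Q _ S] QS by (intro ends_sum_eq_starts_sum) auto
  show ?thesis
    using 5 6 unfolding sum.distrib sum_subtractf 1 2 3 4 7
    by (simp add: algebra_simps)
qed

text \<open>The right interval is contracted first, so that the indices of the left one do not
  move.\<close>

definition disj_ctr :: "rose list \<Rightarrow> nat \<Rightarrow> nat \<Rightarrow> nat \<Rightarrow> nat \<Rightarrow> (rose list \<Rightarrow>\<^sub>0 'k::field)"
  where "disj_ctr w a b c d = lin_ext (ctr a b) (ctr c d w)"

text \<open>All four indices refer to the original word; the inner contraction moves the right end
  of the outer interval by b - a.\<close>

definition nest_ctr :: "rose list \<Rightarrow> nat \<Rightarrow> nat \<Rightarrow> nat \<Rightarrow> nat \<Rightarrow> (rose list \<Rightarrow>\<^sub>0 'k::field)"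
  where "nest_ctr w c d a b = lin_ext (ctr c (d - (b - a))) (ctr a b w)"

lemma sum_shift_diff:
  "e \<le> l \<Longrightarrow> (\<Sum>d\<in>{l - e..<u - e}. f d) = (\<Sum>d\<in>{l..<u}. f (d - e :: nat) :: 'b::comm_monoid_add)"
  by (rule sum.reindex_bij_witness[of _ "\<lambda>d. d - e" "\<lambda>d. d + e"]) auto

lemma split_op_ctr:
  assumes "p > 0" "a \<le> b" "b < length w"
  shows "lin_ext (split_op p) (ctr a b w :: 'k::field word_vec) =
    (\<Sum>d\<in>{p..<length w - (b - a)}. lin_ext (ctr (p - 1) d) (ctr a b w)) -
    (\<Sum>c\<in>{0..<p - 1}. lin_ext (ctr c (p - 1)) (ctr a b w))"
proof -
  have "lin_ext (split_op p) (ctr a b w :: 'k word_vec) = lin_ext (\<lambda>v. (\<Sum>d\<in>{p..<length w - (b - a)}. ctr (p - 1) d v) -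
      (\<Sum>c\<in>{0..<p - 1}. ctr c (p - 1) v)) (ctr a b w)"
    using assms by (intro lin_ext_cong) (simp add: split_op_def length_keys_ctr)
  then show ?thesis by (simp add: lin_ext_fun_diff lin_ext_fun_sum)
qed

text \<open>Here and in the next two lemmas \<open>split_op\<close> is expanded after a contraction
  of [a,b], and its terms are sorted by the position of the second interval relative to [a,b]. The
  letter at which \<open>split_op\<close> splits lies behind [a,b] here, is the contracted letter
  itself in the second lemma, and lies before [a,b] in the third.\<close>

lemma split_op_after:
  assumes "a \<le> b" "b < S" "S < length w"
  shows "lin_ext (split_op (Suc S - (b - a))) (ctr a b w :: 'k::field word_vec) =
    (\<Sum>d\<in>{Suc S..<length w}. disj_ctr w a b S d) -
    ((\<Sum>c\<in>{Suc b..<S}. disj_ctr w a b c S) + nest_ctr w a S a b + (\<Sum>c\<in>{0..<a}. nest_ctr w c S a b))"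
proof -
  let ?e = "b - a" and ?D = "\<lambda>c d. lin_ext (ctr c d) (ctr a b w :: 'k word_vec)"
  have "lin_ext (split_op (Suc S - ?e)) (ctr a b w :: 'k word_vec) =
      (\<Sum>d\<in>{Suc S - ?e..<length w - ?e}. ?D (S - ?e) d) - (\<Sum>c\<in>{0..<S - ?e}. ?D c (S - ?e))"
    using assms by (subst split_op_ctr) (auto simp: Suc_diff_le)
  moreover have "(\<Sum>d\<in>{Suc S - ?e..<length w - ?e}. ?D (S - ?e) d) = (\<Sum>d\<in>{Suc S..<length w}. disj_ctr w a b S d)"
    using assms by (subst sum_shift_diff) (auto simp: disj_ctr_def ctr_disjoint intro!: sum.cong)
  moreover have "(\<Sum>c\<in>{0..<S - ?e}. ?D c (S - ?e)) =
      (\<Sum>c\<in>{0..<a}. ?D c (S - ?e)) + (?D a (S - ?e) + (\<Sum>c\<in>{Suc a..<S - ?e}. ?D c (S - ?e)))"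
    using assms by (intro sum_split_at) auto
  moreover have "(\<Sum>c\<in>{Suc b - ?e..<S - ?e}. ?D c (S - ?e)) = (\<Sum>c\<in>{Suc b..<S}. disj_ctr w a b c S)"
    using assms by (subst sum_shift_diff) (auto simp: disj_ctr_def ctr_disjoint intro!: sum.cong)
  moreover have "Suc b - ?e = Suc a" using assms by simp
  ultimately show ?thesis by (simp add: nest_ctr_def algebra_simps)
qed

lemma split_op_at:
  assumes "a \<le> S" "S < length w"
  shows "lin_ext (split_op (Suc a)) (ctr a S w :: 'k::field word_vec) =
    (\<Sum>d\<in>{Suc S..<length w}. nest_ctr w a d a S) - (\<Sum>c\<in>{0..<a}. nest_ctr w c S a S)"
proof -
  let ?e = "S - a" and ?D = "\<lambda>c d. lin_ext (ctr c d) (ctr a S w :: 'k word_vec)"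
  have "lin_ext (split_op (Suc a)) (ctr a S w :: 'k word_vec) =
      (\<Sum>d\<in>{Suc S - ?e..<length w - ?e}. ?D a d) - (\<Sum>c\<in>{0..<a}. ?D c a)"
    using assms by (subst split_op_ctr) (auto simp: Suc_diff_le)
  moreover have "(\<Sum>d\<in>{Suc S - ?e..<length w - ?e}. ?D a d) = (\<Sum>d\<in>{Suc S..<length w}. nest_ctr w a d a S)"
    using assms by (subst sum_shift_diff) (auto simp: nest_ctr_def)
  ultimately show ?thesis using assms by (simp add: nest_ctr_def)
qed

lemma split_op_before:
  assumes "Q < a" "a \<le> b" "b < length w"
  shows "lin_ext (split_op (Suc Q)) (ctr a b w :: 'k::field word_vec) =
    (\<Sum>d\<in>{Suc Q..<a}. disj_ctr w Q d a b) + nest_ctr w Q b a b + (\<Sum>d\<in>{Suc b..<length w}. nest_ctr w Q d a b)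
    - (\<Sum>c\<in>{0..<Q}. disj_ctr w c Q a b)"
proof -
  let ?e = "b - a" and ?D = "\<lambda>c d. lin_ext (ctr c d) (ctr a b w :: 'k word_vec)"
  have "lin_ext (split_op (Suc Q)) (ctr a b w :: 'k word_vec) =
      (\<Sum>d\<in>{Suc Q..<length w - ?e}. ?D Q d) - (\<Sum>c\<in>{0..<Q}. ?D c Q)"
    using assms by (subst split_op_ctr) auto
  moreover have "(\<Sum>d\<in>{Suc Q..<length w - ?e}. ?D Q d) =
      (\<Sum>d\<in>{Suc Q..<a}. ?D Q d) + (?D Q a + (\<Sum>d\<in>{Suc a..<length w - ?e}. ?D Q d))"
    using assms by (intro sum_split_at) auto
  moreover have "(\<Sum>d\<in>{Suc b - ?e..<length w - ?e}. ?D Q d) = (\<Sum>d\<in>{Suc b..<length w}. nest_ctr w Q d a b)"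
    using assms by (subst sum_shift_diff) (auto simp: nest_ctr_def)
  moreover have "Suc b - ?e = Suc a" using assms by simp
  ultimately show ?thesis using assms by (simp add: nest_ctr_def disj_ctr_def algebra_simps)
qed

text \<open>The defining relations, read as identities between operations on the word z; s + 1 is
  the index i of the relation. The type argument fixes the field.\<close>

definition nuop_law :: "'k::field itself \<Rightarrow> rose list \<Rightarrow> bool"
  where "nuop_law _ z \<longleftrightarrow> (\<forall>s. 0 < s \<longrightarrow> Suc s < length z \<longrightarrow>
    (\<Sum>a\<in>{0..<s}. lin_ext nuop (ctr a s z) :: rose \<Rightarrow>\<^sub>0 'k) = (\<Sum>b\<in>{Suc s..<length z}. lin_ext nuop (ctr s b z)))"

lemma nest_ctr_rel:
  assumes rel: "nuop_law TYPE('k::field) (slice c d w)" and cd: "c < s" "s < d" "d < length w"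
  shows "(\<Sum>a\<in>{c..<s}. nest_ctr w c d a s :: 'k word_vec) = (\<Sum>b\<in>{Suc s..d}. nest_ctr w c d s b)"
proof -
  let ?P = "\<lambda>f. push (\<lambda>z. take c w @ z # drop (Suc d) w) f :: 'k word_vec"
  let ?z = "slice c d w"
  have "(\<Sum>a\<in>{c..<s}. nest_ctr w c d a s) = (\<Sum>a\<in>{c..<s}. ?P (lin_ext nuop (ctr (a - c) (s - c) ?z)))"
    using cd by (intro sum.cong refl) (auto simp: nest_ctr_def ctr_nested)
  also have "\<dots> = (\<Sum>a\<in>{0..<s - c}. ?P (lin_ext nuop (ctr a (s - c) ?z)))"
    using sum_shift_diff[of c c "\<lambda>a. ?P (lin_ext nuop (ctr a (s - c) ?z))" s] by simp
  also have "\<dots> = ?P (\<Sum>b\<in>{Suc (s - c)..<length ?z}. lin_ext nuop (ctr (s - c) b ?z))"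
    using rel cd by (simp add: nuop_law_def lin_ext_sum[symmetric])
  also have "\<dots> = (\<Sum>b\<in>{Suc s - c..<Suc d - c}. ?P (lin_ext nuop (ctr (s - c) b ?z)))"
    using cd by (simp add: lin_ext_sum lin_ext_add Suc_diff_le)
  also have "\<dots> = (\<Sum>b\<in>{Suc s..<Suc d}. ?P (lin_ext nuop (ctr (s - c) (b - c) ?z)))"
    using cd by (intro sum_shift_diff) simp
  also have "\<dots> = (\<Sum>b\<in>{Suc s..d}. nest_ctr w c d s b)"
    using cd by (intro sum.cong) (auto simp: nest_ctr_def ctr_nested)
  finally show ?thesis .
qed

text \<open>This is the law for the word \<open>R u # y\<close> with the outer \<open>R\<close>
  removed, where w = u @ y and q = \<open>length u\<close>. The first summand belongs to the
  interval containing \<open>R u\<close>: its value has a new list v of children, and the outer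
  operation then splits at the end of v.\<close>

lemma split_op_rel:
  assumes rel: "\<And>c d. nuop_law TYPE('k::field) (slice c d w)"
    and q: "q \<le> S" "Suc S < length w"
  shows "lin_ext (\<lambda>v. split_op (length v) (v @ drop (Suc S) w)) (split_op q (take (Suc S) w) :: 'k word_vec)
      + (\<Sum>a\<in>{q..<S}. lin_ext (split_op q) (ctr a S w))
    = (\<Sum>b\<in>{Suc S..<length w}. lin_ext (split_op q) (ctr S b w))"
proof (cases q)
  case 0
  have "split_op (Suc S) w = (\<Sum>b\<in>{Suc S..<length w}. ctr S b w) - (\<Sum>a\<in>{0..<S}. ctr a S w :: 'k word_vec)"
    by (simp add: split_op_def)
  moreover have "lin_ext (split_op 0) g = g" for g :: "'k word_vec"
    by (simp add: split_op_def[abs_def])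
  ultimately show ?thesis using 0 q by (simp add: split_op_def[of 0])
next
  case (Suc Q)
  let ?r = "drop (Suc S) w" and ?L = "\<lambda>f. lin_ext (\<lambda>v. split_op (length v) (v @ drop (Suc S) w)) f :: 'k word_vec"
  have S: "Q < S" "S < length w" using Suc q by auto
  \<comment> \<open>A contraction inside the prefix leaves \<open>Suc S - (b - a)\<close> letters of
    it, and this length is the next splitting position.\<close>
  have L: "?L (ctr a b (take (Suc S) w)) = lin_ext (split_op (Suc S - (b - a))) (ctr a b w)"
    if "a \<le> b" "b \<le> S" for a b
  proof -
    have "ctr a b w = push (\<lambda>v. v @ ?r) (ctr a b (take (Suc S) w) :: 'k word_vec)"
      using ctr_context[where 'k = 'k, of b "take (Suc S) w" a "[]" ?r] that S by simp
    then have "lin_ext (split_op (Suc S - (b - a))) (ctr a b w) =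
       lin_ext (\<lambda>v. split_op (Suc S - (b - a)) (v @ ?r)) (ctr a b (take (Suc S) w) :: 'k word_vec)"
      by (simp add: lin_ext_lin_ext)
    also have "\<dots> = ?L (ctr a b (take (Suc S) w))"
      using that S by (intro lin_ext_cong) (simp add: length_keys_ctr)
    finally show ?thesis by simp
  qed
  have "?L (split_op q (take (Suc S) w)) =
      (\<Sum>b\<in>{Suc Q..<Suc S}. ?L (ctr Q b (take (Suc S) w))) - (\<Sum>a\<in>{0..<Q}. ?L (ctr a Q (take (Suc S) w)))"
    using Suc S by (simp add: split_op_def[of "Suc Q"] lin_ext_diff lin_ext_sum del: sum.op_ivl_Suc)
  also have "\<dots> = (\<Sum>b\<in>{Suc Q..<S}. lin_ext (split_op (Suc S - (b - Q))) (ctr Q b w)) + lin_ext (split_op (Suc Q)) (ctr Q S w)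
      - (\<Sum>a\<in>{0..<Q}. lin_ext (split_op (Suc S - (Q - a))) (ctr a Q w))"
  proof -
    have "Suc S - (S - Q) = Suc Q" using S by simp
    then show ?thesis using S by (simp add: L)
  qed
  finally have 1: "?L (split_op q (take (Suc S) w)) = \<dots>" .
  show ?thesis
    unfolding 1 unfolding Suc
    using contraction_sums[OF S nest_ctr_rel[OF rel], of "disj_ctr w"] S
    by (simp add: split_op_after split_op_at split_op_before)
qed

text \<open>Induction on the number of nodes: for z = R u # y all terms are governed by the word u @
  y, which has one node less, so the law is available for its slices.\<close>

lemma nuop_law_holds: "nuop_law TYPE('k::field) z"
proof (induction z rule: measure_induct_rule[of "\<lambda>z. sum_list (map nodes z)"])
  case (less z)
  show ?case unfolding nuop_law_def
  proof (intro allI impI)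
    fix s assume s: "0 < s" "Suc s < length z"
    obtain u y where z: "z = R u # y" using s by (cases z) (auto, metis rose.exhaust)
    define w q where "w = u @ y" and "q = length u"
    define S where "S = q + s - 1"
    have qS: "q \<le> S" "Suc S < length w" using s by (auto simp: z S_def w_def q_def)
    have IH: "nuop_law TYPE('k) (slice c d w)" for c d
      using sum_list_slice_le[of nodes c d w] by (intro less) (simp add: z w_def)
    \<comment> \<open>Only the interval starting at 0 contains the letter \<open>R u\<close>. All
      others lie inside y and keep \<open>R u\<close> in front, which is the content of
      \<open>other\<close>.\<close>
    have "ctr 0 s z = push (\<lambda>x. x # drop s y) (nuop (R u # take s y) :: rose \<Rightarrow>\<^sub>0 'k)"
      using s by (simp add: ctr_def slice_def z)
    also have "\<dots> = push (\<lambda>v. R v # drop s y) (split_op q (u @ take s y))"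
      by (simp add: nuop_Cons lin_ext_lin_ext q_def)
    also have "u @ take s y = take (Suc S) w" using s by (simp add: S_def w_def q_def)
    finally have "lin_ext nuop (ctr 0 s z) =
        push R (lin_ext (\<lambda>v. split_op (length v) (v @ drop s y)) (split_op q (take (Suc S) w) :: 'k word_vec))"
      by (simp add: nuop_Cons lin_ext_lin_ext)
    also have "drop s y = drop (Suc S) w" using s by (simp add: S_def w_def q_def)
    finally have first: "lin_ext nuop (ctr 0 s z) = push R (lin_ext (\<lambda>v. split_op (length v) (v @ drop (Suc S) w))
        (split_op q (take (Suc S) w) :: 'k word_vec))" .
    have other: "lin_ext nuop (ctr (Suc a) (Suc b) z) = push R (lin_ext (split_op q) (ctr (q + a) (q + b) w :: 'k word_vec))"
      if "a \<le> b" "b < length y" for a b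
    proof -
      have "ctr (Suc a) (Suc b) z = push (\<lambda>v. R u # v) (ctr a b y :: 'k word_vec)"
        using ctr_context[where 'k = 'k, of b y a "[R u]" "[]"] that by (simp add: z)
      moreover have "ctr (q + a) (q + b) w = push (\<lambda>v. u @ v) (ctr a b y :: 'k word_vec)"
        using ctr_context[where 'k = 'k, of b y a u "[]"] that by (simp add: w_def q_def)
      ultimately show ?thesis by (simp add: nuop_Cons lin_ext_lin_ext q_def)
    qed
    have "(\<Sum>a\<in>{0..<s}. lin_ext nuop (ctr a s z) :: rose \<Rightarrow>\<^sub>0 'k) =
        lin_ext nuop (ctr 0 s z) + (\<Sum>a\<in>{Suc 0..<s}. lin_ext nuop (ctr a s z))"
      using s by (simp add: sum.atLeast_Suc_lessThan)
    also have "(\<Sum>a\<in>{Suc 0..<s}. lin_ext nuop (ctr a s z) :: rose \<Rightarrow>\<^sub>0 'k) =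
        (\<Sum>a\<in>{q..<S}. push R (lin_ext (split_op q) (ctr a S w)))"
    proof (rule sum.reindex_bij_witness[of _ "\<lambda>a. a - q + 1" "\<lambda>a. a - 1 + q"])
      fix a assume a: "a \<in> {Suc 0..<s}"
      then have "a - 1 \<le> s - 1" "s - 1 < length y" "Suc (a - 1) = a" "Suc (s - 1) = s"
        "q + (a - 1) = a - 1 + q" "q + (s - 1) = S"
        using s by (auto simp: z S_def)
      note e = this
      show "push R (lin_ext (split_op q) (ctr (a - 1 + q) S w)) = (lin_ext nuop (ctr a s z) :: rose \<Rightarrow>\<^sub>0 'k)"
        using other[OF e(1,2)] unfolding e(3-6) by simp
    qed (use s in \<open>auto simp: S_def\<close>)
    also have "lin_ext nuop (ctr 0 s z) + (\<Sum>a\<in>{q..<S}. push R (lin_ext (split_op q) (ctr a S w))) =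
        push R (\<Sum>b\<in>{Suc S..<length w}. lin_ext (split_op q) (ctr S b w) :: 'k word_vec)"
      unfolding first split_op_rel[OF IH qS, symmetric] by (simp add: lin_ext_add lin_ext_sum)
    also have "\<dots> = (\<Sum>b\<in>{Suc S..<length w}. push R (lin_ext (split_op q) (ctr S b w)))"
      by (simp add: lin_ext_sum)
    also have "\<dots> = (\<Sum>b\<in>{Suc s..<length z}. lin_ext nuop (ctr s b z))"
    proof (rule sum.reindex_bij_witness[of _ "\<lambda>a. a - 1 + q" "\<lambda>a. a - q + 1"])
      fix b assume b: "b \<in> {Suc S..<length w}"
      then have "s - 1 \<le> b - q" "b - q < length y" "Suc (s - 1) = s" "Suc (b - q) = b - q + 1"
        "q + (s - 1) = S" "q + (b - q) = b"
        using s by (auto simp: z S_def w_def q_def)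
      note e = this
      show "lin_ext nuop (ctr s (b - q + 1) z) = (push R (lin_ext (split_op q) (ctr S b w)) :: rose \<Rightarrow>\<^sub>0 'k)"
        using other[OF e(1,2)] unfolding e(3-6) by simp
    qed (use s in \<open>auto simp: S_def z w_def q_def\<close>)
    finally show "(\<Sum>a\<in>{0..<s}. lin_ext nuop (ctr a s z) :: rose \<Rightarrow>\<^sub>0 'k) = (\<Sum>b\<in>{Suc s..<length z}. lin_ext nuop (ctr s b z))" .
  qed
qed

declare Nat.diff_diff_right [simp]

subsection \<open>Tree monomials as operators on words\<close>

abbreviation nc_trees :: "nat ptree set"
  where "nc_trees \<equiv> trees {2..} (\<lambda>k. k)"

lemma Node_in_trees_iff: "Node x ts \<in> trees G ar \<longleftrightarrow> x \<in> G \<and> length ts = ar x \<and> set ts \<subseteq> trees G ar"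
  by (subst trees.simps) auto

lemma leaves_pos: "t \<in> nc_trees \<Longrightarrow> 0 < leaves t"
proof (induction t rule: trees.induct)
  case (Node x ts)
  then obtain s where "s \<in> set ts" by (cases ts) auto
  with Node have "0 < leaves s" "leaves s \<le> sum_list (map leaves ts)"
    by (auto intro: member_le_sum_list)
  then show ?case by simp
qed simp

lemma length_le_leaves: "set ts \<subseteq> nc_trees \<Longrightarrow> length ts \<le> sum_list (map leaves ts)"
proof (induction ts)
  case (Cons t ts)
  then show ?case using leaves_pos[of t] by simp
qed simp

text \<open>The tree consumes \<open>leaves t\<close> letters from position p on. Each subtree is
  replaced by a single letter before its right neighbour is evaluated, hence the step to
  \<open>Suc p\<close>; then the vertex contracts the letters of its children.\<close>

fun act :: "nat ptree \<Rightarrow> nat \<Rightarrow> rose list \<Rightarrow> (rose list \<Rightarrow>\<^sub>0 'k::field)"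
  and act_list :: "nat ptree list \<Rightarrow> nat \<Rightarrow> rose list \<Rightarrow> ('k word_vec)"
  where
    "act Leaf p w = mon w"
  | "act (Node x ss) p w = lin_ext (ctr p (p + length ss - 1)) (act_list ss p w)"
  | "act_list [] p w = mon w"
  | "act_list (s # ss) p w = lin_ext (act_list ss (Suc p)) (act s p w)"

lemma act_fun [simp]:
  "act Leaf p = mon"
  "act (Node x ss) p = (\<lambda>w. lin_ext (ctr p (p + length ss - 1)) (act_list ss p w))"
  "act_list [] p = mon"
  "act_list (s # ss) p = (\<lambda>w. lin_ext (act_list ss (Suc p)) (act s p w))"
  by (auto intro!: ext)

lemma lin_ext_mon [simp]: "lin_ext mon f = f"
  by (fact push_id)

text \<open>The tree acts to the left of [c,d] and removes \<open>leaves s - 1\<close> letters;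
  \<open>ctr_disjoint\<close> is applied at each of its vertices.\<close>

lemma act_ctr:
  assumes "s \<in> nc_trees" "p + leaves s \<le> c" "c \<le> d"
  shows "lin_ext (act s p) (ctr c d w) =
    lin_ext (ctr (c - (leaves s - 1)) (d - (leaves s - 1))) (act s p w :: 'k::field word_vec)"
  using assms
proof (induction s arbitrary: p c d w rule: trees.induct)
  case Leaf
  then show ?case by simp
next
  case (Node x ts)
  \<comment> \<open>Here e is the number of letters removed by the list ss. It is given by an
    additive equation to avoid truncated subtraction.\<close>
  have list: "lin_ext (act_list ss p) (ctr c d w) = lin_ext (ctr (c - e) (d - e)) (act_list ss p w :: 'k word_vec)"
    if "set ss \<subseteq> set ts" "p + sum_list (map leaves ss) \<le> c" "c \<le> d"
      "e + length ss = sum_list (map leaves ss)" for ss p c d e w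
    using that
  proof (induction ss arbitrary: p c d e w)
    case Nil
    then show ?case by simp
  next
    case (Cons s ss)
    define l e' where "l = leaves s - 1" and "e' = e - l"
    have s: "s \<in> nc_trees" "0 < leaves s" using Cons.prems Node.hyps(3) leaves_pos by auto
    have "length ss \<le> sum_list (map leaves ss)"
      using Cons.prems(1) Node.hyps(3) by (intro length_le_leaves) auto
    then have e: "e = l + e'" "e' + length ss = sum_list (map leaves ss)"
      using Cons.prems(4) s by (auto simp: l_def e'_def)
    have "lin_ext (act_list (s # ss) p) (ctr c d w) = lin_ext (act_list ss (Suc p)) (lin_ext (act s p) (ctr c d w) :: 'k word_vec)"
      by (simp add: lin_ext_lin_ext)
    also have "lin_ext (act s p) (ctr c d w) = lin_ext (ctr (c - l) (d - l)) (act s p w :: 'k word_vec)"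
      unfolding l_def using Cons.prems by (intro Node.IH) auto
    also have "lin_ext (act_list ss (Suc p)) (lin_ext (ctr (c - l) (d - l)) (act s p w)) =
        lin_ext (\<lambda>v. lin_ext (ctr (c - l - e') (d - l - e')) (act_list ss (Suc p) v)) (act s p w :: 'k word_vec)"
      unfolding lin_ext_lin_ext
      by (intro lin_ext_cong Cons.IH) (use Cons.prems e s in \<open>auto simp: l_def\<close>)
    also have "\<dots> = lin_ext (ctr (c - e) (d - e)) (act_list (s # ss) p w)"
      by (simp add: lin_ext_lin_ext e)
    finally show ?case .
  qed
  have "length ts \<le> sum_list (map leaves ts)"
    using Node.hyps(3) by (intro length_le_leaves) auto
  then obtain e where e: "e + length ts = sum_list (map leaves ts)" by (metis le_add_diff_inverse2)
  have len: "2 \<le> length ts" using Node.hyps by simp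
  let ?b = "p + length ts - 1"
  have "lin_ext (act (Node x ts) p) (ctr c d w) = lin_ext (ctr p ?b) (lin_ext (act_list ts p) (ctr c d w) :: 'k word_vec)"
    by (simp add: lin_ext_lin_ext)
  also have "\<dots> = lin_ext (ctr p ?b) (lin_ext (ctr (c - e) (d - e)) (act_list ts p w))"
    using Node.prems e by (subst list[where e = e]) auto
  also have "\<dots> = lin_ext (\<lambda>v. lin_ext (ctr (c - e - (?b - p)) (d - e - (?b - p))) (ctr p ?b v)) (act_list ts p w)"
    unfolding lin_ext_lin_ext using Node.prems e len by (intro lin_ext_cong ctr_disjoint[symmetric]) auto
  also have "\<dots> = lin_ext (ctr (c - (leaves (Node x ts) - 1)) (d - (leaves (Node x ts) - 1))) (act (Node x ts) p w)"
  proof -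
    have "c - e - (?b - p) = c - (leaves (Node x ts) - 1)" "d - e - (?b - p) = d - (leaves (Node x ts) - 1)"
      using e len by (auto simp flip: e)
    then show ?thesis by (simp add: lin_ext_lin_ext)
  qed
  finally show ?case .
qed

lemma act_commute:
  assumes "t \<in> nc_trees" "s \<in> nc_trees" "p + leaves s \<le> q"
  shows "lin_ext (act s p) (act t q w) = lin_ext (act t (q - (leaves s - 1))) (act s p w :: 'k::field word_vec)"
  using assms
proof (induction t arbitrary: q w rule: trees.induct)
  case Leaf
  then show ?case by simp
next
  case (Node x ts)
  define e where "e = leaves s - 1"
  have s: "0 < leaves s" using Node.prems leaves_pos by auto
  have list: "lin_ext (act s p) (act_list us q w) = lin_ext (act_list us (q - e)) (act s p w :: 'k word_vec)"
    if "set us \<subseteq> set ts" "p + leaves s \<le> q" for us q w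
    using that
  proof (induction us arbitrary: q w)
    case Nil
    then show ?case by simp
  next
    case (Cons u us)
    have "lin_ext (act s p) (act_list (u # us) q w) = lin_ext (\<lambda>v. lin_ext (act s p) (act_list us (Suc q) v)) (act u q w :: 'k word_vec)"
      by (simp add: lin_ext_lin_ext)
    also have "\<dots> = lin_ext (act_list us (Suc q - e)) (lin_ext (act s p) (act u q w))"
      unfolding lin_ext_lin_ext using Cons.prems by (intro lin_ext_cong Cons.IH) auto
    also have "lin_ext (act s p) (act u q w) = lin_ext (act u (q - e)) (act s p w :: 'k word_vec)"
      unfolding e_def using Cons.prems Node.prems by (intro Node.IH) auto
    also have "Suc q - e = Suc (q - e)" using Cons.prems by (simp add: e_def)
    finally show ?case by (simp add: lin_ext_lin_ext)
  qed
  have len: "2 \<le> length ts" using Node.hyps by simp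
  have "lin_ext (act s p) (act (Node x ts) q w) =
      lin_ext (\<lambda>v. lin_ext (act s p) (ctr q (q + length ts - 1) v)) (act_list ts q w :: 'k word_vec)"
    by (simp add: lin_ext_lin_ext)
  also have "\<dots> = lin_ext (ctr (q - e) (q + length ts - 1 - e)) (lin_ext (act s p) (act_list ts q w))"
    unfolding lin_ext_lin_ext e_def using Node.prems len by (intro lin_ext_cong act_ctr) auto
  also have "\<dots> = lin_ext (ctr (q - e) (q + length ts - 1 - e)) (lin_ext (act_list ts (q - e)) (act s p w))"
    using Node.prems by (subst list) auto
  also have "q + length ts - 1 - e = q - e + length ts - 1" using Node.prems s by (simp add: e_def)
  finally show ?case by (simp add: lin_ext_lin_ext e_def)
qed

lemma length_graft_list [simp]: "length (graft_list ss i t) = length ss"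
  by (induction ss arbitrary: i) auto

text \<open>Grafting becomes composition of operators, with the grafted tree acting first.
  \<open>act_commute\<close> moves it past the subtrees to the left of its leaf.\<close>

lemma act_graft:
  assumes "s \<in> nc_trees" "t \<in> nc_trees" "1 \<le> i" "i \<le> leaves s"
  shows "act (graft s i t) p w = lin_ext (act s p) (act t (p + i - 1) w :: 'k::field word_vec)"
  using assms
proof (induction s arbitrary: i p w rule: trees.induct)
  case Leaf
  then show ?case by (simp add: lin_ext_cong[of _ "act Leaf p" mon])
next
  case (Node x ts)
  have list: "act_list (graft_list us i t) p w = lin_ext (act_list us p) (act t (p + i - 1) w :: 'k word_vec)"
    if "set us \<subseteq> set ts" "1 \<le> i" "i \<le> sum_list (map leaves us)" for us i p w
    using that
  proof (induction us arbitrary: i p w)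
    case Nil
    then show ?case by simp
  next
    case (Cons u us)
    show ?case
    proof (cases "i \<le> leaves u")
      case True
      then have "act (graft u i t) p w = lin_ext (act u p) (act t (p + i - 1) w :: 'k word_vec)"
        using Cons.prems Node.prems by (intro Node.IH) auto
      then show ?thesis using True by (simp add: lin_ext_lin_ext)
    next
      case False
      have u: "u \<in> nc_trees" using Cons.prems Node.hyps by auto
      have "act_list (graft_list (u # us) i t) p w = lin_ext (act_list (graft_list us (i - leaves u) t) (Suc p)) (act u p w :: 'k word_vec)"
        using False by simp
      also have "\<dots> = lin_ext (act_list us (Suc p)) (lin_ext (act t (Suc p + (i - leaves u) - 1)) (act u p w :: 'k word_vec))"
        unfolding lin_ext_lin_ext using Cons.prems False by (intro lin_ext_cong Cons.IH) auto
      also have "Suc p + (i - leaves u) - 1 = p + i - 1 - (leaves u - 1)"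
        using False leaves_pos[OF u] by simp
      also have "lin_ext (act t (p + i - 1 - (leaves u - 1))) (act u p w :: 'k word_vec) = lin_ext (act u p) (act t (p + i - 1) w)"
        using False u Node.prems by (intro act_commute[symmetric]) auto
      finally show ?thesis by (simp add: lin_ext_lin_ext)
    qed
  qed
  then show ?case using Node.prems by (simp add: lin_ext_lin_ext)
qed

subsection \<open>Normal forms of tree monomials\<close>

lemma even_sum_list: "(\<And>x. x \<in> set xs \<Longrightarrow> even (f x)) \<Longrightarrow> even (sum_list (map f xs) :: int)"
  by (induction xs) auto

lemma even_tdeg: "even (tdeg (\<lambda>k. 2 * int k - 4) t)"
  by (induction t) (auto intro!: even_sum_list)

lemma degree_nc [simp]: "degree (nc_free\<lparr>rels := r\<rparr>) = (\<lambda>k. 2 * int k - 4)" "degree nc_free = (\<lambda>k. 2 * int k - 4)"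
    "degree ncHyperCom = (\<lambda>k. 2 * int k - 4)"
  and monomials_nc [simp]: "monomials nc_free = nc_trees" "monomials ncHyperCom = nc_trees"
  by (auto simp: nc_free_def ncHyperCom_def monomials_def)

text \<open>All generators have even degree, so every Koszul sign is 1.\<close>

lemma tree_comp_nc: "tree_comp (\<lambda>k. 2 * int k - 4) s i t = mon (graft s i t)"
  by (simp add: tree_comp_def ksign_def even_tdeg)

lemma pcomp_nc:
  "pcomp nc_free f i g = lin_ext (\<lambda>s. lin_ext (\<lambda>t. mon (graft s i t)) g) f"
  "pcomp ncHyperCom f i g = lin_ext (\<lambda>s. lin_ext (\<lambda>t. mon (graft s i t)) g) f"
  by (simp_all add: pcomp_def tree_comp_nc)

definition corolla :: "nat \<Rightarrow> nat ptree"
  where "corolla k = Node k (replicate k Leaf)"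

lemma leaves_corolla [simp]: "leaves (corolla k) = k"
  by (simp add: corolla_def sum_list_replicate)

lemma corolla_in_trees: "2 \<le> k \<Longrightarrow> corolla k \<in> nc_trees"
  by (auto simp: corolla_def Node_in_trees_iff intro: trees.Leaf)

lemma nu_eq: "nu k = mon (corolla k)"
  by (simp add: nu_def generator_def corolla_def nc_free_def)

lemma nc_rel_eq: "nc_rel n i =
    (\<Sum>j=2..i. mon (graft (corolla (n - j + 1)) (i - j + 1) (corolla j))) -
    (\<Sum>k=2..n - i + 1. mon (graft (corolla (n - k + 1)) i (corolla k)))"
  by (simp add: nc_rel_def pcomp_nc nu_eq)

lemma act_corolla: "2 \<le> k \<Longrightarrow> act (corolla k) p w = (ctr p (p + k - 1) w :: 'k::field word_vec)"
proof -
  have "act_list (replicate k Leaf) p w = (mon w :: 'k word_vec)" for p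
    by (induction k arbitrary: p) auto
  then show ?thesis by (simp add: corolla_def)
qed

lemma act_two_corollas:
  assumes "2 \<le> k" "2 \<le> l" "1 \<le> j" "j \<le> k"
  shows "act (graft (corolla k) j (corolla l)) p w =
    (nest_ctr w p (p + k + l - 2) (p + j - 1) (p + j + l - 2) :: 'k::field word_vec)"
proof -
  have "act (graft (corolla k) j (corolla l)) p w =
      lin_ext (act (corolla k) p) (ctr (p + j - 1) (p + j - 1 + l - 1) w :: 'k word_vec)"
    using assms by (simp add: act_graft corolla_in_trees act_corolla)
  also have "\<dots> = lin_ext (ctr p (p + k - 1)) (ctr (p + j - 1) (p + j - 1 + l - 1) w :: 'k word_vec)"
    using assms by (intro lin_ext_cong act_corolla) auto
  finally have "act (graft (corolla k) j (corolla l)) p w =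
      lin_ext (ctr p (p + k - 1)) (ctr (p + j - 1) (p + j - 1 + l - 1) w :: 'k word_vec)" .
  moreover have "p + j - 1 + l - 1 = p + j + l - 2" "p + k - 1 = p + k + l - 2 - (p + j + l - 2 - (p + j - 1))"
    using assms by auto
  ultimately show ?thesis unfolding nest_ctr_def by metis
qed

lemma nest_ctr_outside:
  assumes "length w \<le> d" "a \<le> b" "b \<le> d"
  shows "nest_ctr w c d a b = (0 :: 'k::field word_vec)"
proof -
  have "nest_ctr w c d a b = lin_ext (\<lambda>v. 0) (ctr a b w :: 'k word_vec)"
    unfolding nest_ctr_def
  proof (rule lin_ext_cong)
    fix v assume "v \<in> keys (ctr a b w :: 'k word_vec)"
    from length_keys_ctr[OF this assms(2)] have "\<not> d - (b - a) < length v" using assms by linarith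
    then show "ctr c (d - (b - a)) v = (0 :: 'k word_vec)"
      using assms by (auto simp: ctr_def)
  qed
  then show ?thesis by simp
qed

text \<open>Both sums are nested contractions with outer interval [p, p + n - 1], and their
  difference vanishes by \<open>nuop_law\<close> at s = p + i - 1. If the word is too short, every
  term vanishes because \<open>ctr\<close> is 0 there.\<close>

lemma act_nc_rel:
  assumes "3 \<le> n" "2 \<le> i" "i \<le> n - 1"
  shows "lin_ext (\<lambda>s. act s p w) (nc_rel n i) = (0 :: 'k::field word_vec)"
proof -
  let ?Y = "nest_ctr w p (p + n - 1) :: nat \<Rightarrow> nat \<Rightarrow> rose list \<Rightarrow>\<^sub>0 'k"
  define s where "s = p + i - 1"
  have s: "p < s" "s < p + n - 1" using assms by (auto simp: s_def)
  have "(\<Sum>j=2..i. act (graft (corolla (n - j + 1)) (i - j + 1) (corolla j)) p w) = (\<Sum>j=2..i. ?Y (s + 1 - j) s)"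
  proof (intro sum.cong refl)
    fix j assume "j \<in> {2..i}"
    moreover from this assms have "p + (n - j + 1) + j - 2 = p + n - 1" "p + (i - j + 1) - 1 = s + 1 - j"
      "p + (i - j + 1) + j - 2 = s" "2 \<le> n - j + 1" "i - j + 1 \<le> n - j + 1" by (auto simp: s_def)
    ultimately show "act (graft (corolla (n - j + 1)) (i - j + 1) (corolla j)) p w = ?Y (s + 1 - j) s"
      using assms act_two_corollas[where 'k = 'k, of "n - j + 1" j "i - j + 1" p w] by simp
  qed
  also have "\<dots> = (\<Sum>a\<in>{p..<s}. ?Y a s)"
    by (rule sum.reindex_bij_witness[of _ "\<lambda>a. s + 1 - a" "\<lambda>j. s + 1 - j"]) (use assms in \<open>auto simp: s_def\<close>)
  finally have 1: "(\<Sum>j=2..i. act (graft (corolla (n - j + 1)) (i - j + 1) (corolla j)) p w) = \<dots>" .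
  have "(\<Sum>k=2..n - i + 1. act (graft (corolla (n - k + 1)) i (corolla k)) p w) = (\<Sum>k=2..n - i + 1. ?Y s (s + k - 1))"
  proof (intro sum.cong refl)
    fix k assume k: "k \<in> {2..n - i + 1}"
    moreover from this assms have "p + (n - k + 1) + k - 2 = p + n - 1" "p + i + k - 2 = s + k - 1"
      "i \<le> n - k + 1" "2 \<le> n - k + 1" by (auto simp: s_def)
    ultimately show "act (graft (corolla (n - k + 1)) i (corolla k)) p w = ?Y s (s + k - 1)"
      using assms act_two_corollas[where 'k = 'k, of "n - k + 1" k i p w] by (simp add: s_def)
  qed
  also have "\<dots> = (\<Sum>b\<in>{Suc s..p + n - 1}. ?Y s b)"
    by (rule sum.reindex_bij_witness[of _ "\<lambda>b. b + 1 - s" "\<lambda>k. s + k - 1"]) (use assms in \<open>auto simp: s_def\<close>)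
  finally have 2: "(\<Sum>k=2..n - i + 1. act (graft (corolla (n - k + 1)) i (corolla k)) p w) = \<dots>" .
  have "(\<Sum>a\<in>{p..<s}. ?Y a s) = (\<Sum>b\<in>{Suc s..p + n - 1}. ?Y s b)"
  proof (cases "p + n - 1 < length w")
    case True
    with s show ?thesis by (intro nest_ctr_rel nuop_law_holds)
  next
    case False
    with s have "?Y a s = 0" if "a \<in> {p..<s}" for a using that by (intro nest_ctr_outside) auto
    moreover from False s have "?Y s b = 0" if "b \<in> {Suc s..p + n - 1}" for b
      using that by (intro nest_ctr_outside) auto
    ultimately show ?thesis by simp
  qed
  then show ?thesis
    unfolding nc_rel_eq lin_ext_diff lin_ext_sum lin_ext_single pm.scale_one 1 2 by simp
qed

lemma free_arity_nc:
  "f \<in> free_arity ncHyperCom n \<longleftrightarrow> (\<forall>t\<in>keys f. t \<in> nc_trees \<and> leaves t = n)"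
  by (simp add: free_arity_def)

lemma act_op_ideal:
  assumes "f \<in> op_ideal (ncHyperCom :: (nat, 'k::field) quadratic_data)"
  shows "lin_ext (\<lambda>s. act s p w) f = 0"
  using assms
proof (induction arbitrary: p w rule: op_ideal.induct)
  case (rel r)
  then show ?case by (auto simp: ncHyperCom_def act_nc_rel)
next
  case (comp_left f m g n i)
  have "lin_ext (\<lambda>s. act s p w) (pcomp ncHyperCom f i g) =
      lin_ext (\<lambda>s. lin_ext (\<lambda>t. lin_ext (act s p) (act t (p + i - 1) w)) g) f"
    unfolding pcomp_nc lin_ext_lin_ext lin_ext_single
    using comp_left.hyps by (intro lin_ext_cong) (auto simp: free_arity_nc act_graft)
  also have "\<dots> = lin_ext (\<lambda>t. lin_ext (\<lambda>s. lin_ext (act s p) (act t (p + i - 1) w)) f) g"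
    by (rule lin_ext_swap)
  also have "\<dots> = lin_ext (\<lambda>t. lin_ext (\<lambda>v. lin_ext (\<lambda>s. act s p v) f) (act t (p + i - 1) w)) g"
    by (intro lin_ext_cong lin_ext_swap)
  finally show ?case by (simp add: comp_left.IH)
next
  case (comp_right g n f m i)
  have "lin_ext (\<lambda>s. act s p w) (pcomp ncHyperCom f i g) =
      lin_ext (\<lambda>s. lin_ext (act s p) (lin_ext (\<lambda>t. act t (p + i - 1) w) g)) f"
    unfolding pcomp_nc lin_ext_lin_ext lin_ext_single
    using comp_right.hyps by (intro lin_ext_cong) (auto simp: free_arity_nc act_graft)
  then show ?case by (simp add: comp_right.IH)
qed (simp_all add: lin_ext_add lin_ext_scale)

section \<open>Normal monomials as rose trees\<close>

primrec emb :: "rose \<Rightarrow> nat ptree"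
  where "emb (R us) = (if us = [] then Leaf else Node (Suc (length us)) (Leaf # map emb us))"

lemma leaves_emb [simp]: "leaves (emb r) = nodes r"
  by (induction r) (auto cong: map_cong simp: comp_def)

text \<open>Each vertex of a normal monomial is applied to a word that starts with the generator,
  where \<open>nuop\<close> just puts \<open>R\<close> around the remaining letters. So the monomial
  evaluates to its own rose tree.\<close>

lemma act_emb: "act (emb r) (length x) (x @ replicate (nodes r) (R []) @ y) = (mon (x @ r # y) :: 'k::field word_vec)"
proof (induction r arbitrary: x y)
  case (R us)
  have list: "act_list (map emb vs) (length x) (x @ replicate (sum_list (map nodes vs)) (R []) @ y) =
      (mon (x @ vs @ y) :: 'k word_vec)"
    if "set vs \<subseteq> set us" for vs x y
    using that
  proof (induction vs arbitrary: x)
    case (Cons v vs)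
    then show ?case
      using R.IH[of v x "replicate (sum_list (map nodes vs)) (R []) @ y"] Cons.IH[of "x @ [v]"]
      by (simp add: replicate_add)
  qed simp
  show ?case
  proof (cases "us = []")
    case False
    have "act_list (Leaf # map emb us) (length x) (x @ replicate (nodes (R us)) (R []) @ y) =
        (mon (x @ (R [] # us) @ y) :: 'k word_vec)"
      using list[of us "x @ [R []]"] by simp
    moreover have "ctr (length x) (length x + length us) (x @ (R [] # us) @ y) =
        (push (\<lambda>z. x @ z # y) (nuop (R [] # us)) :: 'k word_vec)"
      by (rule ctr_block) auto
    ultimately show ?thesis
      using False by (simp add: nuop_Cons split_op_def)
  qed simp
qed

fun normal :: "nat ptree \<Rightarrow> bool"
  where
    "normal Leaf = True"
  | "normal (Node x ts) = (x = length ts \<and> 2 \<le> length ts \<and> hd ts = Leaf \<and> (\<forall>t\<in>set ts. normal t))"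

lemma normal_emb: "normal (emb r)"
  by (induction r) (auto simp: Suc_le_eq)

lemma normal_imp_emb: "normal t \<Longrightarrow> \<exists>r. t = emb r"
proof (induction t)
  case Leaf
  then show ?case by (intro exI[of _ "R []"]) simp
next
  case (Node x ts)
  then obtain us where ts: "ts = Leaf # us" "us \<noteq> []" by (cases ts) (auto simp: Suc_le_eq)
  have "\<forall>u\<in>set us. \<exists>r. u = emb r" using Node ts by auto
  then obtain g where g: "\<And>u. u \<in> set us \<Longrightarrow> u = emb (g u)" by metis
  have "map (\<lambda>u. emb (g u)) us = us" using g by (intro map_idI) auto
  then have "Node x ts = emb (R (map g us))"
    using Node.prems ts by (simp add: comp_def)
  then show ?case by blast
qed

lemma normal_in_trees: "normal t \<Longrightarrow> t \<in> nc_trees"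
  by (induction t) (auto simp: Node_in_trees_iff intro: trees.Leaf)

text \<open>Evaluate the tree on copies of the generator, take the one letter that remains, and read
  it as a normal monomial. This map kills the ideal and fixes normal monomials, which makes the
  latter independent.\<close>

definition nform :: "nat ptree \<Rightarrow> (nat ptree \<Rightarrow>\<^sub>0 'k::field)"
  where "nform a = push (\<lambda>w. emb (hd w)) (act a 0 (replicate (leaves a) (R [])))"

lemma nform_normal: "normal a \<Longrightarrow> nform a = (mon a :: 'k::field tree_vec)"
proof -
  assume "normal a"
  then obtain r where "a = emb r" using normal_imp_emb by blast
  then show ?thesis using act_emb[where 'k = 'k, of r "[]" "[]"] by (simp add: nform_def)
qed

lemma nform_op_ideal:
  assumes "f \<in> op_ideal (ncHyperCom :: (nat, 'k::field) quadratic_data)" "f \<in> free_arity ncHyperCom n"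
  shows "lin_ext nform f = 0"
proof -
  have "lin_ext nform f = lin_ext (\<lambda>a. push (\<lambda>w. emb (hd w)) (act a 0 (replicate n (R [])))) f"
    using assms(2) by (intro lin_ext_cong) (auto simp: free_arity_nc nform_def)
  also have "\<dots> = push (\<lambda>w. emb (hd w)) (lin_ext (\<lambda>a. act a 0 (replicate n (R []))) f)"
    by (simp add: lin_ext_lin_ext)
  finally show ?thesis by (simp add: act_op_ideal[OF assms(1)])
qed

lemma keys_pushE:
  assumes "t \<in> keys (push F f :: 't \<Rightarrow>\<^sub>0 'k::field)"
  obtains s where "s \<in> keys f" "t = F s"
  using assms subsetD[OF keys_push] by fastforce

lemma keys_minusE:
  assumes "t \<in> keys (f - g)"
  obtains "t \<in> keys f" | "t \<in> keys g"
  using assms subsetD[OF keys_diff_subset] by fastforce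

lemma keys_sum_monE:
  assumes "t \<in> keys (\<Sum>i\<in>I. Poly_Mapping.single (F i) c)"
  obtains i where "i \<in> I" "t = F i"
  using assms subsetD[OF keys_sum_subset] by (fastforce split: if_splits)

subsection \<open>Substitution into tree monomials\<close>

text \<open>Simultaneous grafting on all leaves. It presents a monomial as a quadratic one with
  trees on its leaves, and later merges the labels of a decorated tree.\<close>

fun subst :: "'x ptree \<Rightarrow> 'x ptree list \<Rightarrow> 'x ptree"
  and subst_list :: "'x ptree list \<Rightarrow> 'x ptree list \<Rightarrow> 'x ptree list"
  where
    "subst Leaf zs = hd zs"
  | "subst (Node x ss) zs = Node x (subst_list ss zs)"
  | "subst_list [] zs = []"
  | "subst_list (s # ss) zs = subst s (take (leaves s) zs) # subst_list ss (drop (leaves s) zs)"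

lemma length_subst_list [simp]: "length (subst_list ss zs) = length ss"
  by (induction ss arbitrary: zs) auto

lemma subst_induct [case_names Leaf Node Nil Cons]:
  fixes P :: "'x ptree \<Rightarrow> 'x ptree list \<Rightarrow> bool"
  assumes "\<And>zs. P Leaf zs"
    and "\<And>x ss zs. Q ss zs \<Longrightarrow> P (Node x ss) zs"
    and "\<And>zs. Q [] zs"
    and "\<And>s ss zs. P s (take (leaves s) zs) \<Longrightarrow> Q ss (drop (leaves s) zs) \<Longrightarrow> Q (s # ss) zs"
  shows "P s zs" "Q ss zs'"
  using subst_subst_list.induct[of P Q] assms by blast+

lemma sum_list_take_drop: "sum_list (map f (take n xs)) + sum_list (map f (drop n xs)) = (sum_list (map f xs) :: nat)"
  by (metis append_take_drop_id map_append sum_list_append)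

lemma leaves_subst:
  fixes s :: "'x ptree" and ss :: "'x ptree list"
  shows "length zs = leaves s \<Longrightarrow> leaves (subst s zs) = sum_list (map leaves zs)"
  "length zs' = sum_list (map leaves ss) \<Longrightarrow>
    sum_list (map leaves (subst_list ss zs')) = sum_list (map leaves zs')"
proof (induction s zs and ss zs' rule: subst_induct)
  case (Leaf zs)
  then show ?case by (cases zs) auto
qed (auto simp: sum_list_take_drop)

lemma vertices_subst:
  fixes s :: "'x ptree" and ss :: "'x ptree list"
  shows "length zs = leaves s \<Longrightarrow> vertices (subst s zs) = vertices s + sum_list (map vertices zs)"
  "length zs' = sum_list (map leaves ss) \<Longrightarrow>
    sum_list (map vertices (subst_list ss zs')) = sum_list (map vertices ss) + sum_list (map vertices zs')"
proof (induction s zs and ss zs' rule: subst_induct)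
  case (Leaf zs)
  then show ?case by (cases zs) auto
next
  case (Cons s ss zs)
  then show ?case using sum_list_take_drop[of vertices "leaves s" zs] by simp
qed auto

lemma subst_in_trees:
  fixes s :: "'x ptree" and ss :: "'x ptree list"
  shows "s \<in> trees G ar \<Longrightarrow> length zs = leaves s \<Longrightarrow> set zs \<subseteq> trees G ar \<Longrightarrow> subst s zs \<in> trees G ar"
  "set ss \<subseteq> trees G ar \<Longrightarrow> length zs' = sum_list (map leaves ss) \<Longrightarrow> set zs' \<subseteq> trees G ar \<Longrightarrow>
    set (subst_list ss zs') \<subseteq> trees G ar"
proof (induction s zs and ss zs' rule: subst_induct)
  case (Leaf zs)
  then show ?case by (cases zs) auto
next
  case (Cons s ss zs)
  then have "set (take (leaves s) zs) \<subseteq> trees G ar" "set (drop (leaves s) zs) \<subseteq> trees G ar"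
    by (meson order_trans set_take_subset set_drop_subset)+
  with Cons show ?case by auto
qed (auto simp: Node_in_trees_iff)

lemma subst_replicate_Leaf:
  fixes s :: "'x ptree" and ss :: "'x ptree list"
  shows "zs = replicate (leaves s) Leaf \<Longrightarrow> subst s zs = s"
  "zs' = replicate (sum_list (map leaves ss)) Leaf \<Longrightarrow> subst_list ss zs' = ss"
  by (induction s zs and ss zs' rule: subst_induct) auto

lemma subst_list_replicate_Leaf: "length ws = k \<Longrightarrow> subst_list (replicate k Leaf) ws = ws"
  by (induction k arbitrary: ws) (auto simp: length_Suc_conv)

text \<open>Peels off the leftmost grafting. The q positions before it carry bare leaves, so the
  tree z sits at leaf \<open>Suc q\<close> of what has been built so far.\<close>

lemma subst_graft_step:
  fixes s :: "'x ptree" and ss :: "'x ptree list"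
  shows "\<lbrakk>zs = replicate q Leaf @ z # ws; length zs = leaves s\<rbrakk> \<Longrightarrow>
    subst s zs = graft (subst s (replicate (Suc q) Leaf @ ws)) (Suc q) z"
  "\<lbrakk>zs' = replicate q' Leaf @ z # ws'; length zs' = sum_list (map leaves ss)\<rbrakk> \<Longrightarrow>
    subst_list ss zs' = graft_list (subst_list ss (replicate (Suc q') Leaf @ ws')) (Suc q') z"
proof (induction s zs and ss zs' arbitrary: q ws and q' ws' rule: subst_induct)
  case (Leaf zs)
  then show ?case by (cases q) auto
next
  case (Node x ss zs)
  from Node(1)[OF Node(2)] Node(3) show ?case by simp
next
  case (Nil zs)
  then show ?case by simp
next
  case (Cons s ss zs)
  let ?l = "leaves s"
  have len: "length zs = ?l + sum_list (map leaves ss)" using Cons.prems by simp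
  show ?case
  proof (cases "q' < ?l")
    case True
    then have t: "take ?l zs = replicate q' Leaf @ z # take (?l - Suc q') ws'"
      "take ?l (replicate (Suc q') Leaf @ ws') = replicate (Suc q') Leaf @ take (?l - Suc q') ws'"
      "drop ?l zs = drop (?l - Suc q') ws'"
      "drop ?l (replicate (Suc q') Leaf @ ws') = drop (?l - Suc q') ws'"
      using Cons.prems(1) by (auto simp: take_Cons' drop_Cons' Suc_diff_Suc)
    let ?s' = "subst s (replicate (Suc q') Leaf @ take (?l - Suc q') ws')"
    have "subst s (take ?l zs) = graft ?s' (Suc q') z"
      using len by (intro Cons.IH(1)[OF t(1)]) simp
    moreover have "length (replicate (Suc q') Leaf @ take (?l - Suc q') ws') = ?l"
      using Cons.prems len True by auto
    then have "Suc q' \<le> leaves ?s'"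
      by (simp add: leaves_subst sum_list_replicate)
    ultimately show ?thesis using t by simp
  next
    case False
    then have t: "take ?l zs = replicate ?l Leaf"
      "take ?l (replicate (Suc q') Leaf @ ws') = replicate ?l Leaf"
      "drop ?l zs = replicate (q' - ?l) Leaf @ z # ws'"
      "drop ?l (replicate (Suc q') Leaf @ ws') = replicate (Suc (q' - ?l)) Leaf @ ws'"
      using Cons.prems(1) by (auto simp: Suc_diff_le min_def simp del: replicate.simps)
    have "subst_list ss (drop ?l zs) = graft_list (subst_list ss (replicate (Suc (q' - ?l)) Leaf @ ws')) (Suc (q' - ?l)) z"
      using len by (intro Cons.IH(2)[OF t(3)]) simp
    then show ?thesis using t False by (simp add: subst_replicate_Leaf Suc_diff_le del: replicate.simps)
  qed
qed

lemma leaves_graft: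
  fixes s :: "'x ptree" and ss :: "'x ptree list"
  shows "1 \<le> i \<Longrightarrow> i \<le> leaves s \<Longrightarrow> leaves (graft s i t) + 1 = leaves s + leaves t"
  "1 \<le> i' \<Longrightarrow> i' \<le> sum_list (map leaves ss) \<Longrightarrow>
    sum_list (map leaves (graft_list ss i' t')) + 1 = sum_list (map leaves ss) + leaves t'"
  by (induction s i t and ss i' t' rule: graft_graft_list.induct) auto

lemma vertices_graft:
  fixes s :: "'x ptree" and ss :: "'x ptree list"
  shows "1 \<le> i \<Longrightarrow> i \<le> leaves s \<Longrightarrow> vertices (graft s i t) = vertices s + vertices t"
  "1 \<le> i' \<Longrightarrow> i' \<le> sum_list (map leaves ss) \<Longrightarrow>
    sum_list (map vertices (graft_list ss i' t')) = sum_list (map vertices ss) + vertices t'"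
  by (induction s i t and ss i' t' rule: graft_graft_list.induct) auto

lemma graft_in_trees:
  "s \<in> nc_trees \<Longrightarrow> t \<in> nc_trees \<Longrightarrow> graft s i t \<in> nc_trees"
  "set ss \<subseteq> nc_trees \<Longrightarrow> t' \<in> nc_trees \<Longrightarrow> set (graft_list ss i' t') \<subseteq> nc_trees"
  by (induction s i t and ss i' t' rule: graft_graft_list.induct) (auto simp: Node_in_trees_iff)

lemma subst_graft:
  fixes s :: "'x ptree" and ss :: "'x ptree list"
  shows "\<lbrakk>1 \<le> i; i \<le> leaves s; length xs = i - 1; length us = leaves t; length ys = leaves s - i\<rbrakk> \<Longrightarrow>
    subst (graft s i t) (xs @ us @ ys) = subst s (xs @ subst t us # ys)"
  "\<lbrakk>1 \<le> i'; i' \<le> sum_list (map leaves ss); length xs' = i' - 1; length us' = leaves t';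
    length ys' = sum_list (map leaves ss) - i'\<rbrakk> \<Longrightarrow>
    subst_list (graft_list ss i' t') (xs' @ us' @ ys') = subst_list ss (xs' @ subst t' us' # ys')"
proof (induction s i t and ss i' t' arbitrary: xs us ys and xs' us' ys' rule: graft_graft_list.induct)
  case (4 s ss i t)
  show ?case
  proof (cases "i \<le> leaves s")
    case True
    define m where "m = leaves s - i"
    have l: "leaves s = length xs' + Suc m" "leaves (graft s i t) = length xs' + (length us' + m)"
      using leaves_graft(1)[of i s t] 4(3-) True by (auto simp: m_def)
    have t: "take (leaves (graft s i t)) (xs' @ us' @ ys') = xs' @ us' @ take m ys'"
      "drop (leaves (graft s i t)) (xs' @ us' @ ys') = drop m ys'"
      unfolding l(2) by simp_all
    have t': "take (leaves s) (xs' @ v # ys') = xs' @ v # take m ys'"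
      "drop (leaves s) (xs' @ v # ys') = drop m ys'" for v
      unfolding l(1) by simp_all
    have "length (take m ys') = leaves s - i" using 4(3-) True by (simp add: m_def)
    with 4(1)[OF True, of xs' us' "take m ys'"] 4(3-) True
    have "subst (graft s i t) (xs' @ us' @ take m ys') = subst s (xs' @ subst t us' # take m ys')"
      by blast
    with True show ?thesis by (simp only: graft_list.simps subst_list.simps if_True t t')
  next
    case False
    have l: "take (leaves s) (xs' @ zs) = take (leaves s) xs'" "drop (leaves s) (xs' @ zs) = drop (leaves s) xs' @ zs" for zs
      using False 4(3-) by auto
    show ?thesis
      using False 4(2)[OF False, of "drop (leaves s) xs'" us' ys'] 4(3-)
      by (simp add: l)
  qed
qed auto

subsection \<open>A rank that increases under rewriting\<close>

text \<open>\<open>rank p t\<close> is the sum over the vertices of \<open>t\<close> of \<open>p j\<close>, where \<open>j\<close> is the number of leaves to the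
  left of the vertex. The auxiliary \<open>p\<close> keeps track of the sizes of the trees substituted into \<open>t\<close>.\<close>

fun rank :: "(nat \<Rightarrow> nat) \<Rightarrow> 'x ptree \<Rightarrow> nat"
  and rank_list :: "(nat \<Rightarrow> nat) \<Rightarrow> 'x ptree list \<Rightarrow> nat"
  where
    "rank p Leaf = 0"
  | "rank p (Node x ts) = p 0 + rank_list p ts"
  | "rank_list p [] = 0"
  | "rank_list p (t # ts) = rank p t + rank_list (\<lambda>j. p (j + leaves t)) ts"

lemma rank_list_append:
  "rank_list p (ss @ ts) = rank_list p ss + rank_list (\<lambda>j. p (j + sum_list (map leaves ss))) ts"
  by (induction ss arbitrary: p) (auto simp: add_ac)

lemma rank_cong:
  assumes "t \<in> nc_trees" "\<And>j. j < leaves t \<Longrightarrow> p j = q j"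
  shows "rank p t = rank q t"
  using assms
proof (induction t arbitrary: p q rule: trees.induct)
  case (Node x ts)
  have list: "rank_list p us = rank_list q us"
    if "set us \<subseteq> set ts" "\<And>j. j < sum_list (map leaves us) \<Longrightarrow> p j = q j" for us p q
    using that
  proof (induction us arbitrary: p q)
    case (Cons u us)
    have "rank p u = rank q u" using Cons.prems by (intro Node.IH) auto
    moreover have "rank_list (\<lambda>j. p (j + leaves u)) us = rank_list (\<lambda>j. q (j + leaves u)) us"
      using Cons.prems by (intro Cons.IH) auto
    ultimately show ?case by simp
  qed simp
  have "Node x ts \<in> nc_trees" using Node.hyps by (auto simp: Node_in_trees_iff)
  then have "p 0 = q 0" using Node.prems leaves_pos by blast
  with list[of ts p q] Node.prems show ?case by simp
qed simp

text \<open>A vertex of s with j leaves to its left acquires the leaves of the first j substituted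
  trees. Substitution thus reparametrises the weight p, which is why p is kept general.\<close>

lemma rank_subst:
  assumes "s \<in> nc_trees" "length zs = leaves s"
  shows "rank p (subst s zs) = rank (\<lambda>j. p (sum_list (map leaves (take j zs)))) s + rank_list p zs"
  using assms
proof (induction s arbitrary: p zs rule: trees.induct)
  case Leaf
  then show ?case by (cases zs) auto
next
  case (Node x ts)
  have list: "rank_list p (subst_list us zs) = rank_list (\<lambda>j. p (sum_list (map leaves (take j zs)))) us + rank_list p zs"
    if "set us \<subseteq> set ts" "length zs = sum_list (map leaves us)" for us p and zs :: "nat ptree list"
    using that
  proof (induction us arbitrary: p zs)
    case (Cons u us)
    let ?l = "leaves u"
    have u: "u \<in> nc_trees" using Cons.prems Node.hyps by auto
    have "rank p (subst u (take ?l zs)) = rank (\<lambda>j. p (sum_list (map leaves (take j (take ?l zs))))) u + rank_list p (take ?l zs)"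
      using Cons.prems by (intro Node.IH) auto
    also have "rank (\<lambda>j. p (sum_list (map leaves (take j (take ?l zs))))) u = rank (\<lambda>j. p (sum_list (map leaves (take j zs)))) u"
      using u by (intro rank_cong) (auto simp: min_def)
    finally have 1: "rank p (subst u (take ?l zs)) = rank (\<lambda>j. p (sum_list (map leaves (take j zs)))) u + rank_list p (take ?l zs)" .
    define p' where "p' = (\<lambda>j. p (j + sum_list (map leaves (take ?l zs))))"
    have "leaves (subst u (take ?l zs)) = sum_list (map leaves (take ?l zs))"
      using Cons.prems by (intro leaves_subst) auto
    then have "rank_list (\<lambda>j. p (j + leaves (subst u (take ?l zs)))) (subst_list us (drop ?l zs)) =
        rank_list (\<lambda>j. p' (sum_list (map leaves (take j (drop ?l zs))))) us + rank_list p' (drop ?l zs)"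
      using Cons.prems unfolding p'_def by (simp add: Cons.IH)
    moreover have "p' (sum_list (map leaves (take j (drop ?l zs)))) = p (sum_list (map leaves (take (j + ?l) zs)))" for j
      by (simp add: p'_def add.commute[of j] take_add) (simp add: add.commute)
    ultimately have 2: "rank_list (\<lambda>j. p (j + leaves (subst u (take ?l zs)))) (subst_list us (drop ?l zs)) =
        rank_list (\<lambda>j. p (sum_list (map leaves (take (j + ?l) zs)))) us + rank_list p' (drop ?l zs)"
      by simp
    have "rank_list p zs = rank_list p (take ?l zs) + rank_list p' (drop ?l zs)"
      using rank_list_append[of p "take ?l zs" "drop ?l zs"] by (simp add: p'_def)
    with 1 2 show ?case by simp
  qed simp
  show ?case using list[of ts zs p] Node.prems by simp
qed

text \<open>With leaves and vertices fixed the rank is bounded; this is what stops the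
  rewriting.\<close>

lemma rank_le: "t \<in> nc_trees \<Longrightarrow> rank (\<lambda>j. j + c) t \<le> (c + leaves t) * vertices t"
proof (induction t arbitrary: c rule: trees.induct)
  case (Node x ts)
  have "rank_list (\<lambda>j. j + c) us \<le> (c + sum_list (map leaves us)) * sum_list (map vertices us)"
    if "set us \<subseteq> set ts" for us c
    using that
  proof (induction us arbitrary: c)
    case (Cons u us)
    have "rank (\<lambda>j. j + c) u \<le> (c + leaves u) * vertices u" using Cons.prems by (intro Node.IH) auto
    also have "\<dots> \<le> (c + leaves u + sum_list (map leaves us)) * vertices u" by simp
    finally show ?case
      using Cons.IH[of "c + leaves u"] Cons.prems by (simp add: add_mult_distrib2 add_ac)
  qed simp
  from this[of ts c] show ?case by simp
qed simp

text \<open>The quantification over all strictly increasing weights makes the relation stable under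
  substitution and under adding siblings to the left, both of which change the weight.\<close>

definition lower :: "nat ptree \<Rightarrow> nat ptree \<Rightarrow> bool"
  where "lower s t \<longleftrightarrow> (\<forall>p. strict_mono p \<longrightarrow> rank p s < rank p t)"

lemma lower_trans: "lower s t \<Longrightarrow> lower t u \<Longrightarrow> lower s u"
  unfolding lower_def by (meson less_trans)

lemma lower_subst:
  assumes "lower s t" "s \<in> nc_trees" "t \<in> nc_trees" "leaves s = leaves t" "length zs = leaves s" "set zs \<subseteq> nc_trees"
  shows "lower (subst s zs) (subst t zs)"
  unfolding lower_def
proof (intro allI impI)
  fix p :: "nat \<Rightarrow> nat" assume p: "strict_mono p"
  \<comment> \<open>The second summand keeps e strictly increasing beyond the length of zs.\<close>
  define e where "e j = sum_list (map leaves (take j zs)) + (j - length zs)" for j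
  have "strict_mono e"
    unfolding strict_mono_Suc_iff
  proof
    fix j show "e j < e (Suc j)"
    proof (cases "j < length zs")
      case True
      then have "0 < leaves (zs ! j)" using assms(6) leaves_pos nth_mem by blast
      with True show ?thesis by (simp add: e_def take_Suc_conv_app_nth)
    qed (simp add: e_def)
  qed
  with p have "strict_mono (\<lambda>j. p (e j))" by (simp add: strict_mono_def)
  with assms(1) have "rank (\<lambda>j. p (e j)) s < rank (\<lambda>j. p (e j)) t" by (simp add: lower_def)
  moreover have "rank (\<lambda>j. p (e j)) r = rank (\<lambda>j. p (sum_list (map leaves (take j zs)))) r"
    if "r \<in> nc_trees" "leaves r = length zs" for r
    using that by (intro rank_cong) (auto simp: e_def)
  ultimately show "rank p (subst s zs) < rank p (subst t zs)"
    using assms by (simp add: rank_subst)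
qed

lemma lower_Node:
  assumes "lower s t" "leaves s = leaves t"
  shows "lower (Node x (ls @ s # rs)) (Node x (ls @ t # rs))"
  unfolding lower_def
proof (intro allI impI)
  fix p :: "nat \<Rightarrow> nat" assume "strict_mono p"
  then have "strict_mono (\<lambda>j. p (j + sum_list (map leaves ls)))" by (simp add: strict_mono_def)
  with assms show "rank p (Node x (ls @ s # rs)) < rank p (Node x (ls @ t # rs))"
    by (simp add: rank_list_append lower_def)
qed

lemma vertices_corolla [simp]: "vertices (corolla k) = 1"
  by (simp add: corolla_def sum_list_replicate)

lemma graft_corolla_eq_subst:
  assumes "1 \<le> j" "j \<le> k"
  shows "graft (corolla k) j t = subst (corolla k) (replicate (j - 1) Leaf @ t # replicate (k - j) Leaf)"
proof -
  have "subst (corolla k) (replicate (j - 1) Leaf @ t # replicate (k - j) Leaf) =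
      graft (subst (corolla k) (replicate (Suc (j - 1)) Leaf @ replicate (k - j) Leaf)) (Suc (j - 1)) t"
    by (rule subst_graft_step(1)) (use assms in auto)
  also have "replicate (Suc (j - 1)) Leaf @ replicate (k - j) Leaf = replicate (leaves (corolla k)) (Leaf :: nat ptree)"
    using assms by (simp flip: replicate_add replicate_Suc del: replicate.simps)
  finally show ?thesis using assms by (simp add: subst_replicate_Leaf)
qed

lemma rank_list_replicate_Leaf [simp]: "rank_list p (replicate k Leaf) = 0"
  by (induction k arbitrary: p) auto

lemma rank_corolla [simp]: "rank p (corolla k) = p 0"
  by (simp add: corolla_def)

text \<open>The upper vertex has j - 1 leaves to its left, so among compositions of two generators
  the one at the first leaf has the least rank.\<close>

lemma rank_two_corollas:
  assumes "1 \<le> j" "j \<le> k" "2 \<le> k"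
  shows "rank p (graft (corolla k) j (corolla l)) = p 0 + p (j - 1)"
  using assms by (simp add: graft_corolla_eq_subst rank_subst corolla_in_trees rank_list_append sum_list_replicate)

lemma graft_list_append_Leaf:
  "graft_list (ls @ Leaf # rs) (Suc (sum_list (map leaves ls))) t = ls @ t # rs"
  by (induction ls) auto

subsection \<open>Rewriting to normal forms\<close>

lemma subspace_op_ideal: "pm.subspace (op_ideal D)"
  by (auto simp: pm.subspace_def intro: op_ideal.intros)

lemma op_ideal_Node:
  assumes "f \<in> op_ideal ncHyperCom" "f \<in> free_arity ncHyperCom n"
    and "set ls \<subseteq> nc_trees" "set rs \<subseteq> nc_trees" "x = length ls + length rs + 1" "2 \<le> x"
  shows "push (\<lambda>t. Node x (ls @ t # rs)) f \<in> op_ideal ncHyperCom"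
proof -
  let ?s = "Node x (ls @ Leaf # rs)"
  have "?s \<in> nc_trees" using assms by (auto simp: Node_in_trees_iff intro: trees.Leaf)
  then have "pcomp ncHyperCom (mon ?s) (Suc (sum_list (map leaves ls))) f \<in> op_ideal ncHyperCom"
    using assms by (intro op_ideal.comp_right[where m = "leaves ?s"]) (auto simp: free_arity_nc)
  then show ?thesis by (simp add: pcomp_nc graft_list_append_Leaf)
qed

text \<open>The ideal is closed under single graftings. The trees are attached from right to left,
  so that the numbers of the leaves still to be used do not change.\<close>

lemma op_ideal_subst:
  assumes f: "f \<in> op_ideal ncHyperCom" "f \<in> free_arity ncHyperCom (length zs)" and zs: "set zs \<subseteq> nc_trees"
  shows "push (\<lambda>s. subst s zs) f \<in> op_ideal ncHyperCom"
proof -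
  have "push (\<lambda>s. subst s (replicate q Leaf @ ws)) f \<in> op_ideal ncHyperCom"
    if "q + length ws = length zs" "set ws \<subseteq> nc_trees" for q ws
    using that
  proof (induction ws arbitrary: q)
    case Nil
    have "push (\<lambda>s. subst s (replicate q Leaf @ [])) f = push (\<lambda>s. s) f"
      using f(2) Nil by (intro lin_ext_cong) (auto simp: free_arity_nc subst_replicate_Leaf)
    with f show ?case by simp
  next
    case (Cons z ws)
    let ?f = "push (\<lambda>s. subst s (replicate (Suc q) Leaf @ ws)) f"
    let ?m = "Suc q + sum_list (map leaves ws)"
    have len: "length (replicate (Suc q) Leaf @ ws) = leaves s" if "s \<in> keys f" for s
      using that f(2) Cons.prems by (auto simp: free_arity_nc)
    have "?f \<in> op_ideal ncHyperCom" using Cons.prems by (intro Cons.IH) auto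
    moreover have "?f \<in> free_arity ncHyperCom ?m"
      unfolding free_arity_nc
    proof
      fix t assume "t \<in> keys ?f"
      then obtain s where s: "s \<in> keys f" "t = subst s (replicate (Suc q) Leaf @ ws)"
        by (rule keys_pushE)
      with f(2) have "s \<in> nc_trees" by (simp add: free_arity_nc)
      then show "t \<in> nc_trees \<and> leaves t = ?m"
        using s len[OF s(1)] Cons.prems
        by (auto simp: leaves_subst sum_list_replicate intro!: subst_in_trees trees.Leaf simp del: replicate.simps)
    qed
    ultimately have "pcomp ncHyperCom ?f (Suc q) (mon z) \<in> op_ideal ncHyperCom"
      using Cons.prems by (intro op_ideal.comp_left[where m = ?m and n = "leaves z"]) (auto simp: free_arity_nc)
    also have "pcomp ncHyperCom ?f (Suc q) (mon z) =
        push (\<lambda>s. graft (subst s (replicate (Suc q) Leaf @ ws)) (Suc q) z) f"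
      by (simp add: pcomp_nc lin_ext_lin_ext)
    also have "\<dots> = push (\<lambda>s. subst s (replicate q Leaf @ z # ws)) f"
      using len by (intro lin_ext_cong) (simp add: subst_graft_step(1)[OF refl])
    finally show ?case .
  qed
  from this[of 0 zs] zs show ?thesis by simp
qed

text \<open>The leading term of \<open>nc_rel n i\<close> is its unique term with a composition at the first leaf.\<close>

lemma nc_rel_leading:
  assumes "3 \<le> n" "2 \<le> i" "i \<le> n - 1"
  obtains r where "nc_rel n i = mon (graft (corolla (n - i + 1)) 1 (corolla i)) - r"
    "keys r \<subseteq> {graft (corolla k) j (corolla l) | k j l. 2 \<le> k \<and> 2 \<le> l \<and> 2 \<le> j \<and> j \<le> k \<and> k + l = n + 1}"
proof -
  let ?r = "(\<Sum>k=2..n - i + 1. mon (graft (corolla (n - k + 1)) i (corolla k))) -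
    (\<Sum>j\<in>{2..<i}. mon (graft (corolla (n - j + 1)) (i - j + 1) (corolla j)))"
  show thesis
  proof
    have "{2..i} = insert i {2..<i}" using assms by auto
    then show "nc_rel n i = mon (graft (corolla (n - i + 1)) 1 (corolla i)) - ?r"
      by (simp add: nc_rel_eq)
  next
    show "keys ?r \<subseteq> {graft (corolla k) j (corolla l) | k j l. 2 \<le> k \<and> 2 \<le> l \<and> 2 \<le> j \<and> j \<le> k \<and> k + l = n + 1}"
    proof
      fix t assume "t \<in> keys ?r"
      then consider k where "k \<in> {2..n - i + 1}" "t = graft (corolla (n - k + 1)) i (corolla k)"
        | j where "j \<in> {2..<i}" "t = graft (corolla (n - j + 1)) (i - j + 1) (corolla j)"
        by (elim keys_minusE keys_sum_monE)
      then show "t \<in> {graft (corolla k) j (corolla l) | k j l. 2 \<le> k \<and> 2 \<le> l \<and> 2 \<le> j \<and> j \<le> k \<and> k + l = n + 1}"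
      proof cases
        case 1
        then show ?thesis using assms by (intro CollectI exI[of _ "n - k + 1"] exI[of _ i] exI[of _ k]) auto
      next
        case 2
        then show ?thesis using assms by (intro CollectI exI[of _ "n - j + 1"] exI[of _ "i - j + 1"] exI[of _ j]) auto
      qed
    qed
  qed
qed

lemma nc_rel_in_ideal: "3 \<le> n \<Longrightarrow> 2 \<le> i \<Longrightarrow> i \<le> n - 1 \<Longrightarrow> nc_rel n i \<in> op_ideal ncHyperCom"
  by (rule op_ideal.rel) (auto simp: ncHyperCom_def)

lemma two_corollas:
  assumes "2 \<le> k" "2 \<le> l" "1 \<le> j" "j \<le> k"
  shows "graft (corolla k) j (corolla l) \<in> nc_trees" "leaves (graft (corolla k) j (corolla l)) + 1 = k + l"
    "vertices (graft (corolla k) j (corolla l)) = 2"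
  using assms leaves_graft(1)[of j "corolla k" "corolla l"]
  by (simp_all add: graft_in_trees corolla_in_trees vertices_graft)

definition better :: "nat ptree \<Rightarrow> nat ptree set"
  where "better c = {c' \<in> nc_trees. leaves c' = leaves c \<and> vertices c' = vertices c \<and> lower c c'}"

text \<open>Some vertex has a vertex as first child; choose one whose child subtrees are normal. The
  two vertices carry the leading term of a relation, and the other terms are higher. Both ideal and
  order are compatible with the surrounding tree.\<close>

lemma rewrite_step:
  assumes "c \<in> nc_trees" "\<not> normal c"
  shows "\<exists>g :: 'k::field tree_vec. mon c - g \<in> op_ideal ncHyperCom \<and> keys g \<subseteq> better c"
  using assms
proof (induction c rule: trees.induct)
  case (Node x ts)
  show ?case
  proof (cases "\<forall>t\<in>set ts. normal t")
    case False
    then obtain t where t: "t \<in> set ts" "\<not> normal t" by blast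
    then obtain ls rs where ts: "ts = ls @ t # rs" by (meson split_list)
    from Node.IH[OF t] obtain g :: "'k tree_vec" where g: "mon t - g \<in> op_ideal ncHyperCom" "keys g \<subseteq> better t"
      by blast
    have tr: "t \<in> nc_trees" using Node.hyps t by auto
    have "mon t - g \<in> free_arity ncHyperCom (leaves t)"
      unfolding free_arity_nc using g(2) tr subsetD[OF keys_diff_subset] by (fastforce simp: better_def)
    with g(1) have "push (\<lambda>t. Node x (ls @ t # rs)) (mon t - g) \<in> op_ideal ncHyperCom"
      by (rule op_ideal_Node) (use Node.hyps ts in auto)
    then have "mon (Node x ts) - push (\<lambda>t. Node x (ls @ t # rs)) g \<in> op_ideal ncHyperCom"
      by (simp add: lin_ext_diff ts)
    moreover have "keys (push (\<lambda>t. Node x (ls @ t # rs)) g) \<subseteq> better (Node x ts)"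
    proof
      fix c assume "c \<in> keys (push (\<lambda>t. Node x (ls @ t # rs)) g)"
      then obtain t' where t': "t' \<in> keys g" "c = Node x (ls @ t' # rs)"
        by (rule keys_pushE)
      with g(2) show "c \<in> better (Node x ts)"
        using Node.hyps ts by (auto simp: better_def Node_in_trees_iff intro!: lower_Node)
    qed
    ultimately show ?thesis by blast
  next
    case True
    then obtain i us vs where ts: "ts = Node i us # vs"
      using Node.hyps Node.prems by (cases ts; cases "hd ts") auto
    have i: "2 \<le> i" "length us = i" "set us \<subseteq> nc_trees" "set vs \<subseteq> nc_trees"
      using Node.hyps(3)[of "Node i us"] Node.hyps(3) ts by (auto simp: Node_in_trees_iff)
    \<comment> \<open>Here zs lists what hangs below the two vertices, so the relation has arity n,
      and its index is the arity i of the first child.\<close>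
    define zs n where "zs = us @ vs" and "n = length zs"
    have n: "3 \<le> n" "i \<le> n - 1" "n - i + 1 = x" "set zs \<subseteq> nc_trees"
      using i Node.hyps ts by (auto simp: n_def zs_def)
    define s0 where "s0 = graft (corolla x) 1 (corolla i)"
    obtain r :: "'k tree_vec" where r: "nc_rel n i = mon s0 - r"
      "keys r \<subseteq> {graft (corolla k) j (corolla l) | k j l. 2 \<le> k \<and> 2 \<le> l \<and> 2 \<le> j \<and> j \<le> k \<and> k + l = n + 1}"
      by (rule nc_rel_leading[OF n(1) i(1) n(2), unfolded n(3), folded s0_def])
    have s0: "s0 \<in> nc_trees" "leaves s0 = n" "vertices s0 = 2" "\<And>p. rank p s0 = p 0 + p 0"
      using two_corollas[of x i 1] i n Node.hyps by (auto simp: s0_def rank_two_corollas)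
    have keys_r: "s \<in> nc_trees \<and> leaves s = n \<and> vertices s = 2 \<and> lower s0 s" if s: "s \<in> keys r" for s
    proof -
      obtain k j l where kjl: "s = graft (corolla k) j (corolla l)" "2 \<le> k" "2 \<le> l" "2 \<le> j" "j \<le> k" "k + l = n + 1"
        using r(2) s by blast
      have "lower s0 s"
        unfolding lower_def using kjl by (auto simp: s0 rank_two_corollas strict_mono_def)
      with kjl two_corollas[of k l j] show ?thesis by auto
    qed
    have "subst s0 zs = subst (corolla x) (subst (corolla i) us # vs)"
      unfolding s0_def zs_def using subst_graft(1)[of 1 "corolla x" "[]" us "corolla i" vs] i n Node.hyps ts by auto
    also have "\<dots> = Node x ts"
      using i Node.hyps ts by (simp add: corolla_def subst_list_replicate_Leaf)
    finally have c: "subst s0 zs = Node x ts" .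
    have "mon s0 - r \<in> free_arity ncHyperCom n"
      unfolding free_arity_nc using keys_r s0 by (auto elim!: keys_minusE)
    then have "push (\<lambda>s. subst s zs) (mon s0 - r) \<in> op_ideal ncHyperCom"
      using nc_rel_in_ideal[where 'a = 'k, OF n(1) i(1) n(2)] n r(1) by (intro op_ideal_subst) (auto simp: n_def)
    then have "mon (Node x ts) - push (\<lambda>s. subst s zs) r \<in> op_ideal ncHyperCom"
      by (simp add: lin_ext_diff c)
    moreover have "keys (push (\<lambda>s. subst s zs) r) \<subseteq> better (Node x ts)"
    proof
      fix t assume "t \<in> keys (push (\<lambda>s. subst s zs) r)"
      then obtain s where s: "s \<in> keys r" "t = subst s zs" by (rule keys_pushE)
      have "lower (subst s0 zs) (subst s zs)"
        using keys_r[OF s(1)] s0 n by (intro lower_subst) (auto simp: n_def)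
      with keys_r[OF s(1)] s0 n s(2) show "t \<in> better (Node x ts)"
        by (auto simp: better_def leaves_subst vertices_subst n_def subst_in_trees simp flip: c)
    qed
    ultimately show ?thesis by blast
  qed
qed simp

definition mod_supp :: "('t \<Rightarrow>\<^sub>0 'k::field) set \<Rightarrow> 't set \<Rightarrow> ('t \<Rightarrow>\<^sub>0 'k) set"
  where "mod_supp I S = {f. \<exists>g\<in>supp S. f - g \<in> I}"

lemma subspace_mod_supp:
  assumes "pm.subspace I" shows "pm.subspace (mod_supp I S)"
proof -
  have "mod_supp I S = {x + y | x y. x \<in> I \<and> y \<in> supp S}"
    by (auto simp: mod_supp_def) (metis diff_add_cancel, metis add_diff_cancel_right')
  then show ?thesis using pm.subspace_sums[OF assms subspace_supp] by simp
qed

lemma mod_supp_mono: "S \<subseteq> S' \<Longrightarrow> mod_supp I S \<subseteq> mod_supp I S'"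
  by (fastforce simp: mod_supp_def supp_def)

lemma mon_in_mod_supp: "pm.subspace I \<Longrightarrow> s \<in> S \<Longrightarrow> mon s \<in> mod_supp I S"
  unfolding mod_supp_def by (intro CollectI bexI[of _ "mon s"]) (auto simp: supp_def pm.subspace_0)

lemma ideal_in_mod_supp: "f \<in> I \<Longrightarrow> f \<in> mod_supp I S"
  unfolding mod_supp_def by (intro CollectI bexI[of _ 0]) (auto simp: supp_def)

lemma lin_ext_in_mod_supp:
  assumes "pm.subspace I" "f - g \<in> I" "\<And>s. s \<in> keys g \<Longrightarrow> mon s \<in> mod_supp I S"
  shows "f \<in> mod_supp I S"
proof -
  have "lin_ext mon g \<in> mod_supp I S"
    using assms by (intro lin_ext_in_subspace subspace_mod_supp)
  moreover have "f - g \<in> mod_supp I S" using assms by (intro ideal_in_mod_supp)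
  ultimately have "(f - g) + g \<in> mod_supp I S"
    by (metis lin_ext_mon pm.subspace_add subspace_mod_supp[OF assms(1)])
  then show ?thesis by simp
qed

text \<open>Each step raises the rank, which is bounded by \<open>rank_le\<close>. The statement
  records that all new terms are higher, because the acyclic matching needs it.\<close>

lemma normal_form:
  assumes "c \<in> nc_trees"
  shows "(mon c :: 'k::field tree_vec) \<in> mod_supp (op_ideal ncHyperCom)
    {c' \<in> nc_trees. normal c' \<and> leaves c' = leaves c \<and> vertices c' = vertices c \<and> (c' = c \<or> lower c c')}"
    (is "_ \<in> mod_supp _ (?N c)")
  using assms
proof (induction c rule: measure_induct_rule[of "\<lambda>c. leaves c * vertices c - rank (\<lambda>j. j) c"])
  case (less c)
  show ?case
  proof (cases "normal c")
    case True
    then show ?thesis using less.prems by (intro mon_in_mod_supp subspace_op_ideal) auto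
  next
    case False
    then obtain g :: "'k tree_vec" where g: "mon c - g \<in> op_ideal ncHyperCom" "keys g \<subseteq> better c"
      using rewrite_step[OF less.prems] by blast
    show ?thesis
    proof (rule lin_ext_in_mod_supp[OF subspace_op_ideal g(1)])
      fix s assume "s \<in> keys g"
      with g(2) have s: "s \<in> nc_trees" "leaves s = leaves c" "vertices s = vertices c" "lower c s"
        by (auto simp: better_def)
      have "rank (\<lambda>j. j) c < rank (\<lambda>j. j) s" using s(4) by (auto simp: lower_def strict_mono_def)
      moreover have "rank (\<lambda>j. j) s \<le> leaves s * vertices s" using rank_le[OF s(1), of 0] by simp
      ultimately have "(mon s :: 'k tree_vec) \<in> mod_supp (op_ideal ncHyperCom) (?N s)"
        using s by (intro less.IH) auto
      moreover have "?N s \<subseteq> ?N c" using s lower_trans by auto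
      ultimately show "(mon s :: 'k tree_vec) \<in> mod_supp (op_ideal ncHyperCom) (?N c)" using mod_supp_mono by blast
    qed
  qed
qed

subsection \<open>The bar differential squares to zero\<close>

text \<open>This and the next lemma are the parallel and sequential axioms for partial
  compositions.\<close>

lemma graft_graft_parallel:
  fixes s :: "'x ptree" and ss :: "'x ptree list"
  shows "\<lbrakk>1 \<le> i; i < j; j \<le> leaves s; 1 \<le> leaves t\<rbrakk> \<Longrightarrow>
    graft (graft s j u) i t = graft (graft s i t) (j + leaves t - 1) u"
  "\<lbrakk>1 \<le> i'; i' < j'; j' \<le> sum_list (map leaves ss); 1 \<le> leaves t'\<rbrakk> \<Longrightarrow>
    graft_list (graft_list ss j' u') i' t' = graft_list (graft_list ss i' t') (j' + leaves t' - 1) u'"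
proof (induction s i t and ss i' t' arbitrary: j u and j' u' rule: graft_graft_list.induct)
  case (4 s ss i t)
  consider "j' \<le> leaves s" | "i \<le> leaves s" "leaves s < j'" | "leaves s < i" by linarith
  then show ?case
  proof cases
    case 1
    then have "leaves (graft s j' u') + 1 = leaves s + leaves u'" "leaves (graft s i t) + 1 = leaves s + leaves t"
      using leaves_graft(1)[of j' s u'] leaves_graft(1)[of i s t] 4(3-) by auto
    then show ?thesis using 1 4(1)[of j' u'] 4(3-) by auto
  next
    case 2
    then have "leaves (graft s i t) + 1 = leaves s + leaves t"
      using leaves_graft(1)[of i s t] 4(3-) by auto
    moreover from this have "j' + leaves t - 1 - leaves (graft s i t) = j' - leaves s" using 2 4(3-) by linarith
    ultimately show ?thesis using 2 4(3-) by auto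
  next
    case 3
    then show ?thesis using 4(2)[of "j' - leaves s" u'] 4(3-) by (auto simp: diff_commute)
  qed
qed auto

lemma graft_graft_sequential:
  fixes s :: "'x ptree" and ss :: "'x ptree list"
  shows "\<lbrakk>1 \<le> i; i \<le> leaves s; 1 \<le> j; j \<le> leaves t\<rbrakk> \<Longrightarrow>
    graft (graft s i t) (i + j - 1) u = graft s i (graft t j u)"
  "\<lbrakk>1 \<le> i'; i' \<le> sum_list (map leaves ss); 1 \<le> j'; j' \<le> leaves t'\<rbrakk> \<Longrightarrow>
    graft_list (graft_list ss i' t') (i' + j' - 1) u' = graft_list ss i' (graft t' j' u')"
proof (induction s i t and ss i' t' arbitrary: j u and j' u' rule: graft_graft_list.induct)
  case (4 s ss i t)
  show ?case
  proof (cases "i \<le> leaves s")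
    case True
    then have "leaves (graft s i t) + 1 = leaves s + leaves t" using leaves_graft(1)[of i s t] 4(3-) by auto
    then show ?thesis using True 4(1)[OF True, of j' u'] 4(3-) by auto
  next
    case False
    then have "i + j' - 1 - leaves s = i - leaves s + j' - 1" "\<not> i + j' - 1 \<le> leaves s" using 4(3-) by auto
    then show ?thesis using False 4(2)[OF False, of j' u'] 4(3-) by auto
  qed
qed auto

text \<open>\<open>contr T m\<close> contracts the edge above the vertex of \<open>T\<close> with number \<open>m\<close> in prefix order, where the
  root has number 0. In \<open>contr_list a i Ts m\<close> the trees \<open>Ts\<close> are attached to the leaves
  \<open>i, i + 1, \<dots>\<close> of \<open>a\<close>, and the vertices of \<open>Ts\<close> are numbered from 0.\<close>

fun contr :: "'x ptree ptree \<Rightarrow> nat \<Rightarrow> 'x ptree ptree"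
  and contr_list :: "'x ptree \<Rightarrow> nat \<Rightarrow> 'x ptree ptree list \<Rightarrow> nat \<Rightarrow> 'x ptree \<times> 'x ptree ptree list"
  where
    "contr Leaf m = Leaf"
  | "contr (Node a Ts) m = (case contr_list a 1 Ts (m - 1) of (a', Ts') \<Rightarrow> Node a' Ts')"
  | "contr_list a i [] m = (a, [])"
  | "contr_list a i (T # Ts) m =
      (if vertices T \<le> m then map_prod id ((#) T) (contr_list a (Suc i) Ts (m - vertices T))
       else if m = 0 then (case T of Leaf \<Rightarrow> (a, []) | Node b Us \<Rightarrow> (graft a i b, Us @ Ts))
       else (a, contr T m # Ts))"

lemma vertices_contr:
  fixes T :: "'x ptree ptree" and Ts :: "'x ptree ptree list"
  shows "\<lbrakk>1 \<le> m; m < vertices T\<rbrakk> \<Longrightarrow> Suc (vertices (contr T m)) = vertices T"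
  "m' < sum_list (map vertices Ts) \<Longrightarrow>
    Suc (sum_list (map vertices (snd (contr_list a i Ts m')))) = sum_list (map vertices Ts)"
proof (induction T m and a i Ts m' rule: contr_contr_list.induct)
  case (2 a Ts m)
  then show ?case by (cases "contr_list a 1 Ts (m - 1)") auto
next
  case (4 a i T Ts m)
  then show ?case by (cases T) auto
qed auto

abbreviation nc_bar :: "nat ptree ptree set"
  where "nc_bar \<equiv> trees (nc_trees - {Leaf}) leaves"

lemma bar_trees_nc [simp]: "bar_trees ncHyperCom = nc_bar"
  by (simp add: bar_trees_def)

lemma contr_list_parallel:
  assumes "s < sum_list (map vertices Ts)" "1 \<le> i" "i < j" "j + length Ts \<le> Suc (leaves a)" "1 \<le> leaves b"
  shows "contr_list (graft a i b) (j + leaves b - 1) Ts s = map_prod (\<lambda>x. graft x i b) id (contr_list a j Ts s)"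
  using assms
proof (induction Ts arbitrary: j s)
  case (Cons T Ts)
  show ?case
  proof (cases "vertices T \<le> s")
    case True
    have "contr_list (graft a i b) (Suc j + leaves b - 1) Ts (s - vertices T) =
        map_prod (\<lambda>x. graft x i b) id (contr_list a (Suc j) Ts (s - vertices T))"
      using Cons.prems True by (intro Cons.IH) auto
    moreover have "Suc (j + leaves b - 1) = Suc j + leaves b - 1" using Cons.prems by simp
    ultimately show ?thesis using True by (simp add: prod.map_comp comp_def)
  next
    case False
    have "j \<le> leaves a" using Cons.prems by simp
    then show ?thesis
      using False Cons.prems by (cases T) (auto simp: graft_graft_parallel(1)[of i j a b])
  qed
qed simp

lemma contr_list_sequential:
  assumes "s < sum_list (map vertices Us)" "1 \<le> i" "i \<le> leaves a" "1 \<le> j" "j + length Us \<le> Suc (leaves b)"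
  shows "contr_list (graft a i b) (i + j - 1) (Us @ Ts) s =
    (case contr_list b j Us s of (b', Us') \<Rightarrow> (graft a i b', Us' @ Ts))"
  using assms
proof (induction Us arbitrary: j s)
  case (Cons U Us)
  show ?case
  proof (cases "vertices U \<le> s")
    case True
    have "contr_list (graft a i b) (i + Suc j - 1) (Us @ Ts) (s - vertices U) =
       (case contr_list b (Suc j) Us (s - vertices U) of (b', Us') \<Rightarrow> (graft a i b', Us' @ Ts))"
      using Cons.prems True by (intro Cons.IH) auto
    moreover have "Suc (i + j - 1) = i + Suc j - 1" using Cons.prems by simp
    ultimately show ?thesis using True by (simp split: prod.splits)
  next
    case False
    have "j \<le> leaves b" using Cons.prems by simp
    then show ?thesis
      using False Cons.prems by (cases U) (auto simp: graft_graft_sequential(1)[of i a j b, unfolded One_nat_def])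
  qed
qed simp

lemma contr_list_append:
  "sum_list (map vertices Us) \<le> s \<Longrightarrow>
    contr_list a i (Us @ Ts) s = map_prod id ((@) Us) (contr_list a (i + length Us) Ts (s - sum_list (map vertices Us)))"
proof (induction Us arbitrary: i s)
  case Nil
  then show ?case by (cases "contr_list a i Ts s") auto
next
  case (Cons U Us)
  then show ?case
    by (cases "contr_list a (Suc (i + length Us)) Ts (s - (vertices U + sum_list (map vertices Us)))") auto
qed

text \<open>If both edges lie beyond the first tree, induction applies. If only p lies in it, the
  two contractions are independent; when p is its root edge this is the parallel axiom. If both lie
  in it, the sequential axiom handles its root edge, and the hypothesis on trees the rest.\<close>

lemma contr_contr_list:
  assumes "\<And>T p q. \<lbrakk>T \<in> set Ts; 1 \<le> p; p < q; q < vertices T\<rbrakk> \<Longrightarrow> contr (contr T q) p = contr (contr T p) (q - 1)"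
    and "set Ts \<subseteq> nc_bar" "p < q" "q < sum_list (map vertices Ts)" "1 \<le> i" "i + length Ts \<le> Suc (leaves a)"
  shows "(case contr_list a i Ts q of (a', Ts') \<Rightarrow> contr_list a' i Ts' p) =
    (case contr_list a i Ts p of (a', Ts') \<Rightarrow> contr_list a' i Ts' (q - 1))"
  using assms
proof (induction Ts arbitrary: i p q)
  case (Cons T Ts)
  note pq = \<open>p < q\<close>
  let ?v = "vertices T"
  consider "?v \<le> p" | "p < ?v" "?v \<le> q" | "q < ?v" by linarith
  then show ?case
  proof cases
    case 1
    have "(case contr_list a (Suc i) Ts (q - ?v) of (a', Ts') \<Rightarrow> contr_list a' (Suc i) Ts' (p - ?v)) =
        (case contr_list a (Suc i) Ts (p - ?v) of (a', Ts') \<Rightarrow> contr_list a' (Suc i) Ts' (q - ?v - 1))"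
      using Cons.prems 1 by (intro Cons.IH) auto
    moreover have "q - ?v - 1 = q - 1 - ?v" "?v \<le> q - 1" "?v \<le> q" using 1 pq by auto
    ultimately show ?thesis using 1 by (auto split: prod.splits)
  next
    case 2
    obtain a1 Ts1 where 3: "contr_list a (Suc i) Ts (q - ?v) = (a1, Ts1)" by fastforce
    show ?thesis
    proof (cases "p = 0")
      case True
      obtain b Us where T: "T = Node b Us" using 2 by (cases T) auto
      have b: "b \<in> nc_trees" "leaves b = length Us" using Cons.prems(2) T by (auto simp: Node_in_trees_iff)
      have "contr_list (graft a i b) (Suc i + leaves b - 1) Ts (q - ?v) = map_prod (\<lambda>x. graft x i b) id (a1, Ts1)"
        unfolding 3[symmetric] using Cons.prems 2 leaves_pos[OF b(1)] by (intro contr_list_parallel) auto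
      moreover have "Suc i + leaves b - 1 = i + length Us" "q - ?v = q - 1 - sum_list (map vertices Us)"
        using b T by auto
      ultimately show ?thesis using 2 3 True T by (simp add: contr_list_append)
    next
      case False
      then have "Suc (vertices (contr T p)) = ?v" using 2 by (intro vertices_contr) auto
      then have "vertices (contr T p) \<le> q - 1" "q - 1 - vertices (contr T p) = q - ?v" using 2 by auto
      then show ?thesis using 2 3 False by simp
    qed
  next
    case 3
    then have q: "Suc (vertices (contr T q)) = ?v" using pq by (intro vertices_contr) auto
    show ?thesis
    proof (cases "p = 0")
      case True
      obtain b Us where T: "T = Node b Us" using 3 by (cases T) auto
      have b: "b \<in> nc_trees" "leaves b = length Us" using Cons.prems(2) T by (auto simp: Node_in_trees_iff)
      obtain b' Us' where 4: "contr_list b 1 Us (q - 1) = (b', Us')" by fastforce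
      have "contr_list (graft a i b) (i + 1 - 1) (Us @ Ts) (q - 1) =
        (case contr_list b 1 Us (q - 1) of (b', Us') \<Rightarrow> (graft a i b', Us' @ Ts))"
        using Cons.prems 3 b T by (intro contr_list_sequential) auto
      then show ?thesis using 3 4 True T pq by simp
    next
      case False
      then have p: "Suc (vertices (contr T p)) = ?v" using 3 pq by (intro vertices_contr) auto
      have "contr (contr T q) p = contr (contr T p) (q - 1)"
        using Cons.prems 3 False by (intro Cons.prems(1)) auto
      moreover have "\<not> vertices (contr T q) \<le> p" "\<not> vertices (contr T p) \<le> q - 1" "q - 1 \<noteq> 0"
        using p q pq 3 False by auto
      ultimately show ?thesis using 3 False pq by simp
    qed
  qed
qed simp

text \<open>The simplicial identity for edge contractions: contracting edge p lowers the number of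
  every later edge by one.\<close>

lemma contr_contr:
  assumes "T \<in> nc_bar" "1 \<le> p" "p < q" "q < vertices T"
  shows "contr (contr T q) p = contr (contr T p) (q - 1)"
  using assms
proof (induction T arbitrary: p q rule: trees.induct)
  case (Node a Ts)
  have "(case contr_list a 1 Ts (q - 1) of (a', Ts') \<Rightarrow> contr_list a' 1 Ts' (p - 1)) =
    (case contr_list a 1 Ts (p - 1) of (a', Ts') \<Rightarrow> contr_list a' 1 Ts' (q - 1 - 1))"
    using Node by (intro contr_contr_list) auto
  then show ?case by (auto split: prod.splits)
qed simp

abbreviation bar_dt :: "nat ptree ptree \<Rightarrow> (nat ptree ptree \<Rightarrow>\<^sub>0 'k::field)"
  where "bar_dt \<equiv> bar_d_tree (\<lambda>k. 2 * int k - 4)"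

definition edge_contr :: "'x ptree \<Rightarrow> 'x ptree ptree list \<Rightarrow> nat \<Rightarrow> ('x ptree ptree \<Rightarrow>\<^sub>0 'k::field)"
  where "edge_contr a Ts i = (case Ts ! i of Leaf \<Rightarrow> 0
    | Node b Us \<Rightarrow> mon (Node (graft a (Suc i) b) (take i Ts @ Us @ drop (Suc i) Ts)))"

lemma ksign_power: "even (m - int n) \<Longrightarrow> ksign m = (- 1) ^ n"
  by (auto simp: ksign_def)

lemma even_sum_list_diff:
  "(\<And>x. x \<in> set xs \<Longrightarrow> even (f x - int (g x))) \<Longrightarrow> even (sum_list (map f xs) - int (sum_list (map g xs)))"
  by (induction xs) auto

text \<open>Suspension makes every label odd, so the parity of a decorated tree is that of its
  number of vertices, and all signs of the differential count vertices.\<close>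

lemma even_tdeg_sdeg: "even (tdeg (sdeg (\<lambda>k. 2 * int k - 4)) T - int (vertices T))"
proof (induction T)
  case (Node a Ts)
  then have "even (sum_list (map (tdeg (sdeg (\<lambda>k. 2 * int k - 4))) Ts) - int (sum_list (map vertices Ts)))"
    by (intro even_sum_list_diff)
  then show ?case using even_tdeg[of a] by (simp add: sdeg_def[of _ a])
qed simp

lemma bar_dt_Node: "bar_dt (Node a Ts) =
    (\<Sum>i<length Ts. (- 1) ^ sum_list (map vertices (take i Ts)) *\<^sub>p edge_contr a Ts i) +
    (\<Sum>i<length Ts. (- 1) ^ Suc (sum_list (map vertices (take i Ts))) *\<^sub>p
      push (\<lambda>S. Node a (Ts[i := S])) (bar_dt (Ts ! i)) :: 'k::field bar_vec)"
proof -
  let ?dg = "\<lambda>k. 2 * int k - 4"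
  have left: "even (left_deg ?dg Ts i - int (sum_list (map vertices (take i Ts))))" for i
    unfolding left_deg_def by (intro even_sum_list_diff even_tdeg_sdeg)
  have 1: "contract_root ?dg a Ts i = (- 1) ^ sum_list (map vertices (take i Ts)) *\<^sub>p
      (edge_contr a Ts i :: 'k bar_vec)" for i
  proof (cases "Ts ! i")
    case (Node b Us)
    have "even (sdeg ?dg b * left_deg ?dg Ts i + tdeg ?dg a - int (sum_list (map vertices (take i Ts))))"
      using left[of i] even_tdeg[of a] even_tdeg[of b] by (auto simp: sdeg_def)
    then have k: "ksign (sdeg ?dg b * left_deg ?dg Ts i + tdeg ?dg a) = ((- 1) ^ sum_list (map vertices (take i Ts)) :: 'k)"
      by (rule ksign_power)
    with Node show ?thesis by (simp add: contract_root_def edge_contr_def tree_comp_nc)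
  qed (simp add: contract_root_def edge_contr_def)
  have 2: "ksign (sdeg ?dg a + left_deg ?dg Ts i) = ((- 1) ^ Suc (sum_list (map vertices (take i Ts))) :: 'k)" for i
  proof (rule ksign_power)
    show "even (sdeg ?dg a + left_deg ?dg Ts i - int (Suc (sum_list (map vertices (take i Ts)))))"
      using left[of i] even_tdeg[of a] by (auto simp: sdeg_def)
  qed
  show ?thesis by (simp add: 1 2)
qed

lemma sum_lessThan_add: "(\<Sum>m<a + b. f m) = (\<Sum>m<a. f m) + (\<Sum>m<b. f (a + m :: nat) :: 'b::comm_monoid_add)"
  by (induction b) (auto simp: add.assoc)

lemma sum_split_pred:
  "finite A \<Longrightarrow> sum f A = sum f {x \<in> A. P x} + sum f {x \<in> A. \<not> P x}"
  by (subst sum.union_disjoint[symmetric]) (auto intro!: sum.cong)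

text \<open>With vertices numbered in prefix order, the sign of a contraction is the parity of the
  vertices passed, both at the root and inside a child; the root itself accounts for the shift
  between \<open>m\<close> and \<open>Suc m\<close>.\<close>

lemma bar_dt_eq_sum_contr:
  "bar_dt T = (\<Sum>m<vertices T - 1. (- 1) ^ m *\<^sub>p mon (contr T (Suc m)) :: 'k::field bar_vec)"
proof (induction T)
  case (Node a Ts)
  define W where "W p = (case p of (a', Ts') \<Rightarrow> Node a' Ts')" for p :: "nat ptree \<times> nat ptree ptree list"
  define Vs where "Vs Ls = sum_list (map vertices Ls)" for Ls :: "nat ptree ptree list"
  \<comment> \<open>The children Ls have been passed already; their vertices give the offset
    \<open>Vs Ls\<close> in the exponent.\<close>
  have key: "(\<Sum>m<Vs Rs. (- 1) ^ (Vs Ls + m) *\<^sub>p mon (W (map_prod id ((@) Ls) (contr_list a (Suc (length Ls)) Rs m)))) =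
      (\<Sum>i\<in>{length Ls..<length Ts}. (- 1) ^ Vs (take i Ts) *\<^sub>p edge_contr a Ts i +
        (- 1) ^ Suc (Vs (take i Ts)) *\<^sub>p push (\<lambda>S. Node a (Ts[i := S])) (bar_dt (Ts ! i)) :: 'k bar_vec)"
    if "Ts = Ls @ Rs" for Ls Rs
    using that
  proof (induction Rs arbitrary: Ls)
    case Nil
    then show ?case by (simp add: Vs_def)
  next
    case (Cons T Rs)
    let ?f = "\<lambda>m. (- 1) ^ (Vs Ls + m) *\<^sub>p mon (W (map_prod id ((@) Ls) (contr_list a (Suc (length Ls)) (T # Rs) m))) :: 'k bar_vec"
    have "(\<Sum>m<Vs (T # Rs). ?f m) = (\<Sum>m<vertices T. ?f m) + (\<Sum>m<Vs Rs. ?f (vertices T + m))"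
      using sum_lessThan_add[of ?f "vertices T" "Vs Rs"] by (simp add: Vs_def)
    also have "(\<Sum>m<Vs Rs. ?f (vertices T + m)) =
        (\<Sum>i\<in>{Suc (length Ls)..<length Ts}. (- 1) ^ Vs (take i Ts) *\<^sub>p edge_contr a Ts i +
        (- 1) ^ Suc (Vs (take i Ts)) *\<^sub>p push (\<lambda>S. Node a (Ts[i := S])) (bar_dt (Ts ! i)))"
      using Cons.IH[of "Ls @ [T]"] Cons.prems by (simp add: Vs_def prod.map_comp comp_def add.assoc)
    also have "(\<Sum>m<vertices T. ?f m) = (- 1) ^ Vs Ls *\<^sub>p edge_contr a Ts (length Ls) +
        (- 1) ^ Suc (Vs Ls) *\<^sub>p push (\<lambda>S. Node a (Ts[length Ls := S])) (bar_dt T)"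
    proof (cases T)
      case Leaf
      then show ?thesis using Cons.prems by (simp add: edge_contr_def)
    next
      case T: (Node b Us)
      have "(\<Sum>m<vertices T. ?f m) = ?f 0 + (\<Sum>m<vertices T - 1. ?f (Suc m))"
        using T by (simp add: sum.lessThan_Suc_shift del: sum.lessThan_Suc)
      also have "?f 0 = (- 1) ^ Vs Ls *\<^sub>p edge_contr a Ts (length Ls)"
        using T Cons.prems by (simp add: W_def edge_contr_def)
      also have "(\<Sum>m<vertices T - 1. ?f (Suc m)) =
          (\<Sum>m<vertices T - 1. (- 1) ^ Suc (Vs Ls) *\<^sub>p ((- 1) ^ m *\<^sub>p mon (Node a (Ts[length Ls := contr T (Suc m)]))))"
        using T Cons.prems by (intro sum.cong) (auto simp: W_def power_add single_scale)
      also have "\<dots> = (- 1) ^ Suc (Vs Ls) *\<^sub>p push (\<lambda>S. Node a (Ts[length Ls := S])) (bar_dt T)"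
        using Node.IH[of T] Cons.prems by (simp add: lin_ext_sum lin_ext_scale pm.scale_sum_right del: pm.scale_scale)
      finally show ?thesis .
    qed
    finally show ?case using Cons.prems by (simp add: sum.atLeast_Suc_lessThan[of "length Ls"])
  qed
  have "map_prod id ((@) []) x = x" for x :: "nat ptree \<times> nat ptree ptree list" by (cases x) simp
  with key[of "[]" Ts] show ?case
    unfolding bar_dt_Node sum.distrib[symmetric]
    by (simp add: Vs_def W_def lessThan_atLeast0 del: bar_d_tree.simps)
qed simp

lemma bar_dt_bar_dt:
  assumes "T \<in> nc_bar" shows "lin_ext bar_dt (bar_dt T) = (0 :: 'k::field bar_vec)"
proof -
  define N where "N = vertices T - 1"
  define f :: "nat \<Rightarrow> nat \<Rightarrow> nat ptree ptree \<Rightarrow>\<^sub>0 'k"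
    where "f q p = (- 1) ^ (q + p) *\<^sub>p mon (contr (contr T (Suc q)) (Suc p))" for q p
  have "vertices (contr T (Suc q)) - 1 = N - 1" if "q < N" for q
  proof -
    have "Suc q < vertices T" using that by (simp add: N_def)
    with vertices_contr(1)[of "Suc q" T] show ?thesis by (simp add: N_def)
  qed
  then have "lin_ext bar_dt (bar_dt T) = (\<Sum>q<N. \<Sum>p<N - 1. f q p)"
    unfolding bar_dt_eq_sum_contr[of T] N_def[symmetric] lin_ext_sum lin_ext_scale lin_ext_single
    by (intro sum.cong) (auto simp: bar_dt_eq_sum_contr pm.scale_sum_right f_def power_add)
  also have "\<dots> = (\<Sum>q<N. (\<Sum>p\<in>{p\<in>{..<N - 1}. p < q}. f q p) + (\<Sum>p\<in>{p\<in>{..<N - 1}. \<not> p < q}. f q p))"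
    by (intro sum.cong[OF refl] sum_split_pred) simp
  also have "\<dots> = (\<Sum>(q, p)\<in>(SIGMA q:{..<N}. {p\<in>{..<N - 1}. p < q}). f q p) +
      (\<Sum>(q, p)\<in>(SIGMA q:{..<N}. {p\<in>{..<N - 1}. \<not> p < q}). f q p)"
    by (simp add: sum.distrib sum.Sigma)
  also have "(\<Sum>(q, p)\<in>(SIGMA q:{..<N}. {p\<in>{..<N - 1}. \<not> p < q}). f q p) =
      (\<Sum>(q, p)\<in>(SIGMA q:{..<N}. {p\<in>{..<N - 1}. p < q}). - f q p)"
  \<comment> \<open>The identity \<open>contr_contr\<close> exchanges the pairs with q <= p and
    those with p < q. The exponent changes by one, so the two halves cancel.\<close>
  proof (rule sum.reindex_bij_witness[of _ "\<lambda>(q, p). (p, q - 1)" "\<lambda>(q, p). (Suc p, q)"])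
    fix x assume x: "x \<in> (SIGMA q:{..<N}. {p\<in>{..<N - 1}. \<not> p < q})"
    then obtain q p where qp: "x = (q, p)" "q \<le> p" "p < N - 1" by auto
    then have "contr (contr T (Suc (Suc p))) (Suc q) = contr (contr T (Suc q)) (Suc p)"
      using contr_contr[OF assms, of "Suc q" "Suc (Suc p)"] by (simp add: N_def)
    then show "(case (case x of (q, p) \<Rightarrow> (Suc p, q)) of (q, p) \<Rightarrow> - f q p) = (case x of (q, p) \<Rightarrow> f q p)"
      using qp by (simp add: f_def add.commute)
  qed auto
  finally show ?thesis by (simp add: sum_negf case_prod_unfold)
qed

subsection \<open>The bar complex modulo the relations\<close>

lemma bar_weight_simps [simp]:
  "bar_weight Leaf = 0"
  "bar_weight (Node a Ts) = int (vertices a) + sum_list (map bar_weight Ts)"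
  by (simp_all add: bar_weight_def)

lemma nc_bar_Node: "Node a Ts \<in> nc_bar \<longleftrightarrow> a \<in> nc_trees \<and> a \<noteq> Leaf \<and> length Ts = leaves a \<and> set Ts \<subseteq> nc_bar"
  by (auto simp: Node_in_trees_iff)

lemma Leaf_in_nc_bar: "Leaf \<in> nc_bar"
  by (rule trees.Leaf)

lemma graft_neq_Leaf: "a \<noteq> Leaf \<Longrightarrow> graft a i b \<noteq> Leaf"
  by (cases a) auto

lemma contr_in_bar:
  fixes T :: "nat ptree ptree" and Ts :: "nat ptree ptree list"
  shows "\<lbrakk>T \<in> nc_bar; 1 \<le> m; m < vertices T\<rbrakk> \<Longrightarrow>
      contr T m \<in> nc_bar \<and> leaves (contr T m) = leaves T \<and> bar_weight (contr T m) = bar_weight T"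
    "\<lbrakk>a \<in> nc_trees; a \<noteq> Leaf; 1 \<le> i; i + length Ts \<le> Suc (leaves a); set Ts \<subseteq> nc_bar;
        m' < sum_list (map vertices Ts); contr_list a i Ts m' = (a', Ts')\<rbrakk> \<Longrightarrow>
      a' \<in> nc_trees \<and> a' \<noteq> Leaf \<and> set Ts' \<subseteq> nc_bar \<and> leaves a' + length Ts = leaves a + length Ts' \<and>
      sum_list (map leaves Ts') = sum_list (map leaves Ts) \<and>
      int (vertices a') + sum_list (map bar_weight Ts') = int (vertices a) + sum_list (map bar_weight Ts)"
proof (induction T m and a i Ts m' arbitrary: and a' Ts' rule: contr_contr_list.induct)
  case (2 a Ts m)
  obtain a' Ts' where eq: "contr_list a 1 Ts (m - 1) = (a', Ts')" by fastforce
  from 2(1)[OF _ _ _ _ _ _ eq] 2(2-) eq show ?case by (auto simp: nc_bar_Node)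
next
  case (4 a i T Ts m)
  consider "vertices T \<le> m" | "m < vertices T" "m = 0" | "m < vertices T" "m \<noteq> 0" by linarith
  then show ?case
  proof cases
    case 1
    obtain a2 Ts2 where eq: "contr_list a (Suc i) Ts (m - vertices T) = (a2, Ts2)" by fastforce
    have lt: "m - vertices T < sum_list (map vertices Ts)" using 1 4(8) by auto
    have "a2 \<in> nc_trees \<and> a2 \<noteq> Leaf \<and> set Ts2 \<subseteq> nc_bar \<and> leaves a2 + length Ts = leaves a + length Ts2 \<and>
        sum_list (map leaves Ts2) = sum_list (map leaves Ts) \<and>
        int (vertices a2) + sum_list (map bar_weight Ts2) = int (vertices a) + sum_list (map bar_weight Ts)"
      using 4(3-7) by (intro 4(1)[OF 1 _ _ _ _ _ lt eq]) auto
    with 4(7,9) eq 1 show ?thesis by auto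
  next
    case 2
    then obtain b Us where T: "T = Node b Us" by (cases T) auto
    have "b \<in> nc_trees" "leaves b = length Us" "set Us \<subseteq> nc_bar" using 4(7) T by (auto simp: nc_bar_Node)
    moreover have "leaves (graft a i b) + 1 = leaves a + leaves b" "vertices (graft a i b) = vertices a + vertices b"
      using 4(5,6) leaves_graft(1)[of i a b] vertices_graft(1)[of i a b] by auto
    ultimately show ?thesis using 2 4(3-) T by (auto simp: graft_in_trees graft_neq_Leaf)
  next
    case 3
    with 4(2) 4(3-) show ?thesis by auto
  qed
qed auto

lemma keys_bar_dt:
  assumes "S \<in> keys (bar_dt T :: 'k::field bar_vec)" "T \<in> nc_bar"
  shows "S \<in> nc_bar" "leaves S = leaves T" "bar_weight S = bar_weight T" "Suc (vertices S) = vertices T" "S \<noteq> Leaf"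
proof -
  have "S \<in> (\<Union>m\<in>{..<vertices T - 1}. keys ((- 1) ^ m *\<^sub>p mon (contr T (Suc m)) :: 'k bar_vec))"
    using assms(1) unfolding bar_dt_eq_sum_contr[of T] by (rule subsetD[OF keys_sum_subset])
  then obtain m where "m < vertices T - 1"
      "S \<in> keys ((- 1) ^ m *\<^sub>p mon (contr T (Suc m)) :: 'k bar_vec)"
    by (elim UN_E) simp
  moreover from this(2) have "S \<in> keys (mon (contr T (Suc m)) :: 'k bar_vec)"
    by (rule subsetD[OF keys_pm_scale])
  ultimately have m: "1 \<le> Suc m" "Suc m < vertices T" "S = contr T (Suc m)"
    by auto
  with contr_in_bar(1)[OF assms(2) m(1,2)] vertices_contr(1)[OF m(1,2)]
  show "S \<in> nc_bar" "leaves S = leaves T" "bar_weight S = bar_weight T" "Suc (vertices S) = vertices T" by auto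
  then show "S \<noteq> Leaf" using m(2) by auto
qed

section \<open>The differential preserves the relations of the bar complex\<close>

abbreviation bar_I :: "(nat ptree ptree \<Rightarrow>\<^sub>0 'k::field) set"
  where "bar_I \<equiv> bar_ideal ncHyperCom"

lemma subspace_bar_ideal: "pm.subspace (bar_ideal D)"
  by (auto simp: pm.subspace_def intro: bar_ideal.intros)

text \<open>A decorated tree with one open label of arity n. Filling the open place with relations
  spans the bar ideal, so the differential has to be checked on these generators only.\<close>

inductive bar_context :: "nat \<Rightarrow> (nat ptree \<Rightarrow> nat ptree ptree) \<Rightarrow> bool"
  where
    root: "set Ts \<subseteq> nc_bar \<Longrightarrow> bar_context (length Ts) (\<lambda>c. Node c Ts)"
  | inner: "\<lbrakk>bar_context n C; a \<in> nc_trees; a \<noteq> Leaf; leaves a = length Ts + length Us + 1;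
      set Ts \<subseteq> nc_bar; set Us \<subseteq> nc_bar\<rbrakk> \<Longrightarrow> bar_context n (\<lambda>c. Node a (Ts @ C c # Us))"

definition label_rels :: "nat \<Rightarrow> (nat ptree \<Rightarrow>\<^sub>0 'k::field) set"
  where "label_rels n = {f \<in> op_ideal ncHyperCom. f \<in> free_arity ncHyperCom n \<and> Leaf \<notin> keys f}"

lemma push_inner_bar_I:
  assumes "h \<in> bar_I" "a \<in> nc_trees" "a \<noteq> Leaf" "leaves a = length Ts + length Us + 1"
    "set Ts \<subseteq> nc_bar" "set Us \<subseteq> nc_bar"
  shows "push (\<lambda>T. Node a (Ts @ T # Us)) h \<in> bar_I"
  using assms by (intro bar_ideal.inner) auto

lemma push_context:
  "bar_context n C \<Longrightarrow> f \<in> label_rels n \<Longrightarrow> push C f \<in> bar_I"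
proof (induction rule: bar_context.induct)
  case (root Ts)
  then show ?case by (intro bar_ideal.root) (auto simp: label_rels_def)
next
  case (inner n C a Ts Us)
  then show ?case using push_inner_bar_I[of "push C f" a Ts Us] by (simp add: push_push)
qed

lemma bar_ideal_span: "h \<in> bar_I \<Longrightarrow> h \<in> pm.span {push C f | C f n. bar_context n C \<and> f \<in> label_rels n}"
  (is "_ \<Longrightarrow> _ \<in> pm.span ?G")
proof (induction rule: bar_ideal.induct)
  case (root f Ts)
  then have "bar_context (length Ts) (\<lambda>c. Node c Ts)" "f \<in> label_rels (length Ts)"
    by (auto simp: label_rels_def intro: bar_context.root)
  then show ?case
    by (intro pm.span_base CollectI exI[of _ "\<lambda>c. Node c Ts"] exI[of _ f] exI[of _ "length Ts"]) simp
next
  case (inner h a Ts Us)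
  let ?V = "{g. push (\<lambda>T. Node a (Ts @ T # Us)) g \<in> pm.span ?G}"
  have "?G \<subseteq> ?V"
  proof
    fix g :: "'a bar_vec" assume "g \<in> ?G"
    then obtain C f n where g: "g = push C f" "bar_context n C" "f \<in> label_rels n" by blast
    then have "bar_context n (\<lambda>c. Node a (Ts @ C c # Us))"
      using inner.hyps by (intro bar_context.inner) auto
    with g show "g \<in> ?V"
      by (intro CollectI pm.span_base exI[of _ "\<lambda>c. Node a (Ts @ C c # Us)"] exI[of _ f] exI[of _ n]) (simp add: push_push)
  qed
  moreover have "pm.subspace ?V" by (rule subspace_vimage_lin_ext) (rule pm.subspace_span)
  ultimately have "pm.span ?G \<subseteq> ?V" by (rule pm.span_minimal)
  with inner.IH show ?case by blast
qed (auto intro: pm.span_zero pm.span_add pm.span_scale)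

lemma vertices_context: "bar_context n C \<Longrightarrow> vertices (C c) = vertices (C c')"
  by (induction rule: bar_context.induct) auto

text \<open>Contracting an edge at the open vertex composes the relation with a neighbouring label.
  This lemma and the next say that the result is again a relation, with the open label as the lower
  or as the upper factor.\<close>

lemma label_rels_graft_left:
  assumes "f \<in> label_rels n" "b \<in> nc_trees" "1 \<le> i" "i \<le> n"
  shows "push (\<lambda>c. graft c i b) f \<in> label_rels (n + leaves b - 1)"
  unfolding label_rels_def mem_Collect_eq
proof (intro conjI)
  have "pcomp ncHyperCom f i (mon b) \<in> op_ideal ncHyperCom"
    using assms by (intro op_ideal.comp_left[where m = n and n = "leaves b"]) (auto simp: label_rels_def free_arity_nc)
  then show "push (\<lambda>c. graft c i b) f \<in> op_ideal ncHyperCom" by (simp add: pcomp_nc)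
  show "push (\<lambda>c. graft c i b) f \<in> free_arity ncHyperCom (n + leaves b - 1)"
    unfolding free_arity_nc
  proof
    fix t assume "t \<in> keys (push (\<lambda>c. graft c i b) f)"
    then obtain c where c: "c \<in> keys f" "t = graft c i b" by (rule keys_pushE)
    with assms have "c \<in> nc_trees" "leaves c = n" by (auto simp: label_rels_def free_arity_nc)
    with c assms leaves_graft(1)[of i c b] show "t \<in> nc_trees \<and> leaves t = n + leaves b - 1"
      by (auto simp: graft_in_trees)
  qed
  show "Leaf \<notin> keys (push (\<lambda>c. graft c i b) f)"
  proof
    assume "Leaf \<in> keys (push (\<lambda>c. graft c i b) f)"
    then obtain c where "c \<in> keys f" "Leaf = graft c i b" by (rule keys_pushE)
    with assms graft_neq_Leaf[of c i b] show False by (auto simp: label_rels_def)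
  qed
qed

lemma label_rels_graft_right:
  assumes "f \<in> label_rels n" "a \<in> nc_trees" "a \<noteq> Leaf" "1 \<le> i" "i \<le> leaves a"
  shows "push (\<lambda>c. graft a i c) f \<in> label_rels (leaves a + n - 1)"
  unfolding label_rels_def mem_Collect_eq
proof (intro conjI)
  have "pcomp ncHyperCom (mon a) i f \<in> op_ideal ncHyperCom"
    using assms by (intro op_ideal.comp_right[where m = "leaves a" and n = n]) (auto simp: label_rels_def free_arity_nc)
  then show "push (\<lambda>c. graft a i c) f \<in> op_ideal ncHyperCom" by (simp add: pcomp_nc)
  show "push (\<lambda>c. graft a i c) f \<in> free_arity ncHyperCom (leaves a + n - 1)"
    unfolding free_arity_nc
  proof
    fix t assume "t \<in> keys (push (\<lambda>c. graft a i c) f)"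
    then obtain c where c: "c \<in> keys f" "t = graft a i c" by (rule keys_pushE)
    with assms have "c \<in> nc_trees" "leaves c = n" by (auto simp: label_rels_def free_arity_nc)
    with c assms leaves_graft(1)[of i a c] show "t \<in> nc_trees \<and> leaves t = leaves a + n - 1"
      by (auto simp: graft_in_trees)
  qed
  show "Leaf \<notin> keys (push (\<lambda>c. graft a i c) f)"
  proof
    assume "Leaf \<in> keys (push (\<lambda>c. graft a i c) f)"
    then obtain c where "c \<in> keys f" "Leaf = graft a i c" by (rule keys_pushE)
    with assms graft_neq_Leaf[of a i c] show False by (auto simp: label_rels_def)
  qed
qed

lemma bar_d_context_root:
  assumes f: "f \<in> label_rels (length Ts)" and Ts: "set Ts \<subseteq> nc_bar"
  shows "lin_ext (\<lambda>c. bar_dt (Node c Ts)) f \<in> bar_I"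
proof -
  note sub = subspace_bar_ideal[of ncHyperCom]
  have "lin_ext (\<lambda>c. edge_contr c Ts i) f \<in> bar_I" if i: "i < length Ts" for i
  proof (cases "Ts ! i")
    case Leaf
    then show ?thesis by (simp add: edge_contr_def bar_ideal.zero)
  next
    case (Node b Us)
    let ?X = "take i Ts @ Us @ drop (Suc i) Ts"
    have "Ts ! i \<in> nc_bar" using i Ts nth_mem by blast
    then have b: "b \<in> nc_trees" "length Us = leaves b" "set Us \<subseteq> nc_bar" using Node by (auto simp: nc_bar_Node)
    have "set ?X \<subseteq> nc_bar" using Ts b set_take_subset[of i Ts] set_drop_subset[of "Suc i" Ts] by auto
    then have "bar_context (length ?X) (\<lambda>c. Node c ?X)" by (rule bar_context.root)
    moreover have "push (\<lambda>c. graft c (Suc i) b) f \<in> label_rels (length Ts + leaves b - 1)"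
      using f b i by (intro label_rels_graft_left) auto
    moreover have "length Ts + leaves b - 1 = length ?X" using i b by simp
    ultimately have "push (\<lambda>c. Node c ?X) (push (\<lambda>c. graft c (Suc i) b) f) \<in> bar_I"
      using push_context by metis
    then show ?thesis using Node by (simp add: edge_contr_def push_push)
  qed
  moreover have "lin_ext (\<lambda>c. push (\<lambda>S. Node c (Ts[i := S])) (bar_dt (Ts ! i))) f \<in> bar_I" if i: "i < length Ts" for i
  proof -
    have "lin_ext (\<lambda>S. push (\<lambda>c. Node c (Ts[i := S])) f) (bar_dt (Ts ! i)) \<in> bar_I"
    proof (rule lin_ext_in_subspace[OF sub])
      fix S assume "S \<in> keys (bar_dt (Ts ! i) :: 'a bar_vec)"
      moreover have "Ts ! i \<in> nc_bar" using i Ts nth_mem by blast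
      ultimately have "S \<in> nc_bar" by (rule keys_bar_dt(1))
      then have "set (Ts[i := S]) \<subseteq> nc_bar" using Ts set_update_subset_insert[of Ts i S] by blast
      from push_context[OF bar_context.root[OF this]] f show "push (\<lambda>c. Node c (Ts[i := S])) f \<in> bar_I" by simp
    qed
    then show ?thesis by (subst lin_ext_swap)
  qed
  ultimately show ?thesis
    unfolding bar_dt_Node lin_ext_fun_add lin_ext_fun_sum lin_ext_fun_scale
    by (intro pm.subspace_add pm.subspace_sum pm.subspace_scale sub) auto
qed

lemma list_hole_cases:
  assumes "i < Suc (length Ts + length Us)"
  obtains "i < length Ts" | "i = length Ts" | j where "i = Suc (length Ts + j)" "j < length Us"
proof -
  consider "i < length Ts" | "i = length Ts" | "length Ts < i" by linarith
  then show thesis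
  proof cases
    case 3
    then have "i = Suc (length Ts + (i - Suc (length Ts)))" "i - Suc (length Ts) < length Us" using assms by auto
    then show ?thesis using that(3) by blast
  qed (use that in auto)
qed

text \<open>Contracting an edge away from the open vertex yields another context for the same
  relation; contracting an edge at it composes the relation with a label.\<close>

lemma bar_d_context:
  assumes "bar_context n C" "f \<in> label_rels n"
  shows "lin_ext (\<lambda>c. bar_dt (C c)) f \<in> bar_I"
  using assms
proof (induction rule: bar_context.induct)
  case (root Ts)
  then show ?case by (intro bar_d_context_root)
next
  case (inner n C a Ts Us)
  note sub = subspace_bar_ideal[of ncHyperCom]
  define L where "L c = Ts @ C c # Us" for c
  have ctx: "push (\<lambda>c. Node b (Xs @ C c # Ys)) f \<in> bar_I"
    if "b \<in> nc_trees" "b \<noteq> Leaf" "leaves b = length Xs + length Ys + 1" "set Xs \<subseteq> nc_bar" "set Ys \<subseteq> nc_bar" for b Xs Ys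
    using inner.hyps(1) inner.prems that by (intro push_context[of n] bar_context.inner) auto
  have edge: "lin_ext (\<lambda>c. edge_contr a (L c) i) f \<in> bar_I" if i: "i < Suc (length Ts + length Us)" for i
    using i
  proof (cases rule: list_hole_cases)
    case 1
    show ?thesis
    proof (cases "Ts ! i")
      case Leaf
      then show ?thesis using 1 by (simp add: edge_contr_def L_def nth_append bar_ideal.zero)
    next
      case (Node b Vs)
      have "Ts ! i \<in> nc_bar" using 1 inner.hyps nth_mem by blast
      then have b: "b \<in> nc_trees" "length Vs = leaves b" "set Vs \<subseteq> nc_bar" using Node by (auto simp: nc_bar_Node)
      have "push (\<lambda>c. Node (graft a (Suc i) b) ((take i Ts @ Vs @ drop (Suc i) Ts) @ C c # Us)) f \<in> bar_I"
        using b 1 inner.hyps leaves_graft(1)[of "Suc i" a b] set_take_subset[of i Ts] set_drop_subset[of "Suc i" Ts]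
        by (intro ctx) (auto simp: graft_in_trees graft_neq_Leaf)
      then show ?thesis using 1 Node by (simp add: edge_contr_def L_def nth_append)
    qed
  next
    case 2
    from inner.hyps(1) show ?thesis
    proof cases
      case (root Ws)
      have "push (\<lambda>c. graft a (Suc i) c) f \<in> label_rels (leaves a + n - 1)"
        using 2 inner.hyps inner.prems by (intro label_rels_graft_right) auto
      moreover have "leaves a + n - 1 = length (Ts @ Ws @ Us)" using inner.hyps root by simp
      moreover have "set (Ts @ Ws @ Us) \<subseteq> nc_bar" using inner.hyps root by simp
      ultimately have "push (\<lambda>c. Node c (Ts @ Ws @ Us)) (push (\<lambda>c. graft a (Suc i) c) f) \<in> bar_I"
        using push_context[OF bar_context.root] by metis
      then show ?thesis using 2 root by (simp add: edge_contr_def L_def push_push)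
    next
      case (inner C' b Ws Zs)
      have bc: "bar_context n (\<lambda>c. Node (graft a (Suc i) b) ((Ts @ Ws) @ C' c # (Zs @ Us)))"
        using 2 inner inner.hyps \<open>a \<in> nc_trees\<close> \<open>a \<noteq> Leaf\<close> \<open>leaves a = length Ts + length Us + 1\<close>
          \<open>set Ts \<subseteq> nc_bar\<close> \<open>set Us \<subseteq> nc_bar\<close> leaves_graft(1)[of "Suc i" a b]
        by (intro bar_context.inner) (auto simp: graft_in_trees graft_neq_Leaf)
      have "push (\<lambda>c. Node (graft a (Suc i) b) ((Ts @ Ws) @ C' c # (Zs @ Us))) f \<in> bar_I"
        by (rule push_context[OF bc]) fact
      then show ?thesis using 2 inner by (simp add: edge_contr_def L_def)
    qed
  next
    case (3 j)
    show ?thesis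
    proof (cases "Us ! j")
      case Leaf
      then show ?thesis using 3 by (simp add: edge_contr_def L_def nth_append bar_ideal.zero)
    next
      case (Node b Vs)
      have "Us ! j \<in> nc_bar" using 3 inner.hyps nth_mem by blast
      then have b: "b \<in> nc_trees" "length Vs = leaves b" "set Vs \<subseteq> nc_bar" using Node by (auto simp: nc_bar_Node)
      have "push (\<lambda>c. Node (graft a (Suc i) b) (Ts @ C c # (take j Us @ Vs @ drop (Suc j) Us))) f \<in> bar_I"
        using b 3 inner.hyps leaves_graft(1)[of "Suc i" a b] set_take_subset[of j Us] set_drop_subset[of "Suc j" Us]
        by (intro ctx) (auto simp: graft_in_trees graft_neq_Leaf)
      then show ?thesis using 3 Node by (simp add: edge_contr_def L_def nth_append)
    qed
  qed
  have sub_d: "lin_ext (\<lambda>c. push (\<lambda>S. Node a ((L c)[i := S])) (bar_dt (L c ! i))) f \<in> bar_I"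
    if i: "i < Suc (length Ts + length Us)" for i
    using i
  proof (cases rule: list_hole_cases)
    case 1
    have "lin_ext (\<lambda>S. push (\<lambda>c. Node a (Ts[i := S] @ C c # Us)) f) (bar_dt (Ts ! i)) \<in> bar_I"
    proof (rule lin_ext_in_subspace[OF sub])
      fix S assume "S \<in> keys (bar_dt (Ts ! i) :: 'a bar_vec)"
      moreover have "Ts ! i \<in> nc_bar" using 1 inner.hyps nth_mem by blast
      ultimately have "S \<in> nc_bar" by (rule keys_bar_dt(1))
      then show "push (\<lambda>c. Node a (Ts[i := S] @ C c # Us)) f \<in> bar_I"
        using inner.hyps set_update_subset_insert[of Ts i S] by (intro ctx) auto
    qed
    then show ?thesis using 1 by (subst (asm) lin_ext_swap) (simp add: L_def nth_append list_update_append)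
  next
    case 2
    have "push (\<lambda>T. Node a (Ts @ T # Us)) (lin_ext (\<lambda>c. bar_dt (C c)) f) \<in> bar_I"
      using inner by (intro push_inner_bar_I inner.IH) auto
    then show ?thesis using 2 by (simp add: L_def lin_ext_lin_ext)
  next
    case (3 j)
    have "lin_ext (\<lambda>S. push (\<lambda>c. Node a (Ts @ C c # Us[j := S])) f) (bar_dt (Us ! j)) \<in> bar_I"
    proof (rule lin_ext_in_subspace[OF sub])
      fix S assume "S \<in> keys (bar_dt (Us ! j) :: 'a bar_vec)"
      moreover have "Us ! j \<in> nc_bar" using 3 inner.hyps nth_mem by blast
      ultimately have "S \<in> nc_bar" by (rule keys_bar_dt(1))
      then show "push (\<lambda>c. Node a (Ts @ C c # Us[j := S])) f \<in> bar_I"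
        using inner.hyps set_update_subset_insert[of Us j S] by (intro ctx) auto
    qed
    then show ?thesis using 3 by (subst (asm) lin_ext_swap) (simp add: L_def nth_append list_update_append)
  qed
  \<comment> \<open>The signs depend on vertex counts only, which the open label does not affect; so
    they can be pulled out of \<open>lin_ext\<close>.\<close>
  define v where "v i = sum_list (map vertices (take i (L Leaf)))" for i
  have "map vertices (L c) = map vertices (L Leaf)" for c
    using vertices_context[OF inner.hyps(1), of c Leaf] by (simp add: L_def)
  then have v: "sum_list (map vertices (take i (L c))) = v i" for c i
    unfolding v_def by (metis take_map)
  have len: "length (L c) = Suc (length Ts + length Us)" for c by (simp add: L_def)
  show ?case
    unfolding L_def[symmetric] bar_dt_Node lin_ext_fun_add lin_ext_fun_sum lin_ext_fun_scale v len
    using edge sub_d by (intro pm.subspace_add pm.subspace_sum pm.subspace_scale sub) auto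
qed

lemma bar_d_ideal:
  assumes "h \<in> bar_I" shows "lin_ext bar_dt h \<in> bar_I"
proof -
  let ?G = "{push C f | C f n. bar_context n C \<and> f \<in> label_rels n}"
  let ?V = "{g. lin_ext bar_dt g \<in> bar_I}"
  have "?G \<subseteq> ?V" by (auto simp: lin_ext_lin_ext intro: bar_d_context)
  moreover have "pm.subspace ?V" by (rule subspace_vimage_lin_ext) (rule subspace_bar_ideal)
  ultimately have "pm.span ?G \<subseteq> ?V" by (rule pm.span_minimal)
  with bar_ideal_span[OF assms] show ?thesis by blast
qed

subsection \<open>Coordinates on the bar complex\<close>

text \<open>The coefficient of the second tree when every label of the first is replaced by its
  \<open>nform\<close>. It vanishes on the bar ideal, hence is a functional on the bar complex
  itself.\<close>

fun coord :: "nat ptree ptree \<Rightarrow> nat ptree ptree \<Rightarrow> 'k::field"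
  and coord_list :: "nat ptree ptree list \<Rightarrow> nat ptree ptree list \<Rightarrow> 'k"
  where
    "coord Leaf T = (if T = Leaf then 1 else 0)"
  | "coord (Node a Ts) T = (case T of Leaf \<Rightarrow> 0
      | Node b Us \<Rightarrow> lookup (nform a) b * coord_list Ts Us)"
  | "coord_list [] Us = (if Us = [] then 1 else 0)"
  | "coord_list (T # Ts) Us = (case Us of [] \<Rightarrow> 0 | U # Us' \<Rightarrow> coord T U * coord_list Ts Us')"

text \<open>Multilinearity: U is the entry of Vs opposite the hole and c the product of the other
  factors; if the lengths do not match, c = 0 serves.\<close>

lemma coord_list_hole: "\<exists>U c. \<forall>T. coord_list (Ts @ T # Us) Vs = (coord T U * c :: 'k::field)"
proof (induction Ts arbitrary: Vs)
  case Nil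
  show ?case
  proof (cases Vs)
    case (Cons V Vs')
    then show ?thesis by (intro exI[of _ V] exI[of _ "coord_list Us Vs'"]) simp
  qed (auto intro: exI[of _ 0])
next
  case (Cons S Ts)
  show ?case
  proof (cases Vs)
    case V: (Cons V Vs')
    from Cons[of Vs'] obtain U c where "\<forall>T. coord_list (Ts @ T # Us) Vs' = (coord T U * c :: 'k)" by blast
    then show ?thesis using V by (intro exI[of _ U] exI[of _ "c * coord S V"]) simp
  qed (auto intro: exI[of _ 0])
qed

lemma ev_fun_zero [simp]: "ev (\<lambda>s. 0) f = 0"
  by (simp add: ev_def)

lemma ev_delta: "ev (\<lambda>s. if s = t then 1 else 0) f = lookup f t"
  by (simp add: ev_def if_distrib in_keys_iff cong: if_cong)

lemma coord_bar_ideal: "h \<in> bar_I \<Longrightarrow> ev (\<lambda>T. coord T S) h = 0"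
proof (induction arbitrary: S rule: bar_ideal.induct)
  case (root f Ts)
  show ?case
  proof (cases S)
    case (Node b Us)
    have "ev (\<lambda>T. coord T S) (push (\<lambda>a. Node a Ts) f) = ev (\<lambda>a. lookup (nform a) b * coord_list Ts Us) f"
      by (simp add: ev_lin_ext Node)
    also have "\<dots> = lookup (lin_ext nform f) b * coord_list Ts Us"
      by (simp add: ev_mult_right lookup_lin_ext)
    finally show ?thesis using nform_op_ideal[OF root(1,2)] by simp
  qed (simp add: ev_lin_ext)
next
  case (inner h a Ts Us)
  show ?case
  proof (cases S)
    case (Node b Vs)
    obtain U and c :: 'a where U: "\<And>T. coord_list (Ts @ T # Us) Vs = coord T U * c" 
      using coord_list_hole[where 'k = 'a, of Ts Us Vs] by blast
    have "ev (\<lambda>T. coord T S) (push (\<lambda>T. Node a (Ts @ T # Us)) h) =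
        ev (\<lambda>T. coord T U * (c * lookup (nform a) b)) h"
      by (simp add: ev_lin_ext Node U mult_ac)
    also have "\<dots> = 0" unfolding ev_mult_right inner.IH by simp
    finally show ?thesis .
  qed (simp add: ev_lin_ext)
qed (simp_all add: ev_add ev_scale)

section \<open>Decorated trees with normal labels as a basis\<close>

abbreviation normal_bar :: "nat ptree ptree set"
  where "normal_bar \<equiv> trees ({a. normal a} - {Leaf}) leaves"

lemma normal_bar_subset: "T \<in> normal_bar \<Longrightarrow> T \<in> nc_bar"
  by (induction rule: trees.induct) (auto simp: nc_bar_Node normal_in_trees intro: trees.Leaf)

lemma normal_bar_Node: "Node a Ts \<in> normal_bar \<longleftrightarrow> normal a \<and> a \<noteq> Leaf \<and> length Ts = leaves a \<and> set Ts \<subseteq> normal_bar"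
  by (auto simp: Node_in_trees_iff)

lemma coord_normal: "T \<in> normal_bar \<Longrightarrow> coord T S = (if T = S then 1 else 0)"
proof (induction T arbitrary: S rule: trees.induct)
  case (Node a Ts)
  have "coord_list Us Vs = (if Us = Vs then 1 else 0 :: 'a)" if "set Us \<subseteq> set Ts" for Us Vs
    using that Node.IH by (induction Us arbitrary: Vs) (auto split: list.splits)
  then show ?case using Node.hyps by (auto split: ptree.splits simp: nform_normal lookup_single when_def)
qed auto

lemma ev_coord_supp:
  assumes "g \<in> supp normal_bar" shows "ev (\<lambda>T. coord T S) g = lookup g S"
proof -
  have "ev (\<lambda>T. coord T S) g = ev (\<lambda>T. if T = S then 1 else 0) g"
    using assms by (intro ev_cong) (auto simp: supp_def coord_normal)
  then show ?thesis by (simp add: ev_delta)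
qed

lemma push_mod_supp:
  assumes "pm.subspace I" "f \<in> mod_supp I S" "\<And>h. h \<in> I \<Longrightarrow> push F h \<in> I"
    "\<And>s. s \<in> S \<Longrightarrow> mon (F s) \<in> mod_supp I S'"
  shows "push F f \<in> mod_supp I S'"
proof -
  obtain g where g: "g \<in> supp S" "f - g \<in> I" using assms(2) by (auto simp: mod_supp_def)
  have "push F g \<in> mod_supp I S'"
    using g(1) assms(4) by (intro lin_ext_in_subspace subspace_mod_supp assms(1)) (auto simp: supp_def)
  moreover have "push F (f - g) \<in> mod_supp I S'" using g(2) assms(3) by (intro ideal_in_mod_supp)
  ultimately have "push F (f - g) + push F g \<in> mod_supp I S'"
    by (intro pm.subspace_add subspace_mod_supp assms(1))
  then show ?thesis by (simp add: lin_ext_diff)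
qed

lemma normal_form_root:
  assumes "a \<in> nc_trees" "a \<noteq> Leaf" "length Ts = leaves a" "set Ts \<subseteq> normal_bar"
  shows "(mon (Node a Ts) :: 'k::field bar_vec) \<in> mod_supp bar_I
    {Node c Ts | c. normal c \<and> c \<noteq> Leaf \<and> leaves c = leaves a \<and> vertices c = vertices a \<and> (c = a \<or> lower a c)}"
    (is "_ \<in> mod_supp _ ?N")
proof -
  obtain g where g: "g \<in> supp {c \<in> nc_trees. normal c \<and> leaves c = leaves a \<and> vertices c = vertices a \<and> (c = a \<or> lower a c)}"
    "(mon a :: 'k tree_vec) - g \<in> op_ideal ncHyperCom"
    using normal_form[OF assms(1)] unfolding mod_supp_def by blast
  have "vertices a \<noteq> 0" using assms(2) by (cases a) auto
  then have keys: "c \<in> nc_trees \<and> normal c \<and> c \<noteq> Leaf \<and> leaves c = leaves a \<and> vertices c = vertices a \<and> (c = a \<or> lower a c)"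
    if "c \<in> keys g" for c
    using that g(1) by (auto simp: supp_def)
  have "mon a - g \<in> label_rels (length Ts)"
    unfolding label_rels_def free_arity_nc using g(2) keys assms by (auto elim!: keys_minusE)
  then have "push (\<lambda>a. Node a Ts) (mon a - g) \<in> bar_I"
    using assms normal_bar_subset by (intro push_context[OF bar_context.root]) auto
  then have "mon (Node a Ts) - push (\<lambda>a. Node a Ts) g \<in> bar_I" by (simp add: lin_ext_diff)
  then show ?thesis
  proof (rule lin_ext_in_mod_supp[OF subspace_bar_ideal])
    fix s assume "s \<in> keys (push (\<lambda>a. Node a Ts) g)"
    then obtain c where "c \<in> keys g" "s = Node c Ts" by (rule keys_pushE)
    with keys have "s \<in> ?N" by blast
    then show "(mon s :: 'k bar_vec) \<in> mod_supp bar_I ?N" by (intro mon_in_mod_supp subspace_bar_ideal)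
  qed
qed

definition same_shape :: "nat ptree ptree \<Rightarrow> nat ptree ptree set"
  where "same_shape T = {S \<in> normal_bar. leaves S = leaves T \<and> vertices S = vertices T \<and> bar_weight S = bar_weight T}"

lemma normal_form_bar:
  assumes "T \<in> nc_bar" shows "(mon T :: 'k::field bar_vec) \<in> mod_supp bar_I (same_shape T)"
  using assms
proof (induction T rule: trees.induct)
  case Leaf
  show ?case by (intro mon_in_mod_supp subspace_bar_ideal) (auto simp: same_shape_def intro: trees.Leaf)
next
  case (Node a Ts)
  have a: "a \<in> nc_trees" "a \<noteq> Leaf" using Node.hyps by auto
  \<comment> \<open>The children are normalised from left to right, Ls being done, and the root
    label comes last.\<close>
  have "(mon (Node a (Ls @ Rs)) :: 'k bar_vec) \<in> mod_supp bar_I (same_shape (Node a (Ls @ Rs)))"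
    if "set Ls \<subseteq> normal_bar" "set Rs \<subseteq> set Ts" "length Ls + length Rs = leaves a" for Ls Rs
    using that
  proof (induction Rs arbitrary: Ls)
    case Nil
    have "(mon (Node a Ls) :: 'k bar_vec) \<in> mod_supp bar_I
      {Node c Ls | c. normal c \<and> c \<noteq> Leaf \<and> leaves c = leaves a \<and> vertices c = vertices a \<and> (c = a \<or> lower a c)}"
      using Nil a by (intro normal_form_root) auto
    moreover have "{Node c Ls | c. normal c \<and> c \<noteq> Leaf \<and> leaves c = leaves a \<and> vertices c = vertices a \<and> (c = a \<or> lower a c)}
        \<subseteq> same_shape (Node a Ls)"
      using Nil by (auto simp: same_shape_def normal_bar_Node)
    ultimately have "(mon (Node a Ls) :: 'k bar_vec) \<in> mod_supp bar_I (same_shape (Node a Ls))"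
      using subsetD[OF mod_supp_mono] by blast
    then show ?case by simp
  next
    case (Cons T Rs)
    have Ts: "set Ts \<subseteq> nc_bar" using Node.hyps by auto
    have "push (\<lambda>T. Node a (Ls @ T # Rs)) (mon T :: 'k bar_vec) \<in> mod_supp bar_I (same_shape (Node a (Ls @ T # Rs)))"
    proof (rule push_mod_supp[OF subspace_bar_ideal])
      show "(mon T :: 'k bar_vec) \<in> mod_supp bar_I (same_shape T)" using Cons.prems by (intro Node.IH) auto
    next
      fix h :: "'k bar_vec" assume "h \<in> bar_I"
      then show "push (\<lambda>T. Node a (Ls @ T # Rs)) h \<in> bar_I"
        using a Cons.prems Ts normal_bar_subset by (intro push_inner_bar_I) auto
    next
      fix S assume S: "S \<in> same_shape T"
      have "(mon (Node a ((Ls @ [S]) @ Rs)) :: 'k bar_vec) \<in> mod_supp bar_I (same_shape (Node a ((Ls @ [S]) @ Rs)))"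
        using Cons.prems S by (intro Cons.IH) (auto simp: same_shape_def)
      also have "same_shape (Node a ((Ls @ [S]) @ Rs)) = same_shape (Node a (Ls @ T # Rs))"
        using S by (simp add: same_shape_def)
      finally show "(mon (Node a (Ls @ S # Rs)) :: 'k bar_vec) \<in> mod_supp bar_I (same_shape (Node a (Ls @ T # Rs)))"
        by simp
    qed
    then show ?case by simp
  qed
  from this[of "[]" Ts] Node.hyps show ?case by simp
qed

subsection \<open>An acyclic matching\<close>

text \<open>A normal decorated tree is a tree of generators (its \<open>flat\<close>) with some inner edges cut, among them
  all edges to a first child. Matched trees have the same underlying tree; they differ in the first edge
  that does not lead to a first child and is met when descending from the root along first children. It is
  cut in the first tree of the pair and not in the second. \<open>shift\<close> does this at the root of a tree
  whose first child has been removed.\<close>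

inductive shift :: "nat ptree list \<Rightarrow> nat ptree ptree list \<Rightarrow> nat ptree list \<Rightarrow> nat ptree ptree list \<Rightarrow> bool"
  where
    here: "b \<noteq> Leaf \<Longrightarrow> length Us = leaves b \<Longrightarrow> shift (Leaf # as) (Node b Us # Ts) (b # as) (Us @ Ts)"
  | skip: "shift as Ts as' Ts' \<Longrightarrow> shift (Leaf # as) (Leaf # Ts) (Leaf # as') (Leaf # Ts')"

inductive matched :: "nat ptree ptree \<Rightarrow> nat ptree ptree \<Rightarrow> bool"
  where
    top: "shift as Ts as' Ts' \<Longrightarrow> matched (Node (Node k (Leaf # as)) (T # Ts)) (Node (Node k (Leaf # as')) (T # Ts'))"
  | down: "matched U T \<Longrightarrow> matched (Node (Node k (Leaf # replicate m Leaf)) (U # replicate m Leaf))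
      (Node (Node k (Leaf # replicate m Leaf)) (T # replicate m Leaf))"

primrec flat :: "'x ptree ptree \<Rightarrow> 'x ptree"
  where
    "flat Leaf = Leaf"
  | "flat (Node a Ts) = subst a (map flat Ts)"

lemma shift_stats:
  assumes "shift as Ts as' Ts'"
  shows "length as' = length as" "sum_list (map leaves as') + length Ts = sum_list (map leaves as) + length Ts'"
    "sum_list (map leaves Ts') = sum_list (map leaves Ts)" "sum_list (map vertices Ts) = Suc (sum_list (map vertices Ts'))"
    "int (sum_list (map vertices as')) + sum_list (map bar_weight Ts') = int (sum_list (map vertices as)) + sum_list (map bar_weight Ts)"
    "(\<forall>a\<in>set as'. normal a) \<and> set Ts' \<subseteq> normal_bar \<longleftrightarrow> (\<forall>a\<in>set as. normal a) \<and> set Ts \<subseteq> normal_bar"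
proof -
  have "length as' = length as \<and> sum_list (map leaves as') + length Ts = sum_list (map leaves as) + length Ts' \<and>
    sum_list (map leaves Ts') = sum_list (map leaves Ts) \<and> sum_list (map vertices Ts) = Suc (sum_list (map vertices Ts')) \<and>
    int (sum_list (map vertices as')) + sum_list (map bar_weight Ts') = int (sum_list (map vertices as)) + sum_list (map bar_weight Ts)"
    using assms by (induction rule: shift.induct) simp_all
  then show "length as' = length as" "sum_list (map leaves as') + length Ts = sum_list (map leaves as) + length Ts'"
    "sum_list (map leaves Ts') = sum_list (map leaves Ts)" "sum_list (map vertices Ts) = Suc (sum_list (map vertices Ts'))"
    "int (sum_list (map vertices as')) + sum_list (map bar_weight Ts') = int (sum_list (map vertices as)) + sum_list (map bar_weight Ts)"
    by blast+
  show "(\<forall>a\<in>set as'. normal a) \<and> set Ts' \<subseteq> normal_bar \<longleftrightarrow> (\<forall>a\<in>set as. normal a) \<and> set Ts \<subseteq> normal_bar"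
    using assms
  proof (induction rule: shift.induct)
    case (here b Us as Ts)
    then show ?case by (simp add: normal_bar_Node) blast
  next
    case (skip as Ts as' Ts')
    moreover have "Leaf \<in> normal_bar" by (rule trees.Leaf)
    ultimately show ?case by simp
  qed
qed

lemma shift_flat: "shift as Ts as' Ts' \<Longrightarrow> subst_list as' (map flat Ts') = subst_list as (map flat Ts)"
  by (induction rule: shift.induct) auto

lemma shift_inj: "shift as Ts bs Ss \<Longrightarrow> shift as' Ts' bs Ss \<Longrightarrow> as' = as \<and> Ts' = Ts"
proof (induction arbitrary: as' Ts' rule: shift.induct)
  case (here b Us as Ts)
  from here(3) show ?case
    by cases (use here(1,2) in auto)
next
  case (skip as Ts as' Ts')
  from skip(3) show ?case
    by cases (use skip.IH in auto)
qed

text \<open>The first position that is not a bare leaf decides: a tree with a cut edge there can be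
  shifted, whereas the result of a shift has an uncut edge there.\<close>

lemma shift_exclusive: "shift as Ts bs Ss \<Longrightarrow> \<not> shift bs Ss cs Rs"
proof (induction arbitrary: cs Rs rule: shift.induct)
  case (here b Us as Ts)
  then show ?case by (auto elim: shift.cases)
next
  case (skip as Ts as' Ts')
  show ?case
  proof
    assume "shift (Leaf # as') (Leaf # Ts') cs Rs"
    then show False by cases (use skip.IH in auto)
  qed
qed

lemma shift_replicate: "\<not> shift as (replicate m Leaf) bs Ss" "\<not> shift as Ts (replicate m Leaf) Ss"
proof -
  have "Ts \<noteq> replicate m Leaf \<and> bs \<noteq> replicate m' Leaf" if "shift as Ts bs Ss" for as Ts bs Ss m m'
    using that
  proof (induction arbitrary: m m' rule: shift.induct)
    case (here b Us as Ts)
    then show ?case by (cases m; cases m') auto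
  next
    case (skip as Ts as' Ts')
    then show ?case by (cases m; cases m') auto
  qed
  then show "\<not> shift as (replicate m Leaf) bs Ss" "\<not> shift as Ts (replicate m Leaf) Ss" by blast+
qed

text \<open>At the first position that is not a bare leaf, the edge is either cut, and the shift
  applies, or uncut, and cutting it gives a preimage.\<close>

lemma shift_total:
  assumes "sum_list (map leaves as) = length Ts" "set Ts \<subseteq> nc_bar"
  shows "(as = replicate (length as) Leaf \<and> Ts = replicate (length as) Leaf) \<or>
    (\<exists>bs Ss. shift as Ts bs Ss) \<or> (\<exists>bs Ss. shift bs Ss as Ts)"
  using assms
proof (induction as arbitrary: Ts)
  case (Cons a as)
  show ?case
  proof (cases "a = Leaf")
    case False
    have "shift (Leaf # as) (Node a (take (leaves a) Ts) # drop (leaves a) Ts) (a # as) (take (leaves a) Ts @ drop (leaves a) Ts)"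
      using False Cons.prems by (intro shift.here) auto
    then show ?thesis by auto
  next
    case True
    then obtain T Rs where Ts: "Ts = T # Rs" using Cons.prems by (cases Ts) auto
    show ?thesis
    proof (cases T)
      case Leaf
      define m where "m = length as"
      consider "as = replicate m Leaf" "Rs = replicate m Leaf" | bs Ss where "shift as Rs bs Ss" | bs Ss where "shift bs Ss as Rs"
        using Cons.IH[of Rs] Cons.prems Ts True by (auto simp: m_def)
      then show ?thesis
      proof cases
        case 1
        then show ?thesis using True Ts Leaf by simp
      next
        case 2
        from shift.skip[OF this] show ?thesis using True Ts Leaf by blast
      next
        case 3
        from shift.skip[OF this] show ?thesis using True Ts Leaf by blast
      qed
    next
      case (Node b Us)
      have "b \<noteq> Leaf" "length Us = leaves b" using Cons.prems Ts Node by (auto simp: nc_bar_Node)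
      then have "shift (Leaf # as) (Node b Us # Rs) (b # as) (Us @ Rs)" by (intro shift.here) auto
      then show ?thesis using Ts Node True by blast
    qed
  qed
qed simp

lemma matched_stats:
  assumes "matched U T"
  shows "leaves T = leaves U" "vertices U = Suc (vertices T)" "bar_weight T = bar_weight U"
    "T \<in> normal_bar \<longleftrightarrow> U \<in> normal_bar" "flat T = flat U" "U \<noteq> Leaf"
  using assms
proof (induction rule: matched.induct)
  case (top as Ts as' Ts' k T)
  note s = shift_stats[OF top] shift_flat[OF top]
  {
    case 1
    show ?case using s by simp
  next
    case 2
    show ?case using s by simp
  next
    case 3
    show ?case using s by simp
  next
    case 4
    show ?case using s by (auto simp: normal_bar_Node)
  next
    case 5
    show ?case using s by simp
  next
    case 6
    show ?case by simp
  }
qed (auto simp: normal_bar_Node)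

lemma matched_inj: "matched U T \<Longrightarrow> matched U' T \<Longrightarrow> U' = U"
proof (induction arbitrary: U' rule: matched.induct)
  case (top as Ts as' Ts' k T)
  from top(2) show ?case
  proof cases
    case (top bs Ss)
    with shift_inj[OF \<open>shift as Ts as' Ts'\<close>] show ?thesis by auto
  next
    case (down U m)
    with \<open>shift as Ts as' Ts'\<close> shift_replicate show ?thesis by auto
  qed
next
  case (down U T k m)
  from down(3) show ?case
    by cases (use down.IH shift_replicate in auto)
qed

lemma shift_fun: "shift as Ts bs Ss \<Longrightarrow> shift as Ts bs' Ss' \<Longrightarrow> bs' = bs \<and> Ss' = Ss"
proof (induction arbitrary: bs' Ss' rule: shift.induct)
  case (here b Us as Ts)
  from here(3) show ?case by cases auto
next
  case (skip as Ts as' Ts')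
  from skip.prems show ?case
    by cases (use skip.IH in auto)
qed

lemma matched_fun: "matched U T \<Longrightarrow> matched U T' \<Longrightarrow> T' = T"
proof (induction arbitrary: T' rule: matched.induct)
  case (top as Ts as' Ts' k T)
  from top(2) show ?case
  proof cases
    case (top bs Ss)
    with shift_fun[OF \<open>shift as Ts as' Ts'\<close>] show ?thesis by auto
  next
    case (down U m)
    with \<open>shift as Ts as' Ts'\<close> shift_replicate show ?thesis by auto
  qed
next
  case (down U T k m)
  from down(3) show ?case
    by cases (use down.IH shift_replicate in auto)
qed

lemma matched_exclusive: "matched U T \<Longrightarrow> \<not> matched T S"
proof (induction arbitrary: S rule: matched.induct)
  case (top as Ts as' Ts' k T)
  show ?case
  proof
    assume "matched (Node (Node k (Leaf # as')) (T # Ts')) S"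
    then show False
      by cases (use top shift_exclusive shift_replicate in auto)
  qed
next
  case (down U T k m)
  show ?case
  proof
    assume "matched (Node (Node k (Leaf # replicate m Leaf)) (T # replicate m Leaf)) S"
    then show False
      by cases (use down.IH shift_replicate in auto)
  qed
qed

lemma vertices_le_weight: "T \<in> nc_bar \<Longrightarrow> int (vertices T) \<le> bar_weight T"
proof (induction T rule: trees.induct)
  case (Node a Ts)
  have "int (sum_list (map vertices Us)) \<le> sum_list (map bar_weight Us)" if "set Us \<subseteq> set Ts" for Us
    using that Node.IH by (induction Us) force+
  from this[of Ts] Node.hyps show ?case by (cases a) auto
qed simp

text \<open>If the root offers no edge to toggle, its label is a single generator and all children
  but the first are leaves. The root then counts one for vertices and one for weight, so the strict
  inequality passes to the first child.\<close>

lemma matched_total: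
  assumes "T \<in> normal_bar" "int (vertices T) < bar_weight T"
  shows "(\<exists>S. matched T S) \<or> (\<exists>U. matched U T)"
  using assms
proof (induction T rule: trees.induct)
  case (Node a Ts)
  obtain k ss where a': "a = Node k ss" using Node.hyps by (cases a) auto
  then have "ss \<noteq> []" "hd ss = Leaf" using Node.hyps by auto
  then obtain as where a: "a = Node k (Leaf # as)" using a' by (cases ss) auto
  obtain T Rs where Ts: "Ts = T # Rs" "length Rs = sum_list (map leaves as)"
    using Node.hyps a by (cases Ts) auto
  have Ts_nc: "set Rs \<subseteq> nc_bar" using Node.hyps normal_bar_subset Ts by auto
  consider "as = replicate (length as) Leaf" "Rs = replicate (length as) Leaf"
    | bs Ss where "shift as Rs bs Ss" | bs Ss where "shift bs Ss as Rs"
    using shift_total[of as Rs] Ts Ts_nc by auto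
  then show ?case
  proof cases
    case 1
    define m where "m = length as"
    have rep: "as = replicate m Leaf" "Rs = replicate m Leaf" using 1 by (auto simp: m_def)
    have "int (vertices T) < bar_weight T"
      using Node.prems a Ts rep by (simp add: sum_list_replicate)
    then have "(\<exists>S. matched T S) \<or> (\<exists>U. matched U T)" using Node.IH Ts by auto
    then show ?thesis using a Ts rep matched.down by blast
  next
    case 2
    then show ?thesis using a Ts matched.top by blast
  next
    case 3
    then show ?thesis using a Ts matched.top by blast
  qed
qed simp

section \<open>Triangularity of the differential along the matching\<close>

lemma flat_in_trees:
  "T \<in> nc_bar \<Longrightarrow> flat T \<in> nc_trees \<and> leaves (flat T) = leaves T \<and> int (vertices (flat T)) = bar_weight T"
proof (induction T rule: trees.induct)
  case (Node a Ts)
  have "map leaves (map flat Ts) = map leaves Ts" using Node.IH by simp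
  moreover have "int (sum_list (map vertices (map flat Us))) = sum_list (map bar_weight Us)" if "set Us \<subseteq> set Ts" for Us
    using that Node.IH by (induction Us) auto
  ultimately show ?case
    using Node.hyps Node.IH by (auto simp: leaves_subst vertices_subst simp del: map_map intro!: subst_in_trees)
qed (auto intro: trees.Leaf)

text \<open>It depends on the underlying tree only: contractions and the matching preserve it, and
  rewriting a label raises it.\<close>

definition phi :: "nat ptree ptree \<Rightarrow> nat"
  where "phi T = rank (\<lambda>j. j) (flat T)"

lemma phi_le: "T \<in> nc_bar \<Longrightarrow> int (phi T) \<le> int (leaves T) * bar_weight T"
proof -
  assume "T \<in> nc_bar"
  note f = flat_in_trees[OF this]
  then have "rank (\<lambda>j. j + 0) (flat T) \<le> leaves T * vertices (flat T)" using rank_le[of "flat T" 0] by simp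
  then have "int (phi T) \<le> int (leaves T * vertices (flat T))" unfolding phi_def by (simp only: of_nat_le_iff add_0_right)
  then show ?thesis using f by simp
qed

lemma phi_less:
  assumes "lower a c" "a \<in> nc_trees" "c \<in> nc_trees" "leaves a = leaves c" "length Ts = leaves a" "set Ts \<subseteq> nc_bar"
  shows "phi (Node a Ts) < phi (Node c Ts)"
proof -
  have "lower (subst a (map flat Ts)) (subst c (map flat Ts))"
    using assms flat_in_trees by (intro lower_subst) auto
  then show ?thesis by (auto simp: lower_def phi_def strict_mono_def)
qed

lemma edge_contr_stats:
  assumes "Node a (Ls @ Node b Us # Rs) \<in> nc_bar"
  defines "V \<equiv> Node (graft a (Suc (length Ls)) b) (Ls @ Us @ Rs)"
  shows "V \<in> nc_bar" "leaves V = leaves (Node a (Ls @ Node b Us # Rs))"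
    "bar_weight V = bar_weight (Node a (Ls @ Node b Us # Rs))"
    "Suc (vertices V) = vertices (Node a (Ls @ Node b Us # Rs))" "flat V = flat (Node a (Ls @ Node b Us # Rs))"
proof -
  from assms(1) have *: "a \<in> nc_trees" "a \<noteq> Leaf" "leaves a = length Ls + Suc (length Rs)" "b \<in> nc_trees" "length Us = leaves b"
    "set Us \<subseteq> nc_bar" "set Ls \<subseteq> nc_bar" "set Rs \<subseteq> nc_bar"
    by (auto simp: nc_bar_Node)
  have g: "leaves (graft a (Suc (length Ls)) b) + 1 = leaves a + leaves b"
    "vertices (graft a (Suc (length Ls)) b) = vertices a + vertices b"
    using * leaves_graft(1)[of "Suc (length Ls)" a b] vertices_graft(1)[of "Suc (length Ls)" a b] by auto
  show "V \<in> nc_bar" unfolding V_def using * g by (auto simp: nc_bar_Node graft_in_trees graft_neq_Leaf)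
  show "leaves V = leaves (Node a (Ls @ Node b Us # Rs))" by (simp add: V_def)
  show "bar_weight V = bar_weight (Node a (Ls @ Node b Us # Rs))" using g by (simp add: V_def)
  show "Suc (vertices V) = vertices (Node a (Ls @ Node b Us # Rs))" by (simp add: V_def)
  show "flat V = flat (Node a (Ls @ Node b Us # Rs))"
    unfolding V_def using subst_graft(1)[of "Suc (length Ls)" a "map flat Ls" "map flat Us" b "map flat Rs"] * by simp
qed

text \<open>The trees allowed in the differential of U besides its partner: those that can be
  shifted themselves, and those that are strictly higher. Both keep the elimination from
  returning.\<close>

definition later :: "nat ptree ptree \<Rightarrow> nat ptree ptree set"
  where "later U = {V \<in> normal_bar. leaves V = leaves U \<and> bar_weight V = bar_weight U \<and> Suc (vertices V) = vertices U \<and>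
    ((\<exists>S. matched V S) \<or> phi U < phi V)}"

text \<open>The contraction itself preserves \<open>flat\<close>. Since the new label is not normal,
  its normal form contains only strictly higher labels, so \<open>phi\<close> grows.\<close>

lemma edge_contr_not_normal:
  assumes U: "Node a (Ls @ Node b Us # Rs) \<in> normal_bar" and c: "\<not> normal (graft a (Suc (length Ls)) b)"
  shows "(mon (Node (graft a (Suc (length Ls)) b) (Ls @ Us @ Rs)) :: 'k::field bar_vec)
    \<in> mod_supp bar_I (later (Node a (Ls @ Node b Us # Rs)))"
proof -
  let ?U = "Node a (Ls @ Node b Us # Rs)" and ?c = "graft a (Suc (length Ls)) b" and ?X = "Ls @ Us @ Rs"
  note st = edge_contr_stats[OF normal_bar_subset[OF U]]
  have X: "set ?X \<subseteq> normal_bar" using U by (auto simp: normal_bar_Node)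
  have c': "?c \<in> nc_trees" "?c \<noteq> Leaf" "length ?X = leaves ?c" "set ?X \<subseteq> nc_bar" using st(1) by (auto simp: nc_bar_Node)
  have "(mon (Node ?c ?X) :: 'k bar_vec) \<in> mod_supp bar_I
      {Node c ?X | c. normal c \<and> c \<noteq> Leaf \<and> leaves c = leaves ?c \<and> vertices c = vertices ?c \<and> (c = ?c \<or> lower ?c c)}"
    using c' X by (intro normal_form_root) auto
  moreover have "{Node c ?X | c. normal c \<and> c \<noteq> Leaf \<and> leaves c = leaves ?c \<and> vertices c = vertices ?c \<and> (c = ?c \<or> lower ?c c)}
      \<subseteq> later ?U"
  proof
    fix V assume "V \<in> {Node c ?X | c. normal c \<and> c \<noteq> Leaf \<and> leaves c = leaves ?c \<and> vertices c = vertices ?c \<and> (c = ?c \<or> lower ?c c)}"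
    then obtain d where d: "V = Node d ?X" "normal d" "d \<noteq> Leaf" "leaves d = leaves ?c" "vertices d = vertices ?c" "lower ?c d"
      using c by auto
    have "phi (Node ?c ?X) < phi V" unfolding d(1) using d c' by (intro phi_less) (auto simp: normal_in_trees)
    moreover have "phi (Node ?c ?X) = phi ?U" unfolding phi_def st(5) ..
    ultimately show "V \<in> later ?U" using d st c' X by (auto simp: later_def normal_bar_Node)
  qed
  ultimately show ?thesis using subsetD[OF mod_supp_mono] by blast
qed

text \<open>Here j is the edge to be toggled, and contracting it gives the partner. All positions
  before j are bare, so any other contraction happens behind j and leaves that edge cut.\<close>

lemma shift_contract:
  assumes "shift as Ts as' Ts'"
  shows "\<exists>j<length Ts. (\<exists>b Us. Ts ! j = Node b Us \<and> graft_list as (Suc j) b = as' \<and> take j Ts @ Us @ drop (Suc j) Ts = Ts') \<and>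
    (\<forall>i<length Ts. \<forall>b Us. i \<noteq> j \<longrightarrow> Ts ! i = Node b Us \<longrightarrow>
      (\<exists>cs Ss. shift (graft_list as (Suc i) b) (take i Ts @ Us @ drop (Suc i) Ts) cs Ss))"
  using assms
proof (induction rule: shift.induct)
  case (here b Us as Ts)
  have "\<exists>cs Ss. shift (graft_list (Leaf # as) (Suc i) c) (take i (Node b Us # Ts) @ Vs @ drop (Suc i) (Node b Us # Ts)) cs Ss"
    if i0: "i \<noteq> 0" for i c Vs
  proof -
    obtain i' where i: "i = Suc i'" using i0 by (cases i) auto
    from shift.here[OF here, of "graft_list as (Suc i') c" "take i' Ts @ Vs @ drop (Suc i') Ts"]
    show ?thesis using i by auto
  qed
  then show ?case by (intro exI[of _ 0]) auto
next
  case (skip as Ts as' Ts')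
  then obtain j b Us where j: "j < length Ts" "Ts ! j = Node b Us" "graft_list as (Suc j) b = as'" "take j Ts @ Us @ drop (Suc j) Ts = Ts'"
    and other: "\<And>i b Us. \<lbrakk>i < length Ts; i \<noteq> j; Ts ! i = Node b Us\<rbrakk> \<Longrightarrow>
      \<exists>cs Ss. shift (graft_list as (Suc i) b) (take i Ts @ Us @ drop (Suc i) Ts) cs Ss" by blast
  have "\<exists>cs Ss. shift (graft_list (Leaf # as) (Suc i) c) (take i (Leaf # Ts) @ Vs @ drop (Suc i) (Leaf # Ts)) cs Ss"
    if i0: "i < length (Leaf # Ts)" "i \<noteq> Suc j" "(Leaf # Ts) ! i = Node c Vs" for i c Vs
  proof -
    obtain i' where i: "i = Suc i'" using i0 by (cases i) auto
    with i0 obtain cs Ss where "shift (graft_list as (Suc i') c) (take i' Ts @ Vs @ drop (Suc i') Ts) cs Ss"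
      using other[of i' c Vs] by auto
    from shift.skip[OF this] show ?thesis using i by auto
  qed
  with j show ?case by (intro exI[of _ "Suc j"]) auto
qed

text \<open>A changed subtree that is still not a leaf keeps its edge cut, so the same edge can be
  toggled.\<close>

lemma shift_update:
  assumes "shift as Ts as' Ts'" "j < length Ts" "Ts ! j \<noteq> Leaf" "S \<in> nc_bar" "S \<noteq> Leaf"
  shows "\<exists>cs Ss. shift as (Ts[j := S]) cs Ss"
  using assms
proof (induction arbitrary: j rule: shift.induct)
  case (here b Us as Ts)
  show ?case
  proof (cases j)
    case 0
    obtain c Vs where "S = Node c Vs" "c \<noteq> Leaf" "length Vs = leaves c" using here(4-) by (cases S) (auto simp: nc_bar_Node)
    with shift.here[of c Vs as Ts] 0 show ?thesis by auto
  next
    case (Suc i)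
    then show ?thesis using shift.here[OF here(1,2)] by auto
  qed
next
  case (skip as Ts as' Ts')
  then obtain i where "j = Suc i" by (cases j) auto
  have "\<exists>cs Ss. shift as (Ts[i := S]) cs Ss"
    using skip.prems \<open>j = Suc i\<close> by (intro skip.IH) auto
  then obtain cs Ss where "shift as (Ts[i := S]) cs Ss" by blast
  from shift.skip[OF this] show ?case using \<open>j = Suc i\<close> by auto
qed

text \<open>Contracting the toggled edge gives the partner with a sign. A contraction that keeps
  labels normal leaves the toggled edge cut; one onto a first child forces a rewriting and raises
  \<open>phi\<close>; terms inside the children keep their root edges cut.\<close>

lemma matched_bar_d:
  assumes "matched U T" "U \<in> normal_bar"
  shows "\<exists>e. (e = 1 \<or> e = - 1) \<and>
    (bar_dt U - e *\<^sub>p mon T :: 'k::field bar_vec) \<in> mod_supp bar_I (later U)"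
  using assms
proof (induction rule: matched.induct)
  case (top as Ts as' Ts' k T)
  let ?a = "Node k (Leaf # as)" and ?Xs = "T # Ts"
  let ?U = "Node ?a ?Xs" and ?V = "Node (Node k (Leaf # as')) (T # Ts')"
  define M where "M = (mod_supp bar_I (later ?U) :: ('k bar_vec) set)"
  have M: "pm.subspace M" unfolding M_def by (intro subspace_mod_supp subspace_bar_ideal)
  define sg :: "nat \<Rightarrow> 'k" where "sg i = (- 1) ^ sum_list (map vertices (take i ?Xs))" for i
  have normal_U: "normal ?a" "length ?Xs = leaves ?a" "set ?Xs \<subseteq> normal_bar" "set ?Xs \<subseteq> nc_bar"
    using top.prems normal_bar_subset by (auto simp: normal_bar_Node)
  \<comment> \<open>The differential acts inside a child. The child keeps a vertex even after
    normalisation, so the toggled edge at the root stays cut and the result is again the first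
    member of a matched pair.\<close>
  have inner: "push (\<lambda>S. Node ?a (?Xs[i := S])) (bar_dt (?Xs ! i)) \<in> M" if i: "i < length ?Xs" for i
    unfolding lin_ext_def
  proof (intro pm.subspace_sum[OF M] pm.subspace_scale[OF M])
    fix S assume S: "S \<in> keys (bar_dt (?Xs ! i) :: 'k bar_vec)"
    have X: "?Xs ! i \<in> nc_bar" using i normal_U nth_mem by blast
    note S' = keys_bar_dt[OF S X]
    have "vertices (?Xs ! i) \<noteq> 0" using S'(4) by simp
    then have X_Node: "?Xs ! i \<noteq> Leaf" by auto
    have "push (\<lambda>S. Node ?a (?Xs[i := S])) (mon S) \<in> M"
      unfolding M_def
    proof (rule push_mod_supp[OF subspace_bar_ideal normal_form_bar[OF S'(1)]])
      fix h :: "'k bar_vec" assume "h \<in> bar_I"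
      moreover have "set (take i ?Xs) \<subseteq> nc_bar" "set (drop (Suc i) ?Xs) \<subseteq> nc_bar"
        using normal_U(4) set_take_subset[of i ?Xs] set_drop_subset[of "Suc i" ?Xs] by blast+
      ultimately have "push (\<lambda>S. Node ?a (take i ?Xs @ S # drop (Suc i) ?Xs)) h \<in> bar_I"
        using normal_U i by (intro push_inner_bar_I normal_in_trees) auto
      then show "push (\<lambda>S. Node ?a (?Xs[i := S])) h \<in> bar_I" using i by (simp only: upd_conv_take_nth_drop)
    next
      fix R assume R: "R \<in> same_shape S"
      have S0: "vertices S \<noteq> 0" using S'(5) by (cases S) auto
      from R have "vertices R \<noteq> 0" "R \<in> normal_bar" "leaves R = leaves (?Xs ! i)" "bar_weight R = bar_weight (?Xs ! i)"
        "Suc (vertices R) = vertices (?Xs ! i)"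
        using S' S0 by (auto simp: same_shape_def)
      note R = this
      let ?W = "Node ?a (?Xs[i := R])"
      have split: "?Xs = take i ?Xs @ ?Xs ! i # drop (Suc i) ?Xs" using i by (rule id_take_nth_drop)
      have upd: "?Xs[i := R] = take i ?Xs @ R # drop (Suc i) ?Xs" using i by (rule upd_conv_take_nth_drop)
      have "set (?Xs[i := R]) \<subseteq> normal_bar" using normal_U(3) R(2) set_update_subset_insert[of ?Xs i R] by blast
      then have "?W \<in> normal_bar"
        unfolding normal_bar_Node length_list_update using normal_U(1,2) ptree.distinct(2) by blast
      moreover have "leaves ?W = leaves ?U"
        using R(3) arg_cong[OF split, of "\<lambda>l. sum_list (map leaves l)"] unfolding upd by simp
      moreover have "bar_weight ?W = bar_weight ?U"
        using R(4) arg_cong[OF split, of "\<lambda>l. sum_list (map bar_weight l)"] unfolding upd by simp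
      moreover have "Suc (vertices ?W) = vertices ?U"
        using R(5) arg_cong[OF split, of "\<lambda>l. sum_list (map vertices l)"] unfolding upd by simp
      moreover have "\<exists>S. matched ?W S"
      proof (cases i)
        case 0
        then show ?thesis using matched.top[OF top.hyps] by auto
      next
        case (Suc j)
        have "R \<noteq> Leaf" using R(1) by auto
        with Suc i X_Node R(2) obtain cs Ss where "shift as (Ts[j := R]) cs Ss"
          using shift_update[OF top.hyps, of j R] normal_bar_subset by auto
        from matched.top[OF this] show ?thesis using Suc by auto
      qed
      ultimately have "?W \<in> later ?U" by (simp add: later_def)
      then show "(mon ?W :: 'k bar_vec) \<in> mod_supp bar_I (later ?U)"
        by (intro mon_in_mod_supp subspace_bar_ideal)
    qed
    then show "mon (Node ?a (?Xs[i := S])) \<in> M" by simp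
  qed
  obtain j b Us where j: "j < length Ts" "Ts ! j = Node b Us" "graft_list as (Suc j) b = as'" "take j Ts @ Us @ drop (Suc j) Ts = Ts'"
    and other: "\<And>i b Us. \<lbrakk>i < length Ts; i \<noteq> j; Ts ! i = Node b Us\<rbrakk> \<Longrightarrow>
      \<exists>cs Ss. shift (graft_list as (Suc i) b) (take i Ts @ Us @ drop (Suc i) Ts) cs Ss"
    using shift_contract[OF top.hyps] by blast
  have edge: "edge_contr ?a ?Xs i \<in> M" if i: "i < length ?Xs" "i \<noteq> Suc j" for i
  proof (cases "?Xs ! i")
    case Leaf
    then show ?thesis using pm.subspace_0[OF M] by (simp add: edge_contr_def)
  next
    case (Node c Vs)
    let ?W = "Node (graft ?a (Suc i) c) (take i ?Xs @ Vs @ drop (Suc i) ?Xs)"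
    have split: "?Xs = take i ?Xs @ Node c Vs # drop (Suc i) ?Xs"
      using id_take_nth_drop[OF i(1)] Node by simp
    have len: "length (take i ?Xs) = i" using i(1) by simp
    have U: "Node ?a (take i ?Xs @ Node c Vs # drop (Suc i) ?Xs) \<in> normal_bar" using top.prems split by metis
    have W: "mon ?W \<in> M"
    proof (cases "normal (graft ?a (Suc i) c)")
      case False
      then show ?thesis using edge_contr_not_normal[where 'k = 'k, OF U] unfolding M_def len split[symmetric] by blast
    next
      case True
      note st = edge_contr_stats[OF normal_bar_subset[OF U], unfolded len split[symmetric]]
      have "c \<noteq> Leaf" using U by (auto simp: normal_bar_Node)
      \<comment> \<open>Grafting onto the first leaf would give the root a vertex as first child,
        contrary to normality; hence i is not 0.\<close>
      then obtain i' where i': "i = Suc i'" using True by (cases i; cases c) auto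
      have "set (take i ?Xs @ Vs @ drop (Suc i) ?Xs) \<subseteq> normal_bar"
        using U by (auto simp: normal_bar_Node)
      then have "?W \<in> normal_bar" using st(1) True unfolding nc_bar_Node normal_bar_Node by blast
      moreover obtain cs Ss where "shift (graft_list as (Suc i') c) (take i' Ts @ Vs @ drop (Suc i') Ts) cs Ss"
        using other[of i' c Vs] i i' Node by auto
      from matched.top[OF this, of k T] have "\<exists>S. matched ?W S" using i' by auto
      ultimately have "?W \<in> later ?U" using st by (simp add: later_def)
      then show ?thesis unfolding M_def by (intro mon_in_mod_supp subspace_bar_ideal)
    qed
    then show ?thesis using Node by (simp add: edge_contr_def)
  qed
  have edge_j: "edge_contr ?a ?Xs (Suc j) = mon ?V" using j by (simp add: edge_contr_def)
  have "bar_dt ?U = (\<Sum>i<length ?Xs. sg i *\<^sub>p edge_contr ?a ?Xs i) +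
      (\<Sum>i<length ?Xs. (- sg i) *\<^sub>p push (\<lambda>S. Node ?a (?Xs[i := S])) (bar_dt (?Xs ! i)))"
    unfolding bar_dt_Node sg_def by simp
  also have "(\<Sum>i<length ?Xs. sg i *\<^sub>p edge_contr ?a ?Xs i) =
      sg (Suc j) *\<^sub>p edge_contr ?a ?Xs (Suc j) + (\<Sum>i\<in>{..<length ?Xs} - {Suc j}. sg i *\<^sub>p edge_contr ?a ?Xs i)"
    using j(1) by (intro sum.remove) auto
  finally have "bar_dt ?U - sg (Suc j) *\<^sub>p mon ?V = (\<Sum>i\<in>{..<length ?Xs} - {Suc j}. sg i *\<^sub>p edge_contr ?a ?Xs i) +
      (\<Sum>i<length ?Xs. (- sg i) *\<^sub>p push (\<lambda>S. Node ?a (?Xs[i := S])) (bar_dt (?Xs ! i)))"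
    by (simp only: edge_j) simp
  also have "\<dots> \<in> M"
    using edge inner by (intro pm.subspace_add[OF M] pm.subspace_sum[OF M] pm.subspace_scale[OF M]) auto
  finally have "bar_dt ?U - sg (Suc j) *\<^sub>p mon ?V \<in> M" .
  moreover have "sg (Suc j) = 1 \<or> sg (Suc j) = - 1" unfolding sg_def by (rule minus_one_power_iff[THEN ssubst]) auto
  ultimately show ?case unfolding M_def by blast
next
  case (down U T k m)
  let ?a = "Node k (Leaf # replicate m Leaf)" and ?F = "\<lambda>S. Node (Node k (Leaf # replicate m Leaf)) (S # replicate m Leaf) :: nat ptree ptree"
  define M where "M = (mod_supp bar_I (later (?F U)) :: ('k bar_vec) set)"
  have M: "pm.subspace M" unfolding M_def by (intro subspace_mod_supp subspace_bar_ideal)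
  have U: "U \<in> normal_bar" "normal ?a" using down.prems by (auto simp: normal_bar_Node)
  obtain e :: 'k where e: "e = 1 \<or> e = - 1" "bar_dt U - e *\<^sub>p mon T \<in> mod_supp bar_I (later U)"
    using down.IH[OF U(1)] by blast
  have 1: "push ?F (bar_dt U - e *\<^sub>p mon T) \<in> M"
    unfolding M_def
  proof (rule push_mod_supp[OF subspace_bar_ideal e(2)])
    fix h :: "'k bar_vec" assume "h \<in> bar_I"
    moreover have "set (replicate m Leaf) \<subseteq> nc_bar" using Leaf_in_nc_bar by (auto simp: set_replicate_conv_if)
    ultimately show "push ?F h \<in> bar_I"
      using push_inner_bar_I[of h ?a "[]" "replicate m Leaf"] normal_in_trees[OF U(2)]
      by (simp add: sum_list_replicate)
  next
    fix V assume V: "V \<in> later U"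
    have "phi (?F S) = phi S" for S
      by (simp add: phi_def subst_list_replicate_Leaf)
    moreover have "?F V \<in> normal_bar" using down.prems V by (auto simp: normal_bar_Node later_def)
    moreover have "(\<exists>S. matched (?F V) S) \<or> phi U < phi V"
      using V matched.down unfolding later_def by blast
    ultimately have "?F V \<in> later (?F U)" using V by (simp add: later_def)
    then show "(mon (?F V) :: 'k bar_vec) \<in> mod_supp bar_I (later (?F U))"
      by (intro mon_in_mod_supp subspace_bar_ideal)
  qed
  obtain b Us where Node: "U = Node b Us" using matched_stats(6)[OF down.hyps] by (cases U) auto
  have b: "b \<noteq> Leaf" using U(1) Node by (auto simp: normal_bar_Node)
  \<comment> \<open>The only edge at the root leads to the first child, so its contraction is never
    normal.\<close>
  have 2: "edge_contr ?a (U # replicate m Leaf) 0 \<in> M"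
  proof -
    have "\<not> normal (graft ?a (Suc (length [])) b)" using b by (cases b) auto
    from edge_contr_not_normal[where 'k = 'k, OF _ this, of Us "replicate m Leaf"] down.prems Node
    show ?thesis by (simp add: M_def edge_contr_def)
  qed
  have "bar_dt (?F U) = (\<Sum>i<Suc m. (- 1) ^ sum_list (map vertices (take i (U # replicate m Leaf))) *\<^sub>p
        edge_contr ?a (U # replicate m Leaf) i) +
      (\<Sum>i<Suc m. (- 1) ^ Suc (sum_list (map vertices (take i (U # replicate m Leaf)))) *\<^sub>p
        push (\<lambda>S. Node ?a ((U # replicate m Leaf)[i := S])) (bar_dt ((U # replicate m Leaf) ! i)) :: 'k bar_vec)"
    unfolding bar_dt_Node by simp
  also have "\<dots> = edge_contr ?a (U # replicate m Leaf) 0 - push ?F (bar_dt U)"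
    unfolding sum.lessThan_Suc_shift by (simp add: edge_contr_def)
  \<comment> \<open>The differential passes the odd root label, which turns e into - e.\<close>
  finally have "bar_dt (?F U) - (- e) *\<^sub>p mon (?F T) =
      edge_contr ?a (U # replicate m Leaf) 0 - push ?F (bar_dt U - e *\<^sub>p mon T)"
    by (simp add: lin_ext_diff lin_ext_scale)
  also have "\<dots> \<in> M" using 1 2 by (rule pm.subspace_diff[OF M, rotated])
  finally show ?case using e(1) unfolding M_def by (intro exI[of _ "- e"]) auto
qed

subsection \<open>Koszulness\<close>

lemma bar_d_nc: "bar_d ncHyperCom = lin_ext bar_dt"
  by (simp add: bar_d_def fun_eq_iff)

lemma bar_comp_nc: "f \<in> bar_comp ncHyperCom n w b \<longleftrightarrow>
    (\<forall>T\<in>keys f. T \<in> nc_bar \<and> leaves T = n \<and> bar_weight T = int w \<and> vertices T = b)"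
  by (simp add: bar_comp_def)

lemma bar_comp_eq_supp: "bar_comp ncHyperCom n w b = supp {T \<in> nc_bar. leaves T = n \<and> bar_weight T = int w \<and> vertices T = b}"
  by (auto simp: supp_def bar_comp_nc)

definition sources :: "nat ptree ptree set"
  where "sources = {U \<in> normal_bar. \<exists>S. matched U S}"

text \<open>The chains that can be moved onto sources by adding a boundary, modulo the bar
  ideal.\<close>

definition reducible :: "nat \<Rightarrow> nat \<Rightarrow> nat \<Rightarrow> (nat ptree ptree \<Rightarrow>\<^sub>0 'k::field) set"
  where "reducible n w b = {x. \<exists>y\<in>bar_comp ncHyperCom n w (Suc b). x - lin_ext bar_dt y \<in> mod_supp bar_I sources}"

lemma subspace_reducible: "pm.subspace (reducible n w b :: (nat ptree ptree \<Rightarrow>\<^sub>0 'k::field) set)"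
proof -
  let ?V = "{lin_ext bar_dt y | y. y \<in> bar_comp ncHyperCom n w (Suc b)} :: ('k bar_vec) set"
  have V: "pm.subspace ?V"
    unfolding pm.subspace_def
  proof (intro conjI ballI allI)
    show "0 \<in> ?V" by (intro CollectI exI[of _ 0]) (simp add: bar_comp_nc)
  next
    fix x y assume "x \<in> ?V" "y \<in> ?V"
    then obtain x' y' where "x = lin_ext bar_dt x'" "y = lin_ext bar_dt y'"
      "x' \<in> bar_comp ncHyperCom n w (Suc b)" "y' \<in> bar_comp ncHyperCom n w (Suc b)" by blast
    then show "x + y \<in> ?V"
      unfolding bar_comp_eq_supp
      by (intro CollectI exI[of _ "x' + y'"]) (simp add: lin_ext_add pm.subspace_add[OF subspace_supp])
  next
    fix c x assume "x \<in> ?V"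
    then obtain x' where "x = lin_ext bar_dt x'" "x' \<in> bar_comp ncHyperCom n w (Suc b)" by blast
    then show "c *\<^sub>p x \<in> ?V"
      unfolding bar_comp_eq_supp
      by (intro CollectI exI[of _ "c *\<^sub>p x'"]) (simp add: lin_ext_scale pm.subspace_scale[OF subspace_supp])
  qed
  have "reducible n w b = {x + y | x y. x \<in> ?V \<and> y \<in> mod_supp bar_I sources}"
    unfolding reducible_def
  proof (intro set_eqI iffI)
    fix x :: "'k bar_vec"
    assume "x \<in> {x. \<exists>y\<in>bar_comp ncHyperCom n w (Suc b). x - lin_ext bar_dt y \<in> mod_supp bar_I sources}"
    then obtain y where "y \<in> bar_comp ncHyperCom n w (Suc b)" "x - lin_ext bar_dt y \<in> mod_supp bar_I sources" by blast
    moreover have "x = lin_ext bar_dt y + (x - lin_ext bar_dt y)" by simp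
    ultimately show "x \<in> {x + y | x y. x \<in> ?V \<and> y \<in> mod_supp bar_I sources}" by blast
  next
    fix x :: "'k bar_vec"
    assume "x \<in> {x + y | x y. x \<in> ?V \<and> y \<in> mod_supp bar_I sources}"
    then obtain y z where "x = lin_ext bar_dt y + z" "y \<in> bar_comp ncHyperCom n w (Suc b)" "z \<in> mod_supp bar_I sources"
      by blast
    then show "x \<in> {x. \<exists>y\<in>bar_comp ncHyperCom n w (Suc b). x - lin_ext bar_dt y \<in> mod_supp bar_I sources}"
      by (intro CollectI bexI[of _ y]) auto
  qed
  then show ?thesis using pm.subspace_sums[OF V subspace_mod_supp[OF subspace_bar_ideal]] by simp
qed

lemma mod_supp_reducible: "x \<in> mod_supp bar_I sources \<Longrightarrow> x \<in> reducible n w b"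
  unfolding reducible_def by (intro CollectI bexI[of _ 0]) (auto simp: bar_comp_nc)

text \<open>Off the diagonal a normal tree is a source or the partner T of some U. In the latter
  case the differential of U expresses T by sources and by trees with larger \<open>phi\<close>,
  which is bounded by n * w.\<close>

lemma normal_reducible:
  assumes "T \<in> normal_bar" "leaves T = n" "bar_weight T = int w" "vertices T = b" "b < w"
  shows "(mon T :: 'k::field bar_vec) \<in> reducible n w b"
  using assms
proof (induction T rule: measure_induct_rule[of "\<lambda>T. n * w - phi T"])
  case (less T)
  note sub = subspace_reducible[of n w b]
  have "int (vertices T) < bar_weight T" using less.prems by simp
  with less.prems(1) consider S where "matched T S" | U where "matched U T"
    using matched_total by blast
  then show ?case
  proof cases
    case 1
    then have "T \<in> sources" using less.prems by (auto simp: sources_def)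
    then show ?thesis by (intro mod_supp_reducible mon_in_mod_supp subspace_bar_ideal)
  next
    case 2
    note st = matched_stats[OF 2]
    have U: "U \<in> normal_bar" using st less.prems by simp
    obtain e :: 'k where e: "e = 1 \<or> e = - 1" "bar_dt U - e *\<^sub>p mon T \<in> mod_supp bar_I (later U)"
      using matched_bar_d[OF 2 U] by blast
    then obtain g where g: "g \<in> supp (later U)" "bar_dt U - e *\<^sub>p mon T - g \<in> bar_I" by (auto simp: mod_supp_def)
    have "mon U \<in> bar_comp ncHyperCom n w (Suc b)"
      using st less.prems normal_bar_subset[OF U] by (simp add: bar_comp_nc)
    then have 1: "bar_dt U \<in> reducible n w b"
      unfolding reducible_def using pm.subspace_0[OF subspace_mod_supp[OF subspace_bar_ideal]]
      by (intro CollectI bexI[of _ "mon U"]) auto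
    have "lin_ext mon g \<in> reducible n w b"
    proof (rule lin_ext_in_subspace[OF sub])
      fix V assume "V \<in> keys g"
      with g(1) have V: "V \<in> later U" by (auto simp: supp_def)
      then consider "\<exists>S. matched V S" | "phi U < phi V" by (auto simp: later_def)
      then show "(mon V :: 'k bar_vec) \<in> reducible n w b"
      proof cases
        case 1
        then have "V \<in> sources" using V by (auto simp: sources_def later_def)
        then show ?thesis by (intro mod_supp_reducible mon_in_mod_supp subspace_bar_ideal)
      next
        case 2
        have stV: "V \<in> normal_bar" "leaves V = n" "bar_weight V = int w" "vertices V = b"
          using V st less.prems by (auto simp: later_def)
        have "phi U = phi T" using st by (simp add: phi_def)
        moreover have "phi V \<le> n * w"
          using phi_le[OF normal_bar_subset[OF stV(1)]] stV by (simp flip: of_nat_mult)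
        ultimately show ?thesis using 2 stV less.prems(5) by (intro less.IH) auto
      qed
    qed
    then have 2: "g \<in> reducible n w b" by simp
    have 3: "bar_dt U - e *\<^sub>p mon T - g \<in> reducible n w b"
      using g(2) by (intro mod_supp_reducible ideal_in_mod_supp)
    \<comment> \<open>The sign e is its own inverse.\<close>
    have "mon T = e *\<^sub>p (bar_dt U - ((bar_dt U - e *\<^sub>p mon T - g) + g))"
      using e(1) by (auto simp: pm.scale_scale simp del: bar_d_tree.simps)
    also have "\<dots> \<in> reducible n w b"
      by (rule pm.subspace_scale[OF sub pm.subspace_diff[OF sub 1 pm.subspace_add[OF sub 3 2]]])
    finally show ?thesis .
  qed
qed

text \<open>Take U in g with least \<open>phi\<close> and let T be its partner. The T-coordinate of
  the differential of g comes from U alone, with coefficient plus or minus one, so U cannot occur in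
  g.\<close>

lemma sources_no_cycles:
  fixes g :: "nat ptree ptree \<Rightarrow>\<^sub>0 'k::field"
  assumes g: "g \<in> supp sources" and d: "lin_ext bar_dt g \<in> bar_I"
  shows "g = 0"
proof (rule ccontr)
  assume "g \<noteq> 0"
  then have "keys g \<noteq> {}" by simp
  then obtain U where U: "U \<in> keys g" "\<And>V. V \<in> keys g \<Longrightarrow> phi U \<le> phi V"
    using ex_min_if_finite[of "phi ` keys g"] by (force simp: not_less)
  then obtain T where T: "matched U T" using g by (auto simp: supp_def sources_def)
  define c where "c V = ev (\<lambda>S. coord S T) (bar_dt V :: 'k bar_vec)" for V
  have c: "\<exists>e. (e = 1 \<or> e = - 1) \<and> c V = (if V = U then e else 0)" if V: "V \<in> keys g" for V
  proof -
    obtain S where S: "matched V S" "V \<in> normal_bar" using V g by (auto simp: supp_def sources_def)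
    obtain e :: 'k where e: "e = 1 \<or> e = - 1" "bar_dt V - e *\<^sub>p mon S \<in> mod_supp bar_I (later V)"
      using matched_bar_d[OF S] by blast
    then obtain h where h: "h \<in> supp (later V)" "bar_dt V - e *\<^sub>p mon S - h \<in> bar_I" by (auto simp: mod_supp_def)
    have hn: "h \<in> supp normal_bar" "S \<in> normal_bar"
      using h(1) S matched_stats(4)[OF S(1)] by (auto simp: supp_def later_def)
    \<comment> \<open>As a partner, T is not a source, and its \<open>phi\<close> equals the minimal
      value, that of U.\<close>
    have "T \<notin> later V"
    proof
      assume "T \<in> later V"
      then have "phi V < phi T" using matched_exclusive[OF T] by (auto simp: later_def)
      moreover have "phi T = phi U" using matched_stats(5)[OF T] by (simp add: phi_def)
      ultimately show False using U(2)[OF V] by simp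
    qed
    then have h0: "lookup h T = 0" using h(1) by (auto simp: supp_def in_keys_iff)
    have "0 = ev (\<lambda>S. coord S T) (bar_dt V - e *\<^sub>p mon S - h)" using coord_bar_ideal[OF h(2)] by simp
    also have "\<dots> = c V - e * (if S = T then 1 else 0)"
      using hn by (simp add: ev_diff ev_scale ev_coord_supp h0 coord_normal c_def del: bar_d_tree.simps)
    finally have cV: "c V = e * (if S = T then 1 else 0)" by simp
    have "S = T \<longleftrightarrow> V = U"
    proof
      assume "S = T"
      then show "V = U" using matched_inj[OF T] S(1) by blast
    next
      assume "V = U"
      then show "S = T" using matched_fun S(1) T by blast
    qed
    with cV e(1) show ?thesis by auto
  qed
  have "0 = ev (\<lambda>S. coord S T) (lin_ext bar_dt g)" using coord_bar_ideal[OF d] by simp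
  also have "\<dots> = ev c g" unfolding ev_lin_ext by (intro ev_cong) (simp add: c_def)
  also have "\<dots> = (\<Sum>V\<in>keys g. if V = U then lookup g U * c U else 0)"
  proof -
    have "c V = 0" if "V \<in> keys g" "V \<noteq> U" for V using c[OF that(1)] that(2) by auto
    then show ?thesis unfolding ev_def by (intro sum.cong) auto
  qed
  also have "\<dots> = lookup g U * c U" using U(1) by simp
  finally have "lookup g U * c U = 0" by simp
  moreover have "c U \<noteq> 0" using c[OF U(1)] by auto
  ultimately show False using U(1) by (simp add: in_keys_iff)
qed

text \<open>A vertex of arity k adds k - 1 leaves and degree 2(k - 1) - 2. In fixed arity, degree
  and number of vertices therefore determine each other.\<close>

lemma tdeg_nc: "t \<in> nc_trees \<Longrightarrow> tdeg (\<lambda>k. 2 * int k - 4) t = 2 * (int (leaves t) - 1 - int (vertices t))"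
proof (induction t rule: trees.induct)
  case (Node x ts)
  have "sum_list (map (tdeg (\<lambda>k. 2 * int k - 4)) us) =
      2 * (int (sum_list (map leaves us)) - int (length us) - int (sum_list (map vertices us)))" if "set us \<subseteq> set ts" for us
    using that Node.IH by (induction us) (auto simp: algebra_simps)
  from this[of ts] Node.hyps show ?case by simp
qed simp

lemma is_quadratic_nc: "is_quadratic (ncHyperCom :: (nat, 'k::field) quadratic_data)"
  unfolding is_quadratic_def
proof
  fix r :: "'k tree_vec" assume "r \<in> rels ncHyperCom"
  then obtain n i where r: "r = nc_rel n i" "3 \<le> n" "2 \<le> i" "i \<le> n - 1" by (auto simp: ncHyperCom_def)
  obtain r' :: "'k tree_vec" where r': "r = mon (graft (corolla (n - i + 1)) 1 (corolla i)) - r'"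
    "keys r' \<subseteq> {graft (corolla k) j (corolla l) | k j l. 2 \<le> k \<and> 2 \<le> l \<and> 2 \<le> j \<and> j \<le> k \<and> k + l = n + 1}"
    unfolding r(1) by (rule nc_rel_leading[OF r(2-4)])
  have *: "\<exists>k j l. t = graft (corolla k) j (corolla l) \<and> 2 \<le> k \<and> 2 \<le> l \<and> 1 \<le> j \<and> j \<le> k \<and> k + l = n + 1"
    if "t \<in> keys r" for t
    using that unfolding r'(1)
  proof (rule keys_minusE)
    assume "t \<in> keys (mon (graft (corolla (n - i + 1)) 1 (corolla i)) :: 'k tree_vec)"
    then show ?thesis using r by (intro exI[of _ "n - i + 1"] exI[of _ 1] exI[of _ i]) auto
  next
    assume "t \<in> keys r'"
    then show ?thesis using r'(2) by fastforce
  qed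
  have "t \<in> nc_trees \<and> leaves t = n \<and> vertices t = 2" if "t \<in> keys r" for t
  proof -
    from *[OF that] obtain k j l where "t = graft (corolla k) j (corolla l)" "2 \<le> k" "2 \<le> l" "1 \<le> j" "j \<le> k" "k + l = n + 1"
      by blast
    then show ?thesis using two_corollas[of k l j] by simp
  qed
  moreover from this have "tdeg (\<lambda>k. 2 * int k - 4) t = 2 * (int n - 3)" if "t \<in> keys r" for t
    using that by (simp add: tdeg_nc)
  ultimately show "(\<exists>n d. r \<in> free_comp ncHyperCom n d) \<and> (\<forall>t\<in>keys r. vertices t = 2)"
    by (intro conjI exI[of _ n] exI[of _ "2 * (int n - 3)"]) (auto simp: free_comp_def free_arity_nc)
qed

lemma koszul_nc: "koszul (ncHyperCom :: (nat, 'k::field) quadratic_data)"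
  unfolding koszul_def
proof (intro conjI is_quadratic_nc allI impI ballI)
  fix n w b and x :: "'k bar_vec"
  assume bw: "b \<noteq> w" and x: "x \<in> bar_comp ncHyperCom n w b" and d: "bar_d ncHyperCom x \<in> bar_I"
  have x_keys: "T \<in> nc_bar \<and> leaves T = n \<and> bar_weight T = int w \<and> vertices T = b" if "T \<in> keys x" for T
    using x that by (auto simp: bar_comp_nc)
  show "\<exists>y\<in>bar_comp ncHyperCom n w (Suc b). x - bar_d ncHyperCom y \<in> bar_I"
  \<comment> \<open>Each label has weight at least one, so there are no chains with b > w.\<close>
  proof (cases "b < w")
    case False
    have "keys x = {}"
    proof (rule ccontr)
      assume "keys x \<noteq> {}"
      then obtain T where "T \<in> keys x" by blast
      with x_keys vertices_le_weight[of T] False bw show False by auto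
    qed
    then have "x = 0" by simp
    then show ?thesis by (intro bexI[of _ 0]) (auto simp: bar_comp_nc bar_d_nc intro: bar_ideal.zero)
  next
    case True
    have "lin_ext mon x \<in> reducible n w b"
    proof (rule lin_ext_in_subspace[OF subspace_reducible])
      fix T assume "T \<in> keys x"
      note T = x_keys[OF this]
      then obtain g where g: "g \<in> supp (same_shape T)" "(mon T :: 'k bar_vec) - g \<in> bar_I"
        using normal_form_bar[of T] by (auto simp: mod_supp_def)
      have "lin_ext mon g \<in> reducible n w b"
        using g(1) T True by (intro lin_ext_in_subspace[OF subspace_reducible] normal_reducible) (auto simp: supp_def same_shape_def)
      moreover have "(mon T :: 'k bar_vec) - g \<in> reducible n w b" using g(2) by (intro mod_supp_reducible ideal_in_mod_supp)
      ultimately have "((mon T :: 'k bar_vec) - g) + g \<in> reducible n w b"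
        by (intro pm.subspace_add[OF subspace_reducible]) simp_all
      then show "(mon T :: 'k bar_vec) \<in> reducible n w b" by simp
    qed
    then obtain y g where y: "y \<in> bar_comp ncHyperCom n w (Suc b)" and g: "g \<in> supp sources" "x - lin_ext bar_dt y - g \<in> bar_I"
      by (auto simp: reducible_def mod_supp_def)
    have "lin_ext bar_dt (lin_ext bar_dt y) = lin_ext (\<lambda>T. 0) y"
      unfolding lin_ext_lin_ext using y by (intro lin_ext_cong bar_dt_bar_dt) (auto simp: bar_comp_nc)
    \<comment> \<open>Modulo the ideal, x is a boundary plus a combination g of sources. Since x is
      a cycle, so is g, and g = 0.\<close>
    then have "lin_ext bar_dt g = lin_ext bar_dt x - lin_ext bar_dt (x - lin_ext bar_dt y - g)"
      by (simp add: lin_ext_diff)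
    also have "\<dots> \<in> bar_I"
      using d bar_d_ideal[OF g(2)] by (intro pm.subspace_diff[OF subspace_bar_ideal]) (simp_all add: bar_d_nc)
    finally have "g = 0" by (rule sources_no_cycles[OF g(1)])
    with y g(2) show ?thesis by (auto simp: bar_d_nc)
  qed
qed

subsection \<open>Counting normal trees\<close>

primrec internal :: "rose \<Rightarrow> nat"
  where "internal (R us) = (if us = [] then 0 else Suc (sum_list (map internal us)))"

lemma vertices_emb [simp]: "vertices (emb r) = internal r"
  by (induction r) (auto cong: map_cong simp: comp_def)

lemma emb_inj: "emb r = emb r' \<Longrightarrow> r = r'"
proof (induction r arbitrary: r')
  case (R us)
  obtain vs where r': "r' = R vs" by (cases r')
  have "map emb us = map emb vs" using R.prems r' by (auto split: if_splits)
  then have "us = vs" using R.IH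
  proof (induction us arbitrary: vs)
    case (Cons u us)
    then obtain v vs' where "vs = v # vs'" by (cases vs) auto
    with Cons show ?case by auto
  qed simp
  with r' show ?case by simp
qed

section \<open>Counting rose forests\<close>

lemma nodes_pos: "0 < nodes r"
  by (cases r) simp

text \<open>The parameter e is the number of edges, as each of the m trees has one node more than
  edges.\<close>

definition forests :: "nat \<Rightarrow> nat \<Rightarrow> nat \<Rightarrow> rose list set"
  where "forests m e i = {xs. length xs = m \<and> sum_list (map nodes xs) = m + e \<and> sum_list (map internal xs) = i}"

text \<open>A closed form of cycle-lemma type; for m = 1 and positive e and i it is the Narayana
  number of plane trees with e edges and i inner nodes.\<close>

definition forest_number :: "nat \<Rightarrow> nat \<Rightarrow> nat \<Rightarrow> real"
  where "forest_number m e i = (if e = 0 then (if i = 0 then 1 else 0) else if i = 0 then 0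
    else real m / real (m + e) * real ((m + e) choose i) * real ((e - 1) choose (i - 1)))"

lemma Suc_times_binomial_real: "(real k + 1) * real (Suc n choose Suc k) = (real n + 1) * real (n choose k)"
proof -
  have "real (Suc k * (Suc n choose Suc k)) = real (Suc n * (n choose k))" by (simp only: Suc_times_binomial)
  then show ?thesis by (simp only: of_nat_mult of_nat_Suc add.commute)
qed

lemma Suc_binomial_Suc: "(real k + 1) * real (n choose Suc k) = (real n - real k) * real (n choose k)"
proof -
  have "real (Suc n choose Suc k) = real (n choose k) + real (n choose Suc k)" by simp
  with Suc_times_binomial_real[of k n] show ?thesis by (simp only: ring_distribs)
qed

text \<open>Split the factor as x - (k + 1), absorb k + 1 into the binomial as (r + 1) times (k + 1
  choose r + 1), and both parts are hockey-stick sums.\<close>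

lemma weighted_hockey_stick:
  "(\<Sum>k<E. (x - 1 - real k) * real (k choose r)) = x * real (E choose Suc r) - (real r + 1) * real (Suc E choose Suc (Suc r))"
proof (induction E)
  case (Suc E)
  have "real (Suc (Suc E) choose Suc (Suc r)) = real (Suc E choose Suc r) + real (Suc E choose Suc (Suc r))"
    "real (Suc E choose Suc r) = real (E choose r) + real (E choose Suc r)"
    by simp_all
  with Suc Suc_times_binomial_real[of r E] show ?case
    by (simp add: algebra_simps del: binomial_Suc_Suc)
qed simp

text \<open>The recurrence obtained by deleting the root of the first tree; j is the number of its
  children.\<close>

lemma forest_number_Suc:
  "forest_number (Suc m) e i = forest_number m e i +
    (if i = 0 then 0 else \<Sum>j=1..e. forest_number (m + j) (e - j) (i - 1))"
proof -
  consider "i = 0" | "e = 0" "i \<noteq> 0" | "e \<noteq> 0" "i = 1" | E r where "e = Suc E" "i = Suc (Suc r)"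
    by (metis One_nat_def not0_implies_Suc)
  then show ?thesis
  proof cases
    case 3
    have "(\<Sum>j=1..e. forest_number (m + j) (e - j) (i - 1)) = (\<Sum>j=1..e. if j = e then 1 else 0)"
      using 3 by (intro sum.cong) (auto simp: forest_number_def)
    then show ?thesis using 3 by (simp add: forest_number_def Suc_le_eq)
  next
    case (4 E r)
    \<comment> \<open>M is the number of nodes of the remaining forest, (m + j) + (e - j). It does
      not depend on j, so the binomial with upper index M leaves the sum.\<close>
    define M where "M = m + Suc E"
    have M: "real M = real m + real E + 1" "0 < real M" by (simp_all add: M_def)
    define A B where "A = real (M choose Suc r)" and "B = real (E choose Suc r)"
    have "(\<Sum>j=1..e. forest_number (m + j) (e - j) (i - 1)) =
        (\<Sum>j=1..E. forest_number (m + j) (e - j) (i - 1)) + forest_number (m + e) 0 (i - 1)"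
      using 4 by simp
    also have "forest_number (m + e) 0 (i - 1) = 0" using 4 by (simp add: forest_number_def)
    also have "(\<Sum>j=1..E. forest_number (m + j) (e - j) (i - 1)) =
        (\<Sum>k<E. A / real M * ((real M - 1 - real k) * real (k choose r)))"
    proof (rule sum.reindex_bij_witness[of _ "\<lambda>k. E - k" "\<lambda>j. E - j"])
      fix j assume j: "j \<in> {1..E}"
      then have j': "e - j = Suc (E - j)" "m + j + Suc (E - j) = M" "real (m + j) = real M - 1 - real (E - j)"
        "i - 1 = Suc r" using 4 by (auto simp: M_def)
      then have "forest_number (m + j) (e - j) (i - 1) = real (m + j) / real M * real (M choose Suc r) * real ((E - j) choose r)"
        unfolding forest_number_def j'(1,4) j'(2) by simp
      then show "A / real M * ((real M - 1 - real (E - j)) * real ((E - j) choose r)) = forest_number (m + j) (e - j) (i - 1)"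
        unfolding j'(3) A_def by simp
    qed auto
    also have "\<dots> = A / real M * (real M * B - (real r + 1) * real (Suc E choose Suc (Suc r)))"
      unfolding sum_distrib_left[symmetric] weighted_hockey_stick B_def ..
    finally have sum: "(\<Sum>j=1..e. forest_number (m + j) (e - j) (i - 1)) =
        A / real M * (real M * B - (real r + 1) * real (Suc E choose Suc (Suc r)))" by simp
    have b1: "real (Suc M choose Suc (Suc r)) = (real M + 1) * A / (real r + 2)"
      using Suc_times_binomial_real[of "Suc r" M] unfolding A_def
      by (simp add: eq_divide_eq mult.commute add.commute del: binomial_Suc_Suc)
    have b2: "real (M choose Suc (Suc r)) = (real M - real r - 1) * A / (real r + 2)"
      using Suc_binomial_Suc[of "Suc r" M] unfolding A_def
      by (simp add: eq_divide_eq mult.commute add.commute diff_diff_eq)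
    have b3: "real (Suc E choose Suc (Suc r)) = (real E + 1) * B / (real r + 2)"
      using Suc_times_binomial_real[of "Suc r" E] unfolding B_def
      by (simp add: eq_divide_eq mult.commute add.commute del: binomial_Suc_Suc)
    have "forest_number (Suc m) e i = real (Suc m) / (real M + 1) * ((real M + 1) * A / (real r + 2)) * B"
      using 4 b1 by (simp add: forest_number_def M_def B_def del: binomial_Suc_Suc)
    moreover have "forest_number m e i = real m / real M * ((real M - real r - 1) * A / (real r + 2)) * B"
      using 4 b2 by (simp add: forest_number_def M_def B_def del: binomial_Suc_Suc)
    moreover have "real (Suc m) / (real M + 1) * ((real M + 1) * A / (real r + 2)) * B =
      real m / real M * ((real M - real r - 1) * A / (real r + 2)) * B +
      A / real M * (real M * B - (real r + 1) * ((real E + 1) * B / (real r + 2)))"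
      using M(2) unfolding M(1) by (simp add: divide_simps) (simp add: algebra_simps)
    ultimately show ?thesis using 4 sum b3 by simp
  qed (auto simp: forest_number_def)
qed

text \<open>The first tree is a single node, or its j children are placed in front of the other
  trees; j is needed to undo this.\<close>

lemma forests_Suc:
  "forests (Suc m) e i = (#) (R []) ` forests m e i \<union>
    (if i = 0 then {} else \<Union>j\<in>{1..e}. (\<lambda>zs. R (take j zs) # drop j zs) ` forests (m + j) (e - j) (i - 1))"
  (is "_ = ?A \<union> ?B")
proof (intro set_eqI iffI)
  fix xs assume xs: "xs \<in> forests (Suc m) e i"
  then obtain us ys where eq: "xs = R us # ys" by (cases xs) (auto simp: forests_def, metis rose.exhaust)
  show "xs \<in> ?A \<union> ?B"
  proof (cases "us = []")
    case True
    then show ?thesis using xs eq by (auto simp: forests_def)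
  next
    case False
    have "length zs \<le> sum_list (map nodes zs)" for zs
    proof (induction zs)
      case (Cons z zs)
      then show ?case using nodes_pos[of z] by simp
    qed simp
    from this[of us] this[of ys] have j: "length us \<in> {1..e}" "us @ ys \<in> forests (m + length us) (e - length us) (i - 1)"
      using xs eq False by (auto simp: forests_def Suc_le_eq)
    moreover have "i \<noteq> 0" using xs eq False by (auto simp: forests_def)
    moreover have "xs \<in> (\<lambda>zs. R (take (length us) zs) # drop (length us) zs) ` forests (m + length us) (e - length us) (i - 1)"
      using j(2) eq by (intro image_eqI[of _ _ "us @ ys"]) simp_all
    ultimately show ?thesis by (intro UnI2) (simp only: if_False, rule UN_I)
  qed
next
  fix xs assume "xs \<in> ?A \<union> ?B"
  then consider ys where "xs = R [] # ys" "ys \<in> forests m e i"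
    | j zs where "i \<noteq> 0" "1 \<le> j" "j \<le> e" "xs = R (take j zs) # drop j zs" "zs \<in> forests (m + j) (e - j) (i - 1)"
    by (auto split: if_splits)
  then show "xs \<in> forests (Suc m) e i"
  proof cases
    case 2
    then show ?thesis
      using sum_list_take_drop[of nodes j zs] sum_list_take_drop[of internal j zs] by (auto simp: forests_def)
  qed (auto simp: forests_def)
qed

lemma card_forests: "finite (forests m e i) \<and> real (card (forests m e i)) = forest_number m e i"
proof (induction "m + e" arbitrary: m e i rule: less_induct)
  case less
  show ?case
  proof (cases m)
    case 0
    then have "forests m e i = (if e = 0 \<and> i = 0 then {[]} else {})" by (auto simp: forests_def)
    then show ?thesis using 0 by (simp add: forest_number_def)
  next
    case (Suc m')
    let ?f = "\<lambda>j zs. R (take j zs) # drop j zs"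
    let ?F = "\<lambda>j. forests (m' + j) (e - j) (i - 1)"
    have IH0: "finite (forests m' e i)" "real (card (forests m' e i)) = forest_number m' e i"
      using less.hyps[of m' e i] Suc by auto
    have IH: "finite (?F j)" "real (card (?F j)) = forest_number (m' + j) (e - j) (i - 1)" if "j \<in> {1..e}" for j
      using less.hyps[of "m' + j" "e - j" "i - 1"] Suc that by auto
    have inj: "inj_on (?f j) (?F j)" for j
    proof (rule inj_onI)
      fix x y assume "?f j x = ?f j y"
      then have "take j x = take j y" "drop j x = drop j y" by auto
      then show "x = y" by (metis append_take_drop_id)
    qed
    define B where "B = (if i = 0 then {} else \<Union>j\<in>{1..e}. ?f j ` ?F j)"
    \<comment> \<open>The number j is recovered as the number of children of the first tree, so the
      pieces are disjoint.\<close>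
    have len: "length us = j" if "R us # ys \<in> ?f j ` ?F j" for us ys j
      using that by (auto simp: forests_def)
    have finB: "finite B" using IH(1) by (auto simp: B_def)
    have "card (\<Union>j\<in>{1..e}. ?f j ` ?F j) = (\<Sum>j=1..e. card (?f j ` ?F j))"
    proof (rule card_UN_disjoint)
      show "\<forall>j\<in>{1..e}. finite (?f j ` ?F j)" using IH(1) by auto
      show "\<forall>j\<in>{1..e}. \<forall>j'\<in>{1..e}. j \<noteq> j' \<longrightarrow> ?f j ` ?F j \<inter> ?f j' ` ?F j' = {}"
      proof (intro ballI impI equals0I)
        fix j j' x assume "j \<noteq> j'" and x: "x \<in> ?f j ` ?F j \<inter> ?f j' ` ?F j'"
        obtain zs where "x = ?f j zs" using x by blast
        with len[of "take j zs" "drop j zs" j] len[of "take j zs" "drop j zs" j'] x \<open>j \<noteq> j'\<close> show False by simp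
      qed
    qed simp
    also have "real \<dots> = (\<Sum>j=1..e. forest_number (m' + j) (e - j) (i - 1))"
      using inj IH(2) by (simp add: card_image)
    finally have cardB: "real (card B) = (if i = 0 then 0 else \<Sum>j=1..e. forest_number (m' + j) (e - j) (i - 1))"
      by (simp add: B_def)
    have "R [] # ys \<notin> B" for ys
    proof
      assume "R [] # ys \<in> B"
      then obtain j where j: "j \<in> {1..e}" "R [] # ys \<in> ?f j ` ?F j" unfolding B_def by (auto simp only: split: if_splits)
      from len[OF j(2)] j(1) show False by simp
    qed
    then have disj: "(#) (R []) ` forests m' e i \<inter> B = {}" by auto
    have eq: "forests m e i = (#) (R []) ` forests m' e i \<union> B" unfolding Suc forests_Suc B_def ..
    have "real (card (forests m e i)) = real (card ((#) (R []) ` forests m' e i)) + real (card B)"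
      unfolding eq using IH0 finB disj by (subst card_Un_disjoint) auto
    also have "\<dots> = forest_number m e i"
      unfolding Suc forest_number_Suc cardB using IH0(2) by (simp add: card_image)
    finally show ?thesis using IH0 finB eq by simp
  qed
qed

section \<open>Dimensions of the components\<close>

definition normal_trees :: "nat \<Rightarrow> nat \<Rightarrow> nat ptree set"
  where "normal_trees n w = {t. normal t \<and> leaves t = n \<and> vertices t = w}"

lemma card_normal_trees:
  assumes "1 \<le> n"
  shows "finite (normal_trees n w)" "real (card (normal_trees n w)) = forest_number 1 (n - 1) w"
proof -
  have "normal_trees n w = (\<lambda>xs. emb (hd xs)) ` forests 1 (n - 1) w"
  proof (intro set_eqI iffI)
    fix t assume t: "t \<in> normal_trees n w"
    then obtain r where "t = emb r" using normal_imp_emb by (auto simp: normal_trees_def)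
    with t assms show "t \<in> (\<lambda>xs. emb (hd xs)) ` forests 1 (n - 1) w"
      by (intro image_eqI[of _ _ "[r]"]) (auto simp: normal_trees_def forests_def)
  next
    fix t assume "t \<in> (\<lambda>xs. emb (hd xs)) ` forests 1 (n - 1) w"
    then obtain xs where "t = emb (hd xs)" "xs \<in> forests 1 (n - 1) w" by blast
    with assms show "t \<in> normal_trees n w" by (auto simp: normal_trees_def forests_def length_Suc_conv normal_emb)
  qed
  moreover have "inj_on (\<lambda>xs. emb (hd xs)) (forests 1 (n - 1) w)"
    by (rule inj_onI) (auto simp: forests_def length_Suc_conv dest: emb_inj)
  ultimately show "finite (normal_trees n w)" "real (card (normal_trees n w)) = forest_number 1 (n - 1) w"
    using card_forests[of 1 "n - 1" w] by (simp_all add: card_image)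
qed

text \<open>Rewriting gives the spanning property. A combination of normal monomials lying in the
  ideal is killed by \<open>nform\<close>, which also fixes it, so it is 0. The set M covers both a
  whole arity and a single degree.\<close>

lemma quot_dim_normal:
  assumes fin: "finite N" and N: "N \<subseteq> M" "\<And>t. t \<in> N \<Longrightarrow> normal t \<and> leaves t = n"
    and M: "\<And>t. t \<in> M \<Longrightarrow> (mon t :: 'k::field tree_vec) \<in> mod_supp (op_ideal ncHyperCom) N"
  shows "quot_dim (supp M) (op_ideal (ncHyperCom :: (nat, 'k) quadratic_data)) (card N)"
proof -
  let ?B = "mon ` N :: ('k tree_vec) set"
  have inj: "inj_on (\<lambda>t. mon t :: 'k tree_vec) N"
    by (rule inj_onI) (metis lookup_single_eq lookup_single_not_eq zero_neq_one)
  have B: "finite ?B" "card ?B = card N" using fin inj by (auto simp: card_image)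
  have B_sub: "?B \<subseteq> supp M" using N(1) by (auto simp: supp_def)
  have sum: "(\<Sum>b\<in>?B. c b *\<^sub>p b) = (\<Sum>t\<in>N. Poly_Mapping.single t (c (mon t)))" for c :: "('k tree_vec) \<Rightarrow> 'k"
    using inj by (simp add: sum.reindex single_scale)
  have span: "\<exists>c. v - (\<Sum>b\<in>?B. c b *\<^sub>p b) \<in> op_ideal ncHyperCom" if v: "v \<in> supp M" for v :: "'k tree_vec"
  proof -
    have "lin_ext mon v \<in> mod_supp (op_ideal ncHyperCom) N"
      using v M by (intro lin_ext_in_subspace subspace_mod_supp subspace_op_ideal) (auto simp: supp_def)
    then obtain g where g: "g \<in> supp N" "v - g \<in> op_ideal ncHyperCom" by (auto simp: mod_supp_def)
    \<comment> \<open>The coefficients must be indexed by basis vectors, not by trees; evaluating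
      the indicator of b reads off \<open>lookup g t\<close> for b = \<open>mon t\<close>.\<close>
    define c where "c b = ev (\<lambda>t. if mon t = b then 1 else 0) g" for b :: "'k tree_vec"
    have mon_eq: "(mon t :: 'k tree_vec) = mon s \<longleftrightarrow> t = s" for s t
      by (metis lookup_single_eq lookup_single_not_eq zero_neq_one)
    have "(\<Sum>b\<in>?B. c b *\<^sub>p b) = (\<Sum>t\<in>N. Poly_Mapping.single t (lookup g t))"
      unfolding sum by (simp add: c_def mon_eq ev_delta)
    also have "\<dots> = g"
    proof (rule poly_mapping_eqI)
      fix s
      have "lookup (\<Sum>t\<in>N. Poly_Mapping.single t (lookup g t)) s =
          (\<Sum>t\<in>N. if t = s then lookup g t else 0)"
        by (simp add: lookup_sum lookup_single when_def)
      also have "\<dots> = lookup g s"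
        using fin g(1) by (auto simp: supp_def in_keys_iff)
      finally show "lookup (\<Sum>t\<in>N. Poly_Mapping.single t (lookup g t)) s = lookup g s" .
    qed
    finally show "\<exists>c. v - (\<Sum>b\<in>?B. c b *\<^sub>p b) \<in> op_ideal ncHyperCom" using g(2) by (intro exI[of _ c]) simp
  qed
  have indep: "c b = 0" if I: "(\<Sum>b\<in>?B. c b *\<^sub>p b) \<in> op_ideal ncHyperCom" and b: "b \<in> ?B"
    for c :: "('k tree_vec) \<Rightarrow> 'k" and b
  proof -
    define f where "f = (\<Sum>t\<in>N. Poly_Mapping.single t (c (mon t)))"
    have keys: "keys f \<subseteq> N"
      unfolding f_def using keys_sum_subset[of "\<lambda>t. Poly_Mapping.single t (c (mon t))" N] by (auto split: if_splits)
    have "f \<in> op_ideal ncHyperCom" using I unfolding sum f_def .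
    moreover have "f \<in> free_arity ncHyperCom n" using keys N(2) by (auto simp: free_arity_nc normal_in_trees)
    ultimately have "lin_ext nform f = 0" by (rule nform_op_ideal)
    moreover have "lin_ext nform f = lin_ext mon f"
      using keys N(2) by (intro lin_ext_cong nform_normal) auto
    ultimately have "f = 0" by simp
    obtain t where t: "t \<in> N" "b = mon t" using b by blast
    have "lookup f t = (\<Sum>s\<in>N. if s = t then c (mon s) else 0)"
      unfolding f_def by (simp add: lookup_sum lookup_single when_def)
    then have "lookup f t = c b" using t fin by simp
    with \<open>f = 0\<close> show "c b = 0" by simp
  qed
  show ?thesis
    unfolding quot_dim_def using B B_sub span indep by (intro exI[of _ ?B]) blast
qed

lemma tdeg_nonneg: "t \<in> nc_trees \<Longrightarrow> 0 \<le> tdeg (\<lambda>k. 2 * int k - 4) t"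
proof (induction t rule: trees.induct)
  case (Node x ts)
  then have "0 \<le> sum_list (map (tdeg (\<lambda>k. 2 * int k - 4)) ts)" by (intro sum_list_nonneg) auto
  with Node.hyps show ?case by simp
qed simp

lemma comp_dim_nc:
  assumes "finite {t. normal t \<and> leaves t = n \<and> tdeg (\<lambda>k. 2 * int k - 4) t = d}"
  shows "comp_dim (ncHyperCom :: (nat, 'k::field) quadratic_data) n d
    (card {t. normal t \<and> leaves t = n \<and> tdeg (\<lambda>k. 2 * int k - 4) t = d})"
    (is "comp_dim _ n d (card ?N)")
proof -
  let ?M = "{t \<in> nc_trees. leaves t = n \<and> tdeg (\<lambda>k. 2 * int k - 4) t = d}"
  have "free_comp ncHyperCom n d = (supp ?M :: ('k tree_vec) set)"
    by (auto simp: free_comp_def free_arity_nc supp_def)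
  moreover have "quot_dim (supp ?M) (op_ideal (ncHyperCom :: (nat, 'k) quadratic_data)) (card ?N)"
  proof (rule quot_dim_normal[OF assms])
    fix t assume t: "t \<in> ?M"
    have "{c \<in> nc_trees. normal c \<and> leaves c = leaves t \<and> vertices c = vertices t \<and> (c = t \<or> lower t c)} \<subseteq> ?N"
      using t by (auto simp: tdeg_nc)
    then show "(mon t :: 'k tree_vec) \<in> mod_supp (op_ideal ncHyperCom) ?N"
      using normal_form[of t] t subsetD[OF mod_supp_mono] by blast
  qed (auto simp: normal_in_trees)
  ultimately show ?thesis by (simp add: comp_dim_def)
qed

lemma arity_dim_nc:
  assumes "finite {t. normal t \<and> leaves t = n}"
  shows "arity_dim (ncHyperCom :: (nat, 'k::field) quadratic_data) n (card {t. normal t \<and> leaves t = n})"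
    (is "arity_dim _ n (card ?N)")
proof -
  let ?M = "{t \<in> nc_trees. leaves t = n}"
  have "free_arity ncHyperCom n = (supp ?M :: ('k tree_vec) set)"
    by (auto simp: free_arity_nc supp_def)
  moreover have "quot_dim (supp ?M) (op_ideal (ncHyperCom :: (nat, 'k) quadratic_data)) (card ?N)"
  proof (rule quot_dim_normal[OF assms])
    fix t assume t: "t \<in> ?M"
    then have "{c \<in> nc_trees. normal c \<and> leaves c = leaves t \<and> vertices c = vertices t \<and> (c = t \<or> lower t c)} \<subseteq> ?N"
      by auto
    then show "(mon t :: 'k tree_vec) \<in> mod_supp (op_ideal ncHyperCom) ?N"
      using normal_form[of t] t subsetD[OF mod_supp_mono] by blast
  qed (auto simp: normal_in_trees)
  ultimately show ?thesis by (simp add: arity_dim_def)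
qed

text \<open>By symmetry of binomials the left side is (n choose k + 1)(n - 2 choose k) / n.
  Absorption turns the upper indices n and n - 2 into n - 1.\<close>

lemma forest_number_narayana:
  assumes "2 \<le> n" "k < n - 1"
  shows "forest_number 1 (n - 1) (n - 1 - k) = 1 / real (n - 1) * real ((n - 1) choose k) * real ((n - 1) choose (k + 1))"
proof -
  define N where "N = n - 2"
  have n: "n = Suc (Suc N)" "k \<le> N" using assms by (auto simp: N_def)
  have "(Suc (Suc N) choose (Suc N - k)) = (Suc (Suc N) choose Suc k)" "(N choose (N - k)) = (N choose k)"
    using n binomial_symmetric[of "Suc k" "Suc (Suc N)"] binomial_symmetric[of k N] by auto
  then have "forest_number 1 (n - 1) (n - 1 - k) = 1 / (real N + 2) * real (Suc (Suc N) choose Suc k) * real (N choose k)"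
    using n by (simp add: forest_number_def Suc_diff_le del: binomial_Suc_Suc)
  moreover have "real (Suc (Suc N) choose Suc k) = (real N + 2) * real (Suc N choose k) / (real k + 1)"
    using Suc_times_binomial_real[of k "Suc N"]
    by (simp add: eq_divide_eq mult.commute add.commute del: binomial_Suc_Suc)
  moreover have "real (N choose k) = (real k + 1) * real (Suc N choose Suc k) / (real N + 1)"
    using Suc_times_binomial_real[of k N] by (simp add: eq_divide_eq mult.commute del: binomial_Suc_Suc)
  ultimately have "forest_number 1 (n - 1) (n - 1 - k) =
      1 / (real N + 2) * ((real N + 2) * real (Suc N choose k) / (real k + 1)) * ((real k + 1) * real (Suc N choose Suc k) / (real N + 1))"
    by (simp only:)
  also have "\<dots> = 1 / (real N + 1) * real (Suc N choose k) * real (Suc N choose Suc k)"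
    by (simp add: divide_simps del: binomial_Suc_Suc)
  finally show ?thesis using n by (simp del: binomial_Suc_Suc)
qed

text \<open>Replacing (n - 2 choose w - 1) by (n - 2 choose n - 1 - w) makes this a Vandermonde
  convolution.\<close>

lemma sum_forest_number:
  assumes "1 \<le> n"
  shows "(\<Sum>w<n. forest_number 1 (n - 1) w) = 1 / real n * real ((2 * n - 2) choose (n - 1))"
proof (cases "n = 1")
  case False
  define N where "N = n - 2"
  have n: "n = Suc (Suc N)" using assms False by (simp add: N_def)
  have "forest_number 1 (n - 1) w = 1 / real n * real ((n choose w) * (N choose (Suc N - w)))" if "w \<le> Suc N" for w
  proof (cases "w = 0")
    case False
    then have "(N choose (w - 1)) = (N choose (Suc N - w))" using that binomial_symmetric[of "w - 1" N] by simp
    then show ?thesis using False n by (simp add: forest_number_def del: binomial_Suc_Suc)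
  qed (simp add: forest_number_def n)
  moreover have "{..<n} = {..Suc N}" using n by auto
  ultimately have "(\<Sum>w<n. forest_number 1 (n - 1) w) = (\<Sum>w\<le>Suc N. 1 / real n * real ((n choose w) * (N choose (Suc N - w))))"
    by (intro sum.cong) auto
  also have "\<dots> = 1 / real n * real (\<Sum>w\<le>Suc N. (n choose w) * (N choose (Suc N - w)))"
    by (simp only: sum_distrib_left of_nat_sum)
  also have "(\<Sum>w\<le>Suc N. (n choose w) * (N choose (Suc N - w))) = (n + N) choose Suc N"
    by (rule vandermonde)
  finally show ?thesis using n by (simp add: mult_2 del: binomial_Suc_Suc)
qed (simp add: forest_number_def)

theorem theorem4p4p1:
  shows "koszul (ncHyperCom :: (nat, 'k::field) quadratic_data)
    \<and> (\<forall>(n::nat) (d::int). \<not> (even d \<and> d \<ge> 0) \<longrightarrow>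
         comp_dim (ncHyperCom :: (nat, 'k) quadratic_data) n d 0)
    \<and> (\<forall>(n::nat) (k::nat). n \<ge> 2 \<longrightarrow>
         (\<exists>m. comp_dim (ncHyperCom :: (nat, 'k) quadratic_data) n (2 * int k) m \<and>
              real m = 1 / real (n - 1) * real ((n - 1) choose k) * real ((n - 1) choose (k + 1))))
    \<and> (\<forall>n::nat. n \<ge> 1 \<longrightarrow>
         (\<exists>m. arity_dim (ncHyperCom :: (nat, 'k) quadratic_data) n m \<and>
              real m = 1 / real n * real ((2 * n - 2) choose (n - 1))))"
proof (intro conjI allI impI)
  show "koszul (ncHyperCom :: (nat, 'k) quadratic_data)" by (rule koszul_nc)
next
  fix n :: nat and d :: int assume d: "\<not> (even d \<and> d \<ge> 0)"
  have e: "{t. normal t \<and> leaves t = n \<and> tdeg (\<lambda>k. 2 * int k - 4) t = d} = {}"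
    using d even_tdeg tdeg_nonneg normal_in_trees by blast
  show "comp_dim (ncHyperCom :: (nat, 'k) quadratic_data) n d 0"
    using comp_dim_nc[where 'k = 'k, of n d] unfolding e by simp
next
  fix n k :: nat assume n: "2 \<le> n"
  let ?N = "{t. normal t \<and> leaves t = n \<and> tdeg (\<lambda>k. 2 * int k - 4) t = 2 * int k}"
  \<comment> \<open>Degree 2k means n - 1 - k vertices. The equation stays in the integers, so that
    k > n - 1 gives the empty set.\<close>
  have N: "?N = {t. normal t \<and> leaves t = n \<and> int (vertices t) = int n - 1 - int k}"
    using tdeg_nc normal_in_trees by auto
  have "finite ?N \<and> real (card ?N) = 1 / real (n - 1) * real ((n - 1) choose k) * real ((n - 1) choose (k + 1))"
  proof (cases "k \<le> n - 1")
    case True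
    then have "?N = normal_trees n (n - 1 - k)" unfolding N using n by (auto simp: normal_trees_def)
    moreover have "forest_number 1 (n - 1) (n - 1 - k) = 1 / real (n - 1) * real ((n - 1) choose k) * real ((n - 1) choose (k + 1))"
    \<comment> \<open>Here no vertex is left, while n >= 2 leaves need one; both sides are
      0.\<close>
    proof (cases "k = n - 1")
      case True
      then show ?thesis using n by (simp add: forest_number_def)
    next
      case False
      then show ?thesis using True n by (intro forest_number_narayana) auto
    qed
    ultimately show ?thesis using card_normal_trees[of n "n - 1 - k"] n by simp
  next
    case False
    then have e: "?N = {}" unfolding N using n by auto
    show ?thesis unfolding e using False by simp
  qed
  then show "\<exists>m. comp_dim (ncHyperCom :: (nat, 'k) quadratic_data) n (2 * int k) m \<and>
      real m = 1 / real (n - 1) * real ((n - 1) choose k) * real ((n - 1) choose (k + 1))"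
    using comp_dim_nc by blast
next
  fix n :: nat assume n: "1 \<le> n"
  let ?N = "{t. normal t \<and> leaves t = n}"
  \<comment> \<open>Nonnegativity of the degree 2(n - 1 - w) bounds the number w of
    vertices.\<close>
  have "vertices t < n" if "normal t" "leaves t = n" for t
    using tdeg_nonneg[of t] tdeg_nc[of t] normal_in_trees[of t] that by simp
  then have N: "?N = (\<Union>w<n. normal_trees n w)" by (auto simp: normal_trees_def)
  have "card (\<Union>w<n. normal_trees n w) = (\<Sum>w<n. card (normal_trees n w))"
    by (rule card_UN_disjoint) (auto simp: card_normal_trees[OF n], auto simp: normal_trees_def)
  then have "real (card ?N) = (\<Sum>w<n. forest_number 1 (n - 1) w)"
    unfolding N by (simp add: card_normal_trees[OF n])
  moreover have "finite ?N" unfolding N using card_normal_trees[OF n] by auto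
  ultimately show "\<exists>m. arity_dim (ncHyperCom :: (nat, 'k) quadratic_data) n m \<and>
      real m = 1 / real n * real ((2 * n - 2) choose (n - 1))"
    using arity_dim_nc sum_forest_number[OF n] by metis
qed

end
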